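(* Let $B=\frac{\sqrt6}{\pi}$. (1) Let $k_n$ be positive integers with $k_n=o(n^{1/4})$ and let $v_{2k-1}^{[j]}\in[0,\infty)$ for $1\le k\le k_n$, $j\in\{L,R\}$. Then $$\lim_{n\to\infty}\left(\mathbf P_n\left(\frac{(2k-1)X_{2k-1}^{[j]}}{B\sqrt n}\le v_{2k-1}^{[j]}\ \text{ for all }1\le k\le k_n,\ j\in\{L,R\}\right)-\prod_{\substack{1\le k\le k_n\\ j\in\{L,R\}}}\int_0^{v_{2k-1}^{[j]}}e^{-u}\,du\right)=0.$$ (2) Let $k=k_n$ be positive integers with $k_n=o(n^{1/2})$ and let $v^{[L]},v^{[R]}\in[0,\infty)$. Then $$\lim_{n\to\infty}\mathbf P_n\left(\frac{(2k-1)X_{2k-1}^{[L]}}{B\sqrt n}\le v^{[L]},\ \frac{(2k-1)X_{2k-1}^{[R]}}{B\sqrt n}\le v^{[R]}\right)=\left(1-e^{-v^{[L]}}\right)\left(1-e^{-v^{[R]}}\right).$$ (3) Let $c>0$, let $2k-1=\lfloor c\sqrt n\rfloor$ (with $n$ running through the integers for which $\lfloor c\sqrt n\rfloor$ is odd), and let $v^{[L]},v^{[R]}$ be nonnegative integers. Then $$\lim_{n\to\infty}\mathbf P_n\left(X_{2k-1}^{[L]}\le v^{[L]},\ X_{2k-1}^{[R]}\le v^{[R]}\right)=\left(1-e^{-\frac cB(v^{[L]}+1)}\right)\left(1-e^{-\frac cB(v^{[R]}+1)}\right).$$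
   Context: An odd unimodal sequence of size $n$ is a sequence of odd positive integers $a_1\le\dots\le a_r\le\bar c\ge b_1\ge\dots\ge b_s$ ($r,s\ge0$) with a distinguished peak $\bar c$ and $n=\bar c+\sum_{j=1}^r a_j+\sum_{j=1}^s b_j$. $\mathcal{OU}(n)$ is the set of odd unimodal sequences of size $n$ and $\mathbf P_n$ is the uniform probability measure on $\mathcal{OU}(n)$. For $\lambda\in\mathcal{OU}(n)$, $X_k^{[L]}(\lambda)$ (resp. $X_k^{[R]}(\lambda)$) is the number of parts equal to $k$ to the left (resp. right) of the peak. *)

theory Defs
  imports "HOL-Probability.Probability" "HOL-Library.Landau_Symbols"
begin

text \<open>
  A triple \<open>(as, c, bs)\<close> stands for the sequence \<open>as\<close>, peak \<open>c\<close>, \<open>bs\<close>; keeping the peak as a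
  separate component makes it distinguished even if its value also occurs in \<open>as\<close> or \<open>bs\<close>.
  Parts are positive because they are odd.
\<close>

type_synonym peaked_seq = "nat list \<times> nat \<times> nat list"

definition odd_unimodal :: "nat \<Rightarrow> peaked_seq set" where
  "odd_unimodal n =
     {(as, c, bs).
        odd c \<and> (\<forall>x \<in> set as. odd x) \<and> (\<forall>x \<in> set bs. odd x) \<and>
        sorted_wrt (\<le>) (as @ [c]) \<and> sorted_wrt (\<ge>) (c # bs) \<and>
        c + sum_list as + sum_list bs = n}"

datatype side = LeftSide | RightSide

fun num_parts :: "side \<Rightarrow> nat \<Rightarrow> peaked_seq \<Rightarrow> nat" where
  "num_parts LeftSide m (as, c, bs) = count_list as m"
| "num_parts RightSide m (as, c, bs) = count_list bs m"

text \<open>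
  For \<open>n = 0\<close> the set is empty and the value below is unspecified; the two lemmas at the end show
  that it is the uniform probability of the event for every \<open>n \<ge> 1\<close>.
\<close>

definition OU_prob :: "nat \<Rightarrow> (peaked_seq \<Rightarrow> bool) \<Rightarrow> real" where
  "OU_prob n E = measure_pmf.prob (pmf_of_set (odd_unimodal n)) {s. E s}"

lemma finite_odd_unimodal: "finite (odd_unimodal n)"
proof -
  have len: "length xs \<le> sum_list xs" if "\<forall>x \<in> set xs. odd x" for xs :: "nat list"
    using that by (induction xs) (auto elim: oddE)
  have elem: "set xs \<subseteq> {..n}" if "sum_list xs \<le> n" for xs :: "nat list"
    using that member_le_sum_list[of _ xs] by fastforce
  let ?S = "{xs :: nat list. set xs \<subseteq> {..n} \<and> length xs \<le> n}"
  have "odd_unimodal n \<subseteq> ?S \<times> {..n} \<times> ?S"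
  proof
    fix s assume "s \<in> odd_unimodal n"
    then obtain as c bs where s: "s = (as, c, bs)" and
      o: "\<forall>x \<in> set as. odd x" "\<forall>x \<in> set bs. odd x" and
      n: "c + sum_list as + sum_list bs = n"
      by (auto simp: odd_unimodal_def)
    show "s \<in> ?S \<times> {..n} \<times> ?S"
      using s n elem[of as] elem[of bs] len[OF o(1)] len[OF o(2)] by simp
  qed
  moreover have "finite (?S \<times> {..n} \<times> ?S)"
    by (intro finite_cartesian_product finite_lists_length_le) auto
  ultimately show ?thesis
    by (rule finite_subset)
qed

lemma odd_unimodal_nonempty:
  assumes "n \<ge> 1"
  shows "odd_unimodal n \<noteq> {}"
proof -
  have "(replicate (n - 1) 1, 1, []) \<in> odd_unimodal n"
    using assms by (auto simp: odd_unimodal_def sorted_wrt_append sorted_replicate sum_list_replicate)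
  then show ?thesis
    by blast
qed

end

theory Submission
  imports Defs "HOL-Real_Asymp.Real_Asymp"
begin

text \<open>
  Give a sequence of size \<open>N\<close> the Boltzmann weight \<open>q ^ N\<close> with \<open>q = exp (- 1 / \<tau>)\<close>,
  \<open>\<tau> = B * sqrt n\<close>; the uniform measure on sequences of size \<open>n\<close> is this law conditioned on
  \<open>N = n\<close>. Given the peak, the multiplicities of the parts are independent geometric variables,
  and the peak exceeds \<open>M = 3/4 * \<tau> * ln \<tau>\<close> outside a negligible set. The size is the sum of
  the contribution of a set \<open>D\<close> of constrained parts, of the peak and the parts above \<open>M\<close>, and
  of the other parts below \<open>M\<close>. The first two are \<open>o(\<tau> powr (3/2))\<close> in mean if
  \<open>card D = o(sqrt \<tau>)\<close>, while the last one satisfies a local limit theorem with standard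
  deviation of order \<open>\<tau> powr (3/2)\<close>, so that its point probabilities do not change on the scale
  of the first two. Hence conditioning on the size does not affect the law of the parts in \<open>D\<close>
  in the limit. The numbers of constrained and of all sequences are compared with the same
  normalisation, so its asymptotics is not needed.
\<close>

section \<open>Counting by generating functions\<close>

text \<open>The scale \<open>B * sqrt n\<close> is forced by the mean: under the Boltzmann law the
  parts have expected total size \<open>pi\<^sup>2 * \<tau>\<^sup>2 / 6\<close> to leading order,
  and this equals \<open>n\<close> for this \<tau>. The obstacle is the peak, which makes the
  generating function a sum of products, so that no single independent family is being conditioned.
  For all peaks that are at least \<open>M\<close>, however, the parts up to \<open>M\<close> give
  one common factor, and the local limit theorem is applied to that factor only. The coefficient 3/4
  in \<open>M\<close> lies strictly between 1/2 and 1, and both ends matter: with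
  \<open>M = a * \<tau> * ln \<tau>\<close> the parts above \<open>M\<close> contribute at most of
  order \<open>\<tau> powr (2 - a) * ln \<tau>\<close>, to be compared with
  \<open>\<tau> powr (3/2)\<close>, while the total weight of the peaks above \<open>M\<close> is at
  least exponential in a multiple of \<open>\<tau> powr (1 - a)\<close>, to be compared with powers
  of \<tau>. A constrained part contributes at most \<tau> per side in mean; hence
  \<open>card D = o(sqrt \<tau>)\<close>, and hence the exponent 1/4 in the first limit.\<close>

definition part_fps :: "nat set \<Rightarrow> nat \<Rightarrow> 'a::comm_semiring_1 fps" where
  "part_fps C j = Abs_fps (\<lambda>i. of_bool (j dvd i \<and> i div j \<in> C))"

definition restricted_msets :: "(nat \<Rightarrow> nat set) \<Rightarrow> nat set \<Rightarrow> nat \<Rightarrow> nat multiset set" where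
  "restricted_msets C J i = {X. set_mset X \<subseteq> J \<and> (\<forall>j\<in>J. count X j \<in> C j) \<and> \<Sum>\<^sub># X = i}"

lemma bij_betw_restricted_msets_insert:
  assumes "j \<notin> J" "j > 0"
  shows "bij_betw (\<lambda>(x, X). X + replicate_mset x j)
    (SIGMA x:{x \<in> C j. j * x \<le> i}. restricted_msets C J (i - j * x))
    (restricted_msets C (insert j J) i)"
proof (rule bij_betwI[where g = "\<lambda>X. (count X j, filter_mset (\<lambda>y. y \<noteq> j) X)"], goal_cases)
  case 1
  show ?case
  proof safe
    fix x X assume *: "x \<in> C j" "j * x \<le> i" "X \<in> restricted_msets C J (i - j * x)"
    hence "count X j = 0"
      using assms(1) by (auto simp: restricted_msets_def count_eq_zero_iff)
    moreover have "count (replicate_mset x j) m = 0" if "m \<in> J" for m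
      using that assms(1) by auto
    ultimately show "X + replicate_mset x j \<in> restricted_msets C (insert j J) i"
      using * by (auto simp: restricted_msets_def sum_mset_replicate_mset)
  qed
next
  case 2
  show ?case
  proof
    fix X assume X: "X \<in> restricted_msets C (insert j J) i"
    have dec: "X = filter_mset (\<lambda>y. y \<noteq> j) X + replicate_mset (count X j) j"
      by (intro multiset_eqI) auto
    have "\<Sum>\<^sub># X = \<Sum>\<^sub># (filter_mset (\<lambda>y. y \<noteq> j) X) + j * count X j"
      by (subst dec) (simp add: sum_mset_replicate_mset)
    thus "(count X j, filter_mset (\<lambda>y. y \<noteq> j) X)
      \<in> (SIGMA x:{x \<in> C j. j * x \<le> i}. restricted_msets C J (i - j * x))"
      using X assms(1) by (auto simp: restricted_msets_def)
  qed
next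
  case (3 z)
  obtain x X where z: "z = (x, X)" by (cases z)
  have nj: "j \<notin># X"
    using 3 assms(1) by (auto simp: z restricted_msets_def)
  hence "filter_mset (\<lambda>y. y \<noteq> j) X = X"
    by (auto simp: filter_mset_eq_conv)
  moreover have "filter_mset (\<lambda>y. y \<noteq> j) (replicate_mset x j) = {#}"
    by (induction x) auto
  ultimately show ?case using nj by (simp add: z count_eq_zero_iff)
next
  case (4 X)
  show ?case by (auto intro!: multiset_eqI)
qed

text \<open>Peeling off one part \<open>j\<close> turns the coefficient of the product into a sum
  over the multiplicity of \<open>j\<close>. Finiteness is carried through the same induction
  because the cardinality of the dependent sum is additive only over finite fibres.\<close>

lemma fps_nth_prod_part_fps_aux:
  assumes "finite J" "0 \<notin> J"
  shows "finite (restricted_msets C J i) \<and>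
    fps_nth (\<Prod>j\<in>J. part_fps (C j) j) i = (of_nat (card (restricted_msets C J i)) :: 'a::comm_semiring_1)"
  using assms
proof (induction J arbitrary: i rule: finite_induct)
  case empty
  have "restricted_msets C {} i = (if i = 0 then {{#}} else {})"
    by (auto simp: restricted_msets_def)
  thus ?case
    by simp
next
  case (insert j J)
  have j: "j > 0" and J: "0 \<notin> J" using insert.prems by auto
  note bij = bij_betw_restricted_msets_insert[OF insert.hyps(2) j, of C i]
  have fin: "finite {x \<in> C j. j * x \<le> i}"
  proof (rule finite_subset)
    show "{x \<in> C j. j * x \<le> i} \<subseteq> {..i}"
    proof safe
      fix x assume "j * x \<le> i"
      moreover have "1 * x \<le> j * x" using j by (intro mult_right_mono) auto
      ultimately show "x \<le> i" by linarith
    qed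
  qed auto
  have IH: "\<And>i. finite (restricted_msets C J i)"
    "\<And>i. fps_nth (\<Prod>j\<in>J. part_fps (C j) j) i = (of_nat (card (restricted_msets C J i)) :: 'a)"
    using insert.IH J by auto
  have "fps_nth (\<Prod>j\<in>insert j J. part_fps (C j) j) i =
      (\<Sum>l=0..i. of_bool (j dvd l \<and> l div j \<in> C j) *
         (of_nat (card (restricted_msets C J (i - l))) :: 'a))"
    using insert.hyps by (simp add: fps_mult_nth IH) (simp add: part_fps_def)
  also have "\<dots> = (\<Sum>l\<in>{l\<in>{0..i}. j dvd l \<and> l div j \<in> C j}.
        (of_nat (card (restricted_msets C J (i - l))) :: 'a))"
    by (rule sum.mono_neutral_cong_right) auto
  also have "\<dots> = (\<Sum>x\<in>{x \<in> C j. j * x \<le> i}. of_nat (card (restricted_msets C J (i - j * x))))"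
    by (rule sum.reindex_bij_witness[of _ "\<lambda>x. j * x" "\<lambda>l. l div j"]) (use j in auto)
  also have "\<dots> = of_nat (card (SIGMA x:{x \<in> C j. j * x \<le> i}. restricted_msets C J (i - j * x)))"
    using fin IH(1) by (subst card_SigmaI) auto
  also have "\<dots> = of_nat (card (restricted_msets C (insert j J) i))"
    using bij_betw_same_card[OF bij] by simp
  finally show ?case
    using bij_betw_finite[OF bij] fin IH(1) by auto
qed

text \<open>The semiring does not occur in the finiteness half, so its type variable is fixed
  arbitrarily as \<open>nat\<close>.\<close>

lemmas finite_restricted_msets = fps_nth_prod_part_fps_aux[where 'a = nat, THEN conjunct1]
  and fps_nth_prod_part_fps = fps_nth_prod_part_fps_aux[THEN conjunct2]

definition restricted_lists :: "(nat \<Rightarrow> nat set) \<Rightarrow> nat set \<Rightarrow> nat \<Rightarrow> nat list set" where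
  "restricted_lists C J i =
     {xs. sorted xs \<and> set xs \<subseteq> J \<and> (\<forall>j\<in>J. count_list xs j \<in> C j) \<and> sum_list xs = i}"

lemma bij_betw_restricted_lists: "bij_betw mset (restricted_lists C J i) (restricted_msets C J i)"
proof (rule bij_betwI[where g = sorted_list_of_multiset], goal_cases)
  case 1
  show ?case
    by (auto simp: restricted_lists_def restricted_msets_def sum_mset_sum_list count_mset)
next
  case 2
  show ?case
    by (auto simp: restricted_lists_def restricted_msets_def
        simp flip: sum_mset_sum_list count_mset)
next
  case (3 xs)
  thus ?case by (simp add: restricted_lists_def sorted_sort_id)
qed simp

definition odds_upto :: "nat \<Rightarrow> nat set" where
  "odds_upto c = {j. odd j \<and> j \<le> c}"

lemma finite_odds_upto [simp, intro]: "finite (odds_upto c)"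
  by (rule finite_subset[of _ "{..c}"]) (auto simp: odds_upto_def)

lemma zero_notin_odds_upto [simp]: "0 \<notin> odds_upto c"
  by (auto simp: odds_upto_def)

text \<open>Requiring \<open>0 \<in> C j m\<close> makes the constraints vacuous for parts exceeding the peak.\<close>
lemma card_odd_unimodal_restricted:
  fixes C :: "side \<Rightarrow> nat \<Rightarrow> nat set"
  assumes C0: "\<And>j m. 0 \<in> C j m"
  shows "of_nat (card {s \<in> odd_unimodal n. \<forall>j m. num_parts j m s \<in> C j m}) =
    (\<Sum>c\<in>odds_upto n. fps_nth ((\<Prod>m\<in>odds_upto c. part_fps (C LeftSide m) m) *
       (\<Prod>m\<in>odds_upto c. part_fps (C RightSide m) m)) (n - c) :: 'a::comm_semiring_1)"
proof -
  let ?S = "{s \<in> odd_unimodal n. \<forall>j m. num_parts j m s \<in> C j m}"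
  let ?L = "\<lambda>c i. restricted_lists (C LeftSide) (odds_upto c) i"
  let ?R = "\<lambda>c i. restricted_lists (C RightSide) (odds_upto c) i"
  let ?T = "SIGMA c:odds_upto n. SIGMA i:{0..n-c}. ?L c i \<times> ?R c (n - c - i)"
  have mem: "xs \<in> restricted_lists (C j) (odds_upto c) i \<longleftrightarrow> sorted xs \<and> (\<forall>x\<in>set xs. odd x) \<and>
      (\<forall>x\<in>set xs. x \<le> c) \<and> (\<forall>m. count_list xs m \<in> C j m) \<and> sum_list xs = i" for xs j c i
  proof -
    have "count_list xs m \<in> C j m"
      if "set xs \<subseteq> odds_upto c" "\<forall>m\<in>odds_upto c. count_list xs m \<in> C j m" for m
    proof (cases "m \<in> odds_upto c")
      case False
      hence "m \<notin> set xs" using that(1) by blast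
      thus ?thesis using C0 by (simp add: count_notin)
    qed (use that in auto)
    thus ?thesis by (auto simp: restricted_lists_def) (auto simp: odds_upto_def subset_iff)
  qed
  have S: "(as, c, bs) \<in> ?S \<longleftrightarrow> c \<in> odds_upto n \<and> sum_list as \<le> n - c \<and> as \<in> ?L c (sum_list as) \<and>
      rev bs \<in> ?R c (n - c - sum_list as)" for as c bs
  proof -
    have all_side: "(\<forall>j. P j) \<longleftrightarrow> P LeftSide \<and> P RightSide" for P
      by (metis side.exhaust)
    have e: "(\<forall>j m. num_parts j m (as, c, bs) \<in> C j m) \<longleftrightarrow>
        (\<forall>m. count_list as m \<in> C LeftSide m) \<and> (\<forall>m. count_list (rev bs) m \<in> C RightSide m)"
      by (simp add: all_side)
    have e': "c + sum_list as + sum_list bs = n \<longleftrightarrow>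
        c \<le> n \<and> sum_list as \<le> n - c \<and> sum_list (rev bs) = n - c - sum_list as"
      by (auto simp: sum_list_rev)
    have e'': "sorted_wrt (\<le>) (as @ [c]) \<longleftrightarrow> sorted as \<and> (\<forall>x\<in>set as. x \<le> c)"
      "sorted_wrt (\<ge>) (c # bs) \<longleftrightarrow> sorted (rev bs) \<and> (\<forall>x\<in>set bs. x \<le> c)"
      by (auto simp: sorted_wrt_append sorted_wrt_rev)
    show ?thesis
      unfolding mem unfolding mem_Collect_eq odd_unimodal_def odds_upto_def prod.case set_rev e e' e''
      by (simp only: conj_ac simp_thms)
  qed
  have sumL: "sum_list xs = i" if "xs \<in> restricted_lists C' J i" for xs C' J i
    using that by (simp add: restricted_lists_def)
  \<comment> \<open>The parts to the right of the peak are stored in decreasing order; reversing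
    them makes both sides sorted lists that represent multisets of odd numbers up to the
    peak.\<close>
  have "bij_betw (\<lambda>(c, i, as, bs). (as, c, rev bs)) ?T ?S"
  proof (rule bij_betwI[where g = "\<lambda>(as, c, bs). (c, sum_list as, as, rev bs)"], goal_cases)
    case 1
    show ?case
    proof
      fix x assume "x \<in> ?T"
      then obtain c i as bs where x: "x = (c, i, as, bs)" "c \<in> odds_upto n" "i \<le> n - c"
        "as \<in> ?L c i" "bs \<in> ?R c (n - c - i)" by auto
      have "(as, c, rev bs) \<in> ?S"
        unfolding S using x sumL[OF x(4)] by simp
      thus "(case x of (c, i, as, bs) \<Rightarrow> (as, c, rev bs)) \<in> ?S" by (simp only: x(1) prod.case)
    qed
  next
    case 2
    show ?case
    proof
      fix x assume *: "x \<in> ?S"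
      obtain as c bs where x: "x = (as, c, bs)" by (cases x)
      show "(case x of (as, c, bs) \<Rightarrow> (c, sum_list as, as, rev bs)) \<in> ?T"
        using * unfolding x S by simp
    qed
  next
    case (3 x)
    thus ?case by (auto dest: sumL)
  next
    case (4 x)
    thus ?case by (cases x) simp
  qed
  from bij_betw_same_card[OF this] have eq: "card ?S = card ?T" by simp
  have finL: "finite (restricted_lists C' (odds_upto c) i)" for C' c i
    using bij_betw_finite[OF bij_betw_restricted_lists, of C' "odds_upto c" i]
      finite_restricted_msets[of "odds_upto c" C' i] by auto
  have card: "of_nat (card (restricted_lists C' (odds_upto c) i)) =
      (fps_nth (\<Prod>m\<in>odds_upto c. part_fps (C' m) m) i :: 'a)" for C' c i
    using bij_betw_same_card[OF bij_betw_restricted_lists, of C' "odds_upto c" i]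
      fps_nth_prod_part_fps[of "odds_upto c" C' i, where 'a = 'a] by auto
  have "card ?T = (\<Sum>c\<in>odds_upto n. card (SIGMA i:{0..n-c}. ?L c i \<times> ?R c (n - c - i)))"
    by (rule card_SigmaI) (auto simp: finL)
  also have "\<dots> = (\<Sum>c\<in>odds_upto n. \<Sum>i=0..n-c. card (?L c i \<times> ?R c (n - c - i)))"
    by (intro sum.cong refl card_SigmaI) (auto simp: finL)
  finally have "(of_nat (card ?S) :: 'a) = (\<Sum>c\<in>odds_upto n. \<Sum>i=0..n-c.
      of_nat (card (?L c i)) * of_nat (card (?R c (n - c - i))))"
    unfolding eq by (simp add: card_cartesian_product)
  thus ?thesis
    unfolding card fps_mult_nth .
qed

section \<open>Values of the factors inside the unit disc\<close>

abbreviation geom_fps :: "nat \<Rightarrow> 'a::comm_semiring_1 fps" where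
  "geom_fps \<equiv> part_fps UNIV"

lemma fps_conv_radius_part_fps:
  "fps_conv_radius (part_fps C j :: 'a::{banach,real_normed_field} fps) \<ge> 1"
proof -
  have "1 \<le> conv_radius (\<lambda>i. of_bool (j dvd i \<and> i div j \<in> C) :: 'a)"
  proof (rule conv_radius_geI_ex')
    fix r :: real assume r: "0 < r" "ereal r < 1"
    show "summable (\<lambda>i. of_bool (j dvd i \<and> i div j \<in> C) * of_real r ^ i :: 'a)"
    proof (rule summable_comparison_test')
      show "summable (\<lambda>i. r ^ i)"
        using r by (intro summable_geometric) auto
      show "norm (of_bool (j dvd i \<and> i div j \<in> C) * of_real r ^ i :: 'a) \<le> r ^ i" if "i \<ge> 0" for i
        using r by (auto simp: norm_power)
    qed
  qed
  thus ?thesis by (simp add: part_fps_def fps_conv_radius_def)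
qed

lemma fps_conv_radius_mult_ge:
  fixes f g :: "'a::{banach,real_normed_field} fps"
  assumes "fps_conv_radius f \<ge> r" "fps_conv_radius g \<ge> r"
  shows "fps_conv_radius (f * g) \<ge> r"
  using fps_conv_radius_mult[of f g] assms by (meson min.boundedI order_trans)

lemma fps_conv_radius_prod_ge:
  fixes f :: "'b \<Rightarrow> 'a::{banach,real_normed_field} fps"
  assumes "\<And>j. j \<in> J \<Longrightarrow> fps_conv_radius (f j) \<ge> r"
  shows "fps_conv_radius (\<Prod>j\<in>J. f j) \<ge> r"
  using assms by (induction J rule: infinite_finite_induct) (auto intro: fps_conv_radius_mult_ge)

lemma eval_fps_prod:
  fixes f :: "'b \<Rightarrow> 'a::{banach,real_normed_field} fps"
  assumes "\<And>j. j \<in> J \<Longrightarrow> fps_conv_radius (f j) \<ge> 1" "norm z < 1"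
  shows "eval_fps (\<Prod>j\<in>J. f j) z = (\<Prod>j\<in>J. eval_fps (f j) z)"
  using assms(1)
proof (induction J rule: infinite_finite_induct)
  case (insert j J)
  have lt: "ereal (norm z) < fps_conv_radius f" if "fps_conv_radius f \<ge> 1" for f :: "'a fps"
    using assms(2) that by (metis ereal_less(3) ereal_less_eq(3) less_le_trans one_ereal_def less_ereal.simps(1))
  show ?case
    using insert by (simp add: eval_fps_mult lt fps_conv_radius_prod_ge)
qed auto

text \<open>Reindexing along \<open>x \<mapsto> j * x\<close>. The weight \<open>c\<close> stays
  free because the constant 1 yields the value of the series and \<open>of_nat\<close> yields its
  derivative.\<close>

lemma sums_part_fps:
  fixes z :: "'a::{banach,real_normed_field}"
  assumes "j > 0"
  shows "(\<lambda>x. of_bool (x \<in> C) * (c (j * x) * z ^ (j * x))) sums S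
    \<longleftrightarrow> (\<lambda>i. c i * fps_nth (part_fps C j) i * z ^ i) sums S"
proof -
  have "strict_mono (\<lambda>x. j * x)" using assms by (auto simp: strict_mono_def)
  from sums_mono_reindex[OF this, of "\<lambda>i. c i * fps_nth (part_fps C j) i * z ^ i" S]
  show ?thesis using assms by (auto simp: part_fps_def mult_ac image_iff dvd_def)
qed

lemma eval_geom_fps:
  fixes z :: "'a::{banach,real_normed_field}"
  assumes "j > 0" "norm z < 1"
  shows "eval_fps (geom_fps j) z = 1 / (1 - z ^ j)"
proof -
  have "norm (z ^ j) < 1" using assms by (simp add: norm_power power_less_one_iff)
  from geometric_sums[OF this] have "(\<lambda>x. z ^ (j * x)) sums (1 / (1 - z ^ j))"
    by (simp add: power_mult)
  with sums_part_fps[OF assms(1), of UNIV "\<lambda>_. 1" z "1 / (1 - z ^ j)"] show ?thesis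
    unfolding eval_fps_def by (simp add: sums_iff)
qed

text \<open>Divided by the unrestricted factor \<open>1 / (1 - z ^ j)\<close> this leaves
  \<open>1 - z ^ (j * (a + 1))\<close>, the probability that a geometric variable with ratio
  \<open>z ^ j\<close> is at most \<open>a\<close>.\<close>

lemma eval_part_fps_atMost:
  fixes z :: "'a::{banach,real_normed_field}"
  assumes "j > 0" "norm z < 1"
  shows "eval_fps (part_fps {..a} j) z = (1 - z ^ (j * (a + 1))) / (1 - z ^ j)"
proof -
  have "norm (z ^ j) < 1" using assms by (simp add: norm_power power_less_one_iff)
  hence ne: "z ^ j \<noteq> 1" by auto
  have "(\<lambda>x. of_bool (x \<in> {..a}) * z ^ (j * x)) sums (\<Sum>x\<le>a. of_bool (x \<in> {..a}) * z ^ (j * x))"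
    by (rule sums_finite) auto
  also have "(\<Sum>x\<le>a. of_bool (x \<in> {..a}) * z ^ (j * x)) = (\<Sum>x<Suc a. (z ^ j) ^ x)"
    by (intro sum.cong) (auto simp: power_mult)
  also have "\<dots> = (1 - z ^ (j * (a + 1))) / (1 - z ^ j)"
    unfolding power_mult Suc_eq_plus1 using ne
    by (subst geometric_sum) (auto simp: divide_simps algebra_simps)
  finally show ?thesis
    using sums_part_fps[OF assms(1), of "{..a}" "\<lambda>_. 1" z "(1 - z ^ (j * (a + 1))) / (1 - z ^ j)"]
    unfolding eval_fps_def by (simp add: sums_iff)
qed


lemma ereal_norm_less_radius:
  assumes "norm z < 1" "fps_conv_radius f \<ge> 1"
  shows "ereal (norm z) < fps_conv_radius f"
  using assms by (metis less_le_trans less_ereal.simps(1) one_ereal_def)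

text \<open>\<open>fps_X * fps_deriv f\<close> multiplies the \<open>i\<close>-th coefficient by \<open>i\<close>, so its value at \<open>x\<close>
  divided by that of \<open>f\<close> is the mean of the Boltzmann distribution of \<open>f\<close> at \<open>x\<close>.\<close>
lemma eval_fps_X_deriv_geom_fps:
  fixes z :: "'a::{banach,real_normed_field}"
  assumes "j > 0" "norm z < 1"
  shows "eval_fps (fps_X * fps_deriv (geom_fps j)) z = of_nat j * z ^ j / (1 - z ^ j)\<^sup>2"
proof -
  have "norm (z ^ j) < 1" using assms by (simp add: norm_power power_less_one_iff)
  from sums_mult[OF geometric_deriv_sums[OF this], of "of_nat j * z ^ j"]
  have "(\<lambda>x. of_nat j * z ^ j * (of_nat (Suc x) * (z ^ j) ^ x)) sums (of_nat j * z ^ j / (1 - z ^ j)\<^sup>2)"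
    by simp
  also have "(\<lambda>x. of_nat j * z ^ j * (of_nat (Suc x) * (z ^ j) ^ x)) =
      (\<lambda>x. of_nat (j * Suc x) * z ^ (j * Suc x))"
    by (simp only: power_mult power_Suc of_nat_mult mult_ac)
  finally have "(\<lambda>x. of_nat (j * Suc x) * z ^ (j * Suc x)) sums (of_nat j * z ^ j / (1 - z ^ j)\<^sup>2)" .
  hence "(\<lambda>x. of_nat (j * x) * z ^ (j * x)) sums (of_nat j * z ^ j / (1 - z ^ j)\<^sup>2)"
    by (subst (asm) sums_Suc_iff) simp
  with sums_part_fps[OF assms(1), of UNIV of_nat z "of_nat j * z ^ j / (1 - z ^ j)\<^sup>2"]
  have "(\<lambda>i. of_nat i * fps_nth (geom_fps j) i * z ^ i) sums (of_nat j * z ^ j / (1 - z ^ j)\<^sup>2)"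
    by simp
  moreover have "fps_nth (fps_X * fps_deriv (geom_fps j)) i = (of_nat i * fps_nth (geom_fps j) i :: 'a)" for i
    by (cases i) (auto simp: fps_X_mult_nth)
  ultimately show ?thesis unfolding eval_fps_def by (simp add: sums_iff)
qed

text \<open>The Euler operator \<open>fps_X * fps_deriv\<close> is a derivation.\<close>

lemma eval_fps_X_deriv_mult:
  fixes f g :: "'a::{banach,real_normed_field} fps"
  assumes "fps_conv_radius f \<ge> 1" "fps_conv_radius g \<ge> 1" "norm z < 1"
  shows "eval_fps (fps_X * fps_deriv (f * g)) z =
    eval_fps (fps_X * fps_deriv f) z * eval_fps g z + eval_fps f z * eval_fps (fps_X * fps_deriv g) z"
proof -
  have r: "fps_conv_radius (fps_X * fps_deriv f) \<ge> 1" if "fps_conv_radius f \<ge> 1" for f :: "'a fps"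
    using that fps_conv_radius_deriv[of f] by (intro fps_conv_radius_mult_ge) (auto intro: order_trans)
  have "fps_X * fps_deriv (f * g) = fps_X * fps_deriv f * g + f * (fps_X * fps_deriv g)"
    by (simp add: algebra_simps)
  thus ?thesis
    using assms by (simp only:) (subst eval_fps_add; (subst eval_fps_mult)?; (subst eval_fps_mult)?;
      simp add: ereal_norm_less_radius fps_conv_radius_mult_ge r)
qed

text \<open>Logarithmic differentiation: the mean of a sum of independent variables is the sum of
  their means, the factor 2 standing for the two sides of the peak.\<close>

lemma eval_fps_X_deriv_prod_geom_fps:
  fixes z :: "'a::{banach,real_normed_field}"
  assumes "finite J" "0 \<notin> J" "norm z < 1"
  shows "eval_fps (fps_X * fps_deriv (\<Prod>j\<in>J. geom_fps j * geom_fps j)) z =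
    (\<Prod>j\<in>J. 1 / (1 - z ^ j)\<^sup>2) * (\<Sum>j\<in>J. 2 * of_nat j * z ^ j / (1 - z ^ j))"
  using assms(1,2)
proof (induction J rule: finite_induct)
  case (insert j J)
  hence j: "j > 0" by auto
  have "norm (z ^ j) < 1" using assms j by (simp add: norm_power power_less_one_iff)
  hence ne: "1 - z ^ j \<noteq> 0" by auto
  have ev: "eval_fps (geom_fps i * geom_fps i) z = 1 / (1 - z ^ i)\<^sup>2" if "i > 0" for i
    using that assms(3) ereal_norm_less_radius[OF assms(3) fps_conv_radius_part_fps]
    by (subst eval_fps_mult) (auto simp: eval_geom_fps power2_eq_square)
  have evp: "eval_fps (\<Prod>j\<in>J. geom_fps j * geom_fps j) z = (\<Prod>j\<in>J. 1 / (1 - z ^ j)\<^sup>2)"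
    using insert assms(3) by (subst eval_fps_prod)
      (auto intro!: fps_conv_radius_mult_ge fps_conv_radius_part_fps prod.cong ev Nat.gr0I)
  have d: "eval_fps (fps_X * fps_deriv (geom_fps j * geom_fps j)) z =
      1 / (1 - z ^ j)\<^sup>2 * (2 * of_nat j * z ^ j / (1 - z ^ j))"
    using j assms(3) ne
    by (subst eval_fps_X_deriv_mult)
      (auto simp: fps_conv_radius_part_fps eval_geom_fps eval_fps_X_deriv_geom_fps power2_eq_square field_simps)
  have "eval_fps (fps_X * fps_deriv (\<Prod>j\<in>insert j J. geom_fps j * geom_fps j)) z =
    eval_fps (fps_X * fps_deriv (geom_fps j * geom_fps j)) z * eval_fps (\<Prod>j\<in>J. geom_fps j * geom_fps j) z +
    eval_fps (geom_fps j * geom_fps j) z * eval_fps (fps_X * fps_deriv (\<Prod>j\<in>J. geom_fps j * geom_fps j)) z"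
    using insert.hyps assms(3) by (subst prod.insert, simp, simp, subst eval_fps_X_deriv_mult)
      (auto intro!: fps_conv_radius_mult_ge fps_conv_radius_part_fps fps_conv_radius_prod_ge)
  also have "\<dots> = (\<Prod>j\<in>insert j J. 1 / (1 - z ^ j)\<^sup>2) * (\<Sum>j\<in>insert j J. 2 * of_nat j * z ^ j / (1 - z ^ j))"
    unfolding d ev[OF j] evp using insert by (simp add: algebra_simps)
  finally show ?case .
qed auto

section \<open>Fourier inversion\<close>

lemma cis_integral:
  fixes k :: int
  shows "(LBINT \<theta>:{-pi..pi}. cis (of_int k * \<theta>)) = (if k = 0 then 2 * pi else 0)"
    and "set_integrable lborel {-pi..pi} (\<lambda>\<theta>. cis (of_int k * \<theta>))"
proof -
  show "set_integrable lborel {-pi..pi} (\<lambda>\<theta>. cis (of_int k * \<theta>))"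
    by (intro borel_integrable_atLeastAtMost') (auto intro!: continuous_intros)
  show "(LBINT \<theta>:{-pi..pi}. cis (of_int k * \<theta>)) = (if k = 0 then 2 * pi else 0)"
  proof (cases "k = 0")
    case True
    thus ?thesis by (simp add: set_lebesgue_integral_def scaleR_conv_of_real)
  next
    case False
    define F where "F = (\<lambda>\<theta>. cis (of_int k * \<theta>) / (\<i> * of_int k))"
    have "((\<lambda>\<theta>. cis (of_int k * \<theta>)) has_vector_derivative
        (of_int k * (\<i> * cis (of_int k * x)))) (at x within {-pi..pi})" for x
    proof -
      have "((\<lambda>\<theta>. exp (\<i> * (of_int k * of_real \<theta>))) has_vector_derivative
          (of_int k * (\<i> * exp (\<i> * (of_int k * of_real x))))) (at x within {-pi..pi})"
        by (auto intro!: derivative_eq_intros has_vector_derivative_real_field simp: field_simps)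
      thus ?thesis by (simp add: cis_conv_exp mult_ac)
    qed
    hence "(F has_vector_derivative cis (of_int k * x)) (at x within {-pi..pi})" for x
      unfolding F_def using False
      by (intro has_vector_derivative_eq_rhs[OF has_vector_derivative_divide]) auto
    hence "(LBINT \<theta>:{-pi..pi}. cis (of_int k * \<theta>)) = F pi - F (- pi)"
      unfolding set_lebesgue_integral_def
      by (intro integral_FTC_atLeastAtMost) (auto intro!: continuous_intros)
    also have "cis (of_int k * pi) = cis (- (of_int k * pi))"
      by (simp add: complex_eq_iff mult.commute)
    hence "F pi - F (-pi) = 0" by (simp add: F_def)
    finally show ?thesis using False by simp
  qed
qed

text \<open>Cauchy's coefficient formula on the circle of radius \<open>q\<close>, by orthogonality
  of the characters. Absolute convergence at \<open>q\<close> dominates all angles at once, which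
  permits exchanging series and integral.\<close>

lemma fps_nth_fourier:
  fixes f :: "complex fps"
  assumes "0 < q" "ereal q < fps_conv_radius f"
  shows "fps_nth f n * of_real (q ^ n) =
    (LBINT \<theta>:{-pi..pi}. eval_fps f (of_real q * cis \<theta>) * cis (- (real n * \<theta>))) / (2 * pi)"
proof -
  define g where "g = (\<lambda>i (\<theta>::real). indicat_real {-pi..pi} \<theta> *\<^sub>R
     (fps_nth f i * of_real (q ^ i) * cis (of_int (int i - int n) * \<theta>)))"
  have sm: "summable (\<lambda>i. norm (fps_nth f i * of_real q ^ i))"
    using assms abs_summable_in_conv_radius[of "of_real q" "fps_nth f"]
    by (simp add: fps_conv_radius_def)
  have int: "integrable lborel (g i)" for i
    using set_integrable_mult_right[OF cis_integral(2)[of "int i - int n"]]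
    unfolding g_def set_integrable_def by simp
  have norm_g: "norm (g i \<theta>) = indicat_real {-pi..pi} \<theta> * norm (fps_nth f i * of_real q ^ i)" for i \<theta>
    by (simp add: g_def norm_mult norm_power)
  have "(\<lambda>i. integral\<^sup>L lborel (g i)) sums (\<integral>\<theta>. (\<Sum>i. g i \<theta>) \<partial>lborel)"
  proof (rule sums_integral[OF int])
    show "AE x in lborel. summable (\<lambda>i. norm (g i x))"
      unfolding norm_g using sm by (intro AE_I2 summable_mult)
    have "(\<integral>x. norm (g i x) \<partial>lborel) = 2 * pi * norm (fps_nth f i * of_real q ^ i)" for i
      unfolding norm_g by simp
    thus "summable (\<lambda>i. \<integral>x. norm (g i x) \<partial>lborel)"
      using summable_mult[OF sm, of "2 * pi"] by simp
  qed
  moreover have "integral\<^sup>L lborel (g i) = (if i = n then 2 * pi * (fps_nth f n * of_real (q ^ n)) else 0)" for i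
  proof -
    have "integral\<^sup>L lborel (g i) = (LBINT \<theta>:{-pi..pi}.
        fps_nth f i * of_real (q ^ i) * cis (of_int (int i - int n) * \<theta>))"
      unfolding g_def set_lebesgue_integral_def by (rule refl)
    also have "\<dots> = fps_nth f i * of_real (q ^ i) * (LBINT \<theta>:{-pi..pi}. cis (of_int (int i - int n) * \<theta>))"
      by (rule set_integral_mult_right)
    finally show ?thesis unfolding cis_integral(1) by simp
  qed
  moreover have "(\<lambda>i. if i = n then 2 * pi * (fps_nth f n * of_real (q ^ n)) else 0) sums
      (2 * pi * (fps_nth f n * of_real (q ^ n)))"
    using sums_single[of n "\<lambda>_. 2 * pi * (fps_nth f n * of_real (q ^ n))"] by simp
  ultimately have "2 * pi * (fps_nth f n * of_real (q ^ n)) = (\<integral>\<theta>. (\<Sum>i. g i \<theta>) \<partial>lborel)"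
    using sums_unique2 by (simp cong: if_cong)
  also have "(\<lambda>\<theta>. \<Sum>i. g i \<theta>) = (\<lambda>\<theta>. indicat_real {-pi..pi} \<theta> *\<^sub>R
      (eval_fps f (of_real q * cis \<theta>) * cis (- (real n * \<theta>))))"
  proof
    fix \<theta>
    have "(\<lambda>i. fps_nth f i * (of_real q * cis \<theta>) ^ i) sums eval_fps f (of_real q * cis \<theta>)"
      by (rule sums_eval_fps) (use assms in \<open>simp add: norm_mult\<close>)
    from sums_scaleR_right[OF sums_mult2[OF this, of "cis (- (real n * \<theta>))"], of "indicat_real {-pi..pi} \<theta>"]
    have "(\<lambda>i. g i \<theta>) sums (indicat_real {-pi..pi} \<theta> *\<^sub>R
      (eval_fps f (of_real q * cis \<theta>) * cis (- (real n * \<theta>))))"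
    proof (rule sums_cong[THEN iffD1, rotated])
      fix i
      have "cis \<theta> ^ i * cis (- (real n * \<theta>)) = cis (of_int (int i - int n) * \<theta>)"
        by (simp add: Complex.DeMoivre cis_mult algebra_simps)
      thus "indicat_real {-pi..pi} \<theta> *\<^sub>R (fps_nth f i * (of_real q * cis \<theta>) ^ i * cis (- (real n * \<theta>)))
        = g i \<theta>"
        by (simp add: g_def power_mult_distrib mult.assoc)
    qed
    thus "(\<Sum>i. g i \<theta>) = indicat_real {-pi..pi} \<theta> *\<^sub>R
      (eval_fps f (of_real q * cis \<theta>) * cis (- (real n * \<theta>)))"
      by (simp add: sums_iff)
  qed
  finally show ?thesis
    by (simp add: set_lebesgue_integral_def field_simps)
qed

section \<open>Cumulant expansion of the geometric distribution\<close>

lemma sums_nat_mult_power: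
  fixes p :: real
  assumes "\<bar>p\<bar> < 1"
  shows "(\<lambda>n. real n * p ^ n) sums (p / (1 - p)\<^sup>2)"
proof -
  have "(\<lambda>n. real (Suc n) * p ^ n) sums (1 / (1 - p)\<^sup>2)"
    using geometric_deriv_sums[of p] assms by simp
  from sums_mult[OF this, of p] have "(\<lambda>n. real (Suc n) * p ^ Suc n) sums (p / (1 - p)\<^sup>2)"
    by (simp add: mult_ac del: of_nat_Suc)
  thus ?thesis by (subst (asm) sums_Suc_iff) simp
qed

text \<open>The Cauchy product of the series with terms \<open>(n + 1) * p ^ n\<close> and
  \<open>p ^ n\<close> has the coefficients \<open>(k + 1) * (k + 2) / 2\<close>, and after an index
  shift \<open>(k + 1)\<^sup>2 \<le> (k + 1) * (k + 2)\<close>. The bound serves the cubic remainder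
  of the cumulant expansion.\<close>

lemma sum_square_mult_power_le:
  fixes p :: real
  assumes "0 < p" "p < 1"
  shows "summable (\<lambda>n. (real n)\<^sup>2 * p ^ n)" "(\<Sum>n. (real n)\<^sup>2 * p ^ n) \<le> 2 * p / (1 - p) ^ 3"
proof -
  have 1: "(\<lambda>n. real (Suc n) * p ^ n) sums (1 / (1 - p)\<^sup>2)"
    using geometric_deriv_sums[of p] assms by simp
  have 2: "(\<lambda>n. p ^ n) sums (1 / (1 - p))"
    using geometric_sums[of p] assms by simp
  have "(\<lambda>k. \<Sum>i\<le>k. real (Suc i) * p ^ i * p ^ (k - i)) sums
      ((\<Sum>n. real (Suc n) * p ^ n) * (\<Sum>n. p ^ n))"
    by (rule Cauchy_product_sums)
      (use 1 2 assms in \<open>simp_all add: abs_mult sums_iff del: of_nat_Suc\<close>)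
  also have "(\<Sum>n. real (Suc n) * p ^ n) * (\<Sum>n. p ^ n) = 1 / (1 - p) ^ 3"
    using 1 2 by (simp add: sums_iff power3_eq_cube power2_eq_square)
  also have "(\<lambda>k. \<Sum>i\<le>k. real (Suc i) * p ^ i * p ^ (k - i)) =
      (\<lambda>k. (real k + 1) * (real k + 2) / 2 * p ^ k)"
  proof
    fix k
    have "(\<Sum>i\<le>k. real (Suc i) * p ^ i * p ^ (k - i)) = (\<Sum>i\<le>k. real (Suc i)) * p ^ k"
      by (simp add: sum_distrib_right mult.assoc flip: power_add)
    also have "(\<Sum>i\<le>k. real (Suc i)) = (real k + 1) * (real k + 2) / 2"
      by (induction k) (auto simp: field_simps)
    finally show "(\<Sum>i\<le>k. real (Suc i) * p ^ i * p ^ (k - i)) = (real k + 1) * (real k + 2) / 2 * p ^ k" .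
  qed
  finally have "(\<lambda>k. (real k + 1) * (real k + 2) / 2 * p ^ k) sums (1 / (1 - p) ^ 3)" .
  from sums_mult[OF this, of "2 * p"]
  have "(\<lambda>n. 2 * p * ((real n + 1) * (real n + 2) / 2 * p ^ n)) sums (2 * p / (1 - p) ^ 3)"
    by simp
  also have "(\<lambda>n. 2 * p * ((real n + 1) * (real n + 2) / 2 * p ^ n)) =
      (\<lambda>k. (real k + 1) * (real k + 2) * p ^ Suc k)"
    by (simp add: fun_eq_iff)
  finally have 3: "(\<lambda>k. (real k + 1) * (real k + 2) * p ^ Suc k) sums (2 * p / (1 - p) ^ 3)" .
  have le: "(real (Suc k))\<^sup>2 * p ^ Suc k \<le> (real k + 1) * (real k + 2) * p ^ Suc k" for k
    using assms by (intro mult_right_mono) (auto simp: power2_eq_square algebra_simps)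
  have sm: "summable (\<lambda>k. (real (Suc k))\<^sup>2 * p ^ Suc k)"
    by (rule summable_comparison_test'[OF sums_summable[OF 3]]) (use le assms in auto)
  thus sm': "summable (\<lambda>n. (real n)\<^sup>2 * p ^ n)"
    by (subst (asm) summable_Suc_iff)
  have "(\<Sum>n. (real n)\<^sup>2 * p ^ n) = (\<Sum>k. (real (Suc k))\<^sup>2 * p ^ Suc k)"
    using suminf_split_head[OF sm'] by simp
  also have "\<dots> \<le> (\<Sum>k. (real k + 1) * (real k + 2) * p ^ Suc k)"
    by (rule suminf_le[OF le sm sums_summable[OF 3]])
  also have "\<dots> = 2 * p / (1 - p) ^ 3" using 3 by (simp add: sums_iff)
  finally show "(\<Sum>n. (real n)\<^sup>2 * p ^ n) \<le> 2 * p / (1 - p) ^ 3" .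
qed

lemma sums_ln_one_minus:
  fixes z :: complex
  assumes "norm z < 1"
  shows "(\<lambda>n. z ^ n / of_nat n) sums (- ln (1 - z))"
proof -
  have "(\<lambda>n. (-1) ^ Suc n / of_nat n * (- z) ^ n) sums ln (1 + (- z))"
    by (rule Ln_series) (use assms in simp)
  from sums_minus[OF this] show ?thesis
    by (simp add: power_minus[of z] flip: power_add mult.assoc)
qed

text \<open>The geometric distribution is compound Poisson: its characteristic function is
  \<open>exp (\<Sum>n. p ^ n / n * (cis (n * u) - 1))\<close>.\<close>
lemma geometric_char_exp:
  fixes p u :: real
  assumes p: "0 < p" "p < 1"
  obtains w :: complex where
    "exp w = (1 - p) / (1 - p * cis u)"
    "Re w \<le> - (p * (1 - cos u))"
    "norm (w - (\<i> * (u * (p / (1 - p))) - u\<^sup>2 / 2 * (p / (1 - p)\<^sup>2))) \<le> \<bar>u\<bar> ^ 3 * (p / (1 - p) ^ 3) / 3"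
proof
  define w where "w = ln (1 - complex_of_real p) - ln (1 - p * cis u)"
  define a where "a = (\<lambda>n. complex_of_real (p ^ n / real n) * (cis (real n * u) - 1))"
  have nrm: "norm (p * cis u) < 1" "norm (complex_of_real p) < 1"
    using p by (auto simp: norm_mult)
  have nz: "1 - p * cis u \<noteq> 0" "1 - complex_of_real p \<noteq> 0"
    using nrm by auto
  show "exp w = (1 - p) / (1 - p * cis u)"
    using nz by (simp add: w_def exp_diff)
  have "(\<lambda>n. (p * cis u) ^ n / of_nat n - of_real p ^ n / of_nat n) sums (- ln (1 - p * cis u) - (- ln (1 - of_real p)))"
    by (intro sums_diff sums_ln_one_minus nrm)
  also have "(\<lambda>n. (p * cis u) ^ n / of_nat n - of_real p ^ n / of_nat n) = a"
    by (simp add: a_def fun_eq_iff power_mult_distrib Complex.DeMoivre right_diff_distrib diff_divide_distrib)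
  finally have a: "a sums w" by (simp add: w_def)
  have "(\<lambda>n. - Re (a n)) sums (- Re w)"
    by (intro sums_minus sums_Re a)
  hence r: "(\<lambda>n. p ^ n / real n * (1 - cos (real n * u))) sums (- Re w)"
    by (simp add: a_def right_diff_distrib diff_divide_distrib)
  \<comment> \<open>All terms of the series for \<open>- Re w\<close> are nonnegative, so the term
    with index 1 alone is a lower bound.\<close>
  have "(\<Sum>n\<in>{1}. p ^ n / real n * (1 - cos (real n * u))) \<le> - Re w"
    using r p by (intro sum_le_suminf[of _ "{1}", THEN order_trans[OF _ eq_refl[OF sums_unique[OF r, symmetric]]]])
      (auto simp: sums_iff)
  thus "Re w \<le> - (p * (1 - cos u))" by simp
  \<comment> \<open>\<open>b n\<close> is the quadratic Taylor polynomial of \<open>a n\<close> in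
    \<open>u\<close>. At index 0 division by zero makes \<open>a 0 = 0\<close>, so the linear term
    has to be cut off there.\<close>
  define b where "b = (\<lambda>n. (\<i> * of_real u) * of_real (if n = 0 then 0 else p ^ n) -
     of_real (u\<^sup>2 / 2) * complex_of_real (real n * p ^ n))"
  have "(\<lambda>n. p ^ Suc n) sums (p / (1 - p))"
    using sums_mult[OF geometric_sums[of p], of p] p by simp
  hence "(\<lambda>n. if n = 0 then 0 else p ^ n) sums (p / (1 - p))"
    using sums_Suc_iff[of "\<lambda>n. if n = 0 then 0 else p ^ n" "p / (1 - p)"] by simp
  hence b: "b sums (\<i> * u * of_real (p / (1 - p)) - of_real (u\<^sup>2 / 2) * of_real (p / (1 - p)\<^sup>2))"
    unfolding b_def using p
    by (intro sums_diff sums_mult sums_of_real sums_nat_mult_power) auto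
  have ab: "norm (a n - b n) \<le> \<bar>u\<bar> ^ 3 / 6 * ((real n)\<^sup>2 * p ^ n)" for n
  proof (cases "n = 0")
    case True
    thus ?thesis by (simp add: a_def b_def)
  next
    case False
    define x where "x = real n * u"
    have "norm (iexp x - (\<Sum>k\<le>2. (\<i> * x) ^ k / fact k)) \<le> \<bar>x\<bar> ^ 3 / 6"
      using iexp_approx1[of x 2] by (simp add: eval_nat_numeral)
    also have "(\<Sum>k\<le>2. (\<i> * x) ^ k / fact k) = 1 + \<i> * x - x\<^sup>2 / 2"
      by (simp add: eval_nat_numeral power_mult_distrib)
    finally have *: "norm (cis x - 1 - \<i> * x + x\<^sup>2 / 2) \<le> \<bar>x\<bar> ^ 3 / 6"
      by (simp add: cis_conv_exp algebra_simps)
    have "a n - b n = of_real (p ^ n / real n) * (cis x - 1 - \<i> * x + x\<^sup>2 / 2)"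
      using False by (simp add: a_def b_def x_def field_simps power2_eq_square)
    hence "norm (a n - b n) \<le> p ^ n / real n * (\<bar>x\<bar> ^ 3 / 6)"
      using mult_left_mono[OF *, of "p ^ n / real n"] p
      by (simp add: norm_mult norm_divide norm_power)
    also have "\<dots> = \<bar>u\<bar> ^ 3 / 6 * ((real n)\<^sup>2 * p ^ n)"
      using False by (simp add: x_def abs_mult power_mult_distrib eval_nat_numeral)
    finally show ?thesis .
  qed
  note sq = sum_square_mult_power_le[OF p]
  have "norm (w - (\<i> * u * of_real (p / (1 - p)) - of_real (u\<^sup>2 / 2) * of_real (p / (1 - p)\<^sup>2)))
      = norm (\<Sum>n. a n - b n)"
    using sums_diff[OF a b] by (simp add: sums_iff)
  also have "\<dots> \<le> (\<Sum>n. \<bar>u\<bar> ^ 3 / 6 * ((real n)\<^sup>2 * p ^ n))"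
    by (rule norm_suminf_le[OF ab summable_mult[OF sq(1)]])
  also have "\<dots> = \<bar>u\<bar> ^ 3 / 6 * (\<Sum>n. (real n)\<^sup>2 * p ^ n)"
    by (rule suminf_mult[OF sq(1)])
  also have "\<dots> \<le> \<bar>u\<bar> ^ 3 / 6 * (2 * p / (1 - p) ^ 3)"
    by (intro mult_left_mono sq(2)) auto
  finally show "norm (w - (\<i> * (u * (p / (1 - p))) - u\<^sup>2 / 2 * (p / (1 - p)\<^sup>2))) \<le> \<bar>u\<bar> ^ 3 * (p / (1 - p) ^ 3) / 3"
    by (simp add: mult_ac)
qed

text \<open>\<open>W\<close> is twice the sum of the logarithms of the single factors, not
  \<open>ln\<close> of the product: the principal branch could jump and would lose the expansion.
  Doubling accounts for the two sides.\<close>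

lemma prod_geometric_char_exp:
  fixes q \<theta> :: real and J :: "nat set"
  assumes "finite J" "0 \<notin> J" "0 < q" "q < 1"
  obtains W :: complex where
    "exp W = (\<Prod>j\<in>J. (1 - q ^ j) / (1 - (q * cis \<theta>) ^ j))\<^sup>2"
    "Re W \<le> - 2 * (\<Sum>j\<in>J. q ^ j * (1 - cos (real j * \<theta>)))"
    "norm (W - (\<i> * \<theta> * (\<Sum>j\<in>J. 2 * real j * q ^ j / (1 - q ^ j)) -
       \<theta>\<^sup>2 / 2 * (\<Sum>j\<in>J. 2 * (real j)\<^sup>2 * q ^ j / (1 - q ^ j)\<^sup>2)))
      \<le> \<bar>\<theta>\<bar> ^ 3 * (\<Sum>j\<in>J. real j ^ 3 * q ^ j / (1 - q ^ j) ^ 3)"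
proof -
  have "\<exists>w. exp w = (1 - q ^ j) / (1 - (q * cis \<theta>) ^ j) \<and>
    Re w \<le> - (q ^ j * (1 - cos (real j * \<theta>))) \<and>
    norm (w - (\<i> * \<theta> * (real j * q ^ j / (1 - q ^ j)) - \<theta>\<^sup>2 / 2 * ((real j)\<^sup>2 * q ^ j / (1 - q ^ j)\<^sup>2)))
      \<le> \<bar>\<theta>\<bar> ^ 3 * (real j ^ 3 * q ^ j / (1 - q ^ j) ^ 3) / 3" if "j \<in> J" for j
  proof -
    have "j > 0" using that assms(2) by (auto intro: Nat.gr0I)
    hence "0 < q ^ j" "q ^ j < 1" using assms by (auto simp: power_less_one_iff)
    then obtain w where w: "exp w = (1 - q ^ j) / (1 - (q ^ j) * cis (real j * \<theta>))"
      "Re w \<le> - (q ^ j * (1 - cos (real j * \<theta>)))"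
      "norm (w - (\<i> * (real j * \<theta> * (q ^ j / (1 - q ^ j))) - (real j * \<theta>)\<^sup>2 / 2 * (q ^ j / (1 - q ^ j)\<^sup>2)))
         \<le> \<bar>real j * \<theta>\<bar> ^ 3 * (q ^ j / (1 - q ^ j) ^ 3) / 3"
      using geometric_char_exp[of "q ^ j" "real j * \<theta>"] by blast
    show ?thesis
    proof (intro exI[of _ w] conjI)
      have "(q * cis \<theta>) ^ j = (q ^ j) * cis (real j * \<theta>)"
        by (simp add: power_mult_distrib Complex.DeMoivre)
      thus "exp w = (1 - q ^ j) / (1 - (q * cis \<theta>) ^ j)" using w(1) by simp
    qed (use w(2,3) in \<open>simp_all add: power_mult_distrib abs_mult mult_ac\<close>)
  qed
  then obtain w where w: "exp (w j) = (1 - q ^ j) / (1 - (q * cis \<theta>) ^ j)"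
    "Re (w j) \<le> - (q ^ j * (1 - cos (real j * \<theta>)))"
    "norm (w j - (\<i> * \<theta> * (real j * q ^ j / (1 - q ^ j)) - \<theta>\<^sup>2 / 2 * ((real j)\<^sup>2 * q ^ j / (1 - q ^ j)\<^sup>2)))
      \<le> \<bar>\<theta>\<bar> ^ 3 * (real j ^ 3 * q ^ j / (1 - q ^ j) ^ 3) / 3" if "j \<in> J" for j
    by metis
  show ?thesis
  proof (rule that[of "2 * (\<Sum>j\<in>J. w j)"])
    show "exp (2 * (\<Sum>j\<in>J. w j)) = (\<Prod>j\<in>J. (1 - q ^ j) / (1 - (q * cis \<theta>) ^ j))\<^sup>2"
      using assms(1) w(1) by (simp add: exp_double exp_sum)
    show "Re (2 * (\<Sum>j\<in>J. w j)) \<le> - 2 * (\<Sum>j\<in>J. q ^ j * (1 - cos (real j * \<theta>)))"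
      using sum_mono[of J "\<lambda>j. Re (w j)", OF w(2)] by (simp add: sum_negf)
    have "norm (2 * (\<Sum>j\<in>J. w j) - (\<i> * \<theta> * (\<Sum>j\<in>J. 2 * real j * q ^ j / (1 - q ^ j)) -
       \<theta>\<^sup>2 / 2 * (\<Sum>j\<in>J. 2 * (real j)\<^sup>2 * q ^ j / (1 - q ^ j)\<^sup>2)))
      = norm (\<Sum>j\<in>J. 2 * (w j - (\<i> * \<theta> * (real j * q ^ j / (1 - q ^ j)) - \<theta>\<^sup>2 / 2 * ((real j)\<^sup>2 * q ^ j / (1 - q ^ j)\<^sup>2))))"
      by (rule arg_cong[of _ _ norm])
        (simp add: sum_subtractf sum.distrib sum_distrib_left sum_distrib_right algebra_simps)
    also have "\<dots> \<le> (\<Sum>j\<in>J. \<bar>\<theta>\<bar> ^ 3 * (real j ^ 3 * q ^ j / (1 - q ^ j) ^ 3))"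
    proof (rule sum_norm_le)
      fix j assume j: "j \<in> J"
      have "q ^ j \<le> 1" using assms by (simp add: power_le_one)
      hence "0 \<le> \<bar>\<theta>\<bar> ^ 3 * (real j ^ 3 * q ^ j / (1 - q ^ j) ^ 3)" using assms by simp
      thus "norm (2 * (w j - (\<i> * \<theta> * (real j * q ^ j / (1 - q ^ j)) - \<theta>\<^sup>2 / 2 * ((real j)\<^sup>2 * q ^ j / (1 - q ^ j)\<^sup>2))))
        \<le> \<bar>\<theta>\<bar> ^ 3 * (real j ^ 3 * q ^ j / (1 - q ^ j) ^ 3)"
        using w(3)[OF j] unfolding norm_mult by simp
    qed
    finally show "norm (2 * (\<Sum>j\<in>J. w j) - (\<i> * \<theta> * (\<Sum>j\<in>J. 2 * real j * q ^ j / (1 - q ^ j)) -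
       \<theta>\<^sup>2 / 2 * (\<Sum>j\<in>J. 2 * (real j)\<^sup>2 * q ^ j / (1 - q ^ j)\<^sup>2)))
      \<le> \<bar>\<theta>\<bar> ^ 3 * (\<Sum>j\<in>J. real j ^ 3 * q ^ j / (1 - q ^ j) ^ 3)"
      by (simp add: sum_distrib_left)
  qed
qed

section \<open>Decay of the characteristic function\<close>

text \<open>Jordan's inequality: the sine is concave on \<open>{0..pi/2}\<close> and so lies above
  its chord.\<close>

lemma sin_ge_two_pi:
  fixes x :: real
  assumes "0 \<le> x" "x \<le> pi / 2"
  shows "2 * x / pi \<le> sin x"
proof -
  have "concave_on {0..pi/2} (sin :: real \<Rightarrow> real)"
  proof (rule f''_le0_imp_concave)
    fix x :: real assume "x \<in> {0..pi/2}"
    thus "- sin x \<le> 0" by (auto intro!: sin_ge_zero)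
    show "(sin has_real_derivative cos x) (at x)" "(cos has_real_derivative - sin x) (at x)"
      by (auto intro!: derivative_eq_intros)
  qed auto
  from concave_onD[OF this, of "2 * x / pi" 0 "pi / 2"] assms show ?thesis
    by (simp add: field_simps)
qed

lemma one_minus_cos_ge:
  fixes x :: real
  assumes "0 \<le> x" "x \<le> pi"
  shows "2 * x\<^sup>2 / pi\<^sup>2 \<le> 1 - cos x"
proof -
  have "(x / pi)\<^sup>2 \<le> (sin (x / 2))\<^sup>2"
    using sin_ge_two_pi[of "x / 2"] assms by (intro power_mono) auto
  moreover have "cos x = 1 - 2 * (sin (x / 2))\<^sup>2"
    using cos_double_sin[of "x / 2"] by simp
  ultimately show ?thesis by (simp add: power_divide)
qed

text \<open>Multiplication by \<open>2 * sin x\<close> makes the sum telescope.\<close>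

lemma sum_cos_odd:
  fixes x :: real
  shows "2 * sin x * (\<Sum>i<N. cos (real (2 * i + 1) * x)) = sin (2 * real N * x)"
proof (induction N)
  case (Suc N)
  have "2 * sin x * cos (real (2 * N + 1) * x) =
      sin (real (2 * N + 1) * x + x) - sin (real (2 * N + 1) * x - x)"
    by (simp add: sin_add sin_diff)
  moreover have "real (2 * N + 1) * x + x = 2 * real (Suc N) * x" "real (2 * N + 1) * x - x = 2 * real N * x"
    by (simp_all add: algebra_simps)
  ultimately show ?case using Suc by (simp add: distrib_left)
qed simp

lemma sum_odd_squares: "(\<Sum>i<N. (real (2 * i + 1))\<^sup>2) = (4 * real N ^ 3 - real N) / 3"
  by (induction N) (auto simp: field_simps power2_eq_square power3_eq_cube)

text \<open>Close to 0 the quadratic lower bound applies to every term. Elsewhere the closed form of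
  the cosine sum is at most \<open>N / 2\<close>. A second resonance at \<open>pi\<close> does not
  occur, since odd multiples of \<open>pi\<close> have cosine -1; this is where oddness of the parts
  helps. Leaving out an eighth of the indices costs at most \<open>N / 4\<close> in the second case
  and \<open>N ^ 3 / 2\<close> in the sum of squares in the first, which is affordable.\<close>

lemma sum_one_minus_cos_odd_ge:
  fixes x :: real
  assumes x: "\<bar>x\<bar> \<le> pi" and A: "A \<subseteq> {..<N}" "8 * card ({..<N} - A) \<le> N"
  shows "(\<Sum>i\<in>A. 1 - cos (real (2 * i + 1) * x)) \<ge> min (real N / 4) (real N ^ 3 * x\<^sup>2 / pi\<^sup>2)"
proof (cases "N = 0")
  case True
  with A show ?thesis by simp
next
  case False
  define y where "y = \<bar>x\<bar>"
  have y: "0 \<le> y" "y \<le> pi" using x by (auto simp: y_def)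
  have cosy: "cos (real j * x) = cos (real j * y)" for j
    by (cases "x \<ge> 0") (auto simp: y_def)
  have fin: "finite A" using A(1) finite_subset by blast
  have card8: "real (card ({..<N} - A)) \<le> real N / 8"
    using A(2) by linarith
  have split: "(\<Sum>i\<in>A. f i) = (\<Sum>i<N. f i) - (\<Sum>i\<in>{..<N} - A. f i)" for f :: "nat \<Rightarrow> real"
    using sum.subset_diff[OF A(1), of f] by simp
  \<comment> \<open>Below this threshold all \<open>(2 * i + 1) * y\<close> with
    \<open>i < N\<close> stay within \<open>{0..pi}\<close>, the range of
    \<open>one_minus_cos_ge\<close>; above it \<open>sin y \<ge> 1 / N\<close> unless
    \<open>y\<close> is close to \<open>pi\<close>.\<close>
  show ?thesis
  proof (cases "y < pi / (2 * real N)")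
    case True
    have "(\<Sum>i\<in>A. 2 * (real (2 * i + 1) * y)\<^sup>2 / pi\<^sup>2) \<le> (\<Sum>i\<in>A. 1 - cos (real (2 * i + 1) * x))"
    proof (rule sum_mono)
      fix i assume "i \<in> A"
      hence "i < N" using A(1) by auto
      hence "real (2 * i + 1) \<le> 2 * real N" by linarith
      hence "real (2 * i + 1) * y \<le> 2 * real N * (pi / (2 * real N))"
        using y True by (intro mult_mono) auto
      also have "\<dots> = pi" using False by simp
      finally show "2 * (real (2 * i + 1) * y)\<^sup>2 / pi\<^sup>2 \<le> 1 - cos (real (2 * i + 1) * x)"
        unfolding cosy using y by (intro one_minus_cos_ge) auto
    qed
    also have "(\<Sum>i\<in>A. 2 * (real (2 * i + 1) * y)\<^sup>2 / pi\<^sup>2) = 2 * y\<^sup>2 / pi\<^sup>2 * (\<Sum>i\<in>A. (real (2 * i + 1))\<^sup>2)"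
      by (simp add: sum_distrib_left power_mult_distrib mult_ac flip: sum_divide_distrib)
    finally have 1: "2 * y\<^sup>2 / pi\<^sup>2 * (\<Sum>i\<in>A. (real (2 * i + 1))\<^sup>2) \<le> (\<Sum>i\<in>A. 1 - cos (real (2 * i + 1) * x))" .
    have "(\<Sum>i\<in>{..<N} - A. (real (2 * i + 1))\<^sup>2) \<le> real (card ({..<N} - A)) * (2 * real N)\<^sup>2"
    proof (rule sum_bounded_above)
      fix i assume "i \<in> {..<N} - A"
      hence "real (2 * i + 1) \<le> 2 * real N" by auto
      thus "(real (2 * i + 1))\<^sup>2 \<le> (2 * real N)\<^sup>2" by (intro power_mono) auto
    qed
    also have "\<dots> \<le> real N / 8 * (2 * real N)\<^sup>2"
      using card8 by (intro mult_right_mono) auto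
    also have "\<dots> = real N ^ 3 / 2" by (simp add: power2_eq_square power3_eq_cube)
    finally have "(\<Sum>i\<in>A. (real (2 * i + 1))\<^sup>2) \<ge> (4 * real N ^ 3 - real N) / 3 - real N ^ 3 / 2"
      unfolding split sum_odd_squares by simp
    moreover have "real N \<le> real N ^ 3"
      using False by (intro self_le_power) auto
    moreover have "b / 2 \<le> c" if "(4 * b - a) / 3 - b / 2 \<le> c" "a \<le> b" for a b c :: real
      using that by (simp add: field_simps)
    ultimately have "(\<Sum>i\<in>A. (real (2 * i + 1))\<^sup>2) \<ge> real N ^ 3 / 2" by blast
    hence "2 * y\<^sup>2 / pi\<^sup>2 * (real N ^ 3 / 2) \<le> 2 * y\<^sup>2 / pi\<^sup>2 * (\<Sum>i\<in>A. (real (2 * i + 1))\<^sup>2)"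
      by (intro mult_left_mono) auto
    with 1 have "real N ^ 3 * x\<^sup>2 / pi\<^sup>2 \<le> (\<Sum>i\<in>A. 1 - cos (real (2 * i + 1) * x))"
      by (simp add: y_def mult_ac)
    thus ?thesis by linarith
  next
    case y2: False
    define S where "S = (\<Sum>i<N. cos (real (2 * i + 1) * y))"
    have S: "2 * sin y * S = sin (2 * real N * y)"
      unfolding S_def by (rule sum_cos_odd)
    have "S \<le> real N / 2"
    proof (cases "y \<le> pi / 2")
      case True
      have "1 / real N \<le> 2 * y / pi" using y2 False by (simp add: field_simps)
      also have "\<dots> \<le> sin y" using y True by (intro sin_ge_two_pi) auto
      finally have s: "1 / real N \<le> sin y" .
      show ?thesis
      proof (rule ccontr)
        assume "\<not> ?thesis"
        hence "2 * (1 / real N) * (real N / 2) < 2 * sin y * S"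
          using s False by (intro mult_le_less_imp_less) auto
        thus False using S sin_le_one[of "2 * real N * y"] False by simp
      qed
    next
      case gt: False
      \<comment> \<open>Reflection at \<open>pi\<close> keeps the sine but changes the sign of
        \<open>sin (2 * N * y)\<close>, so that close to \<open>pi\<close> the cosine sum is not
        positive.\<close>
      define z where "z = pi - y"
      have z: "0 \<le> z" "z < pi / 2" using gt y by (auto simp: z_def)
      have siny: "sin y = sin z" by (simp add: z_def)
      have "2 * real N * y = real (2 * N) * pi - 2 * real N * z"
        by (simp add: z_def algebra_simps)
      moreover have "sin (real (2 * N) * pi) = 0"
        using sin_npi[of "2 * N"] by simp
      moreover have "cos (real (2 * N) * pi) = 1"
        using cos_npi[of "2 * N"] by simp
      ultimately have sin2: "sin (2 * real N * y) = - sin (2 * real N * z)"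
        by (simp only: sin_diff)
      show ?thesis
      proof (cases "z < pi / (2 * real N)")
        case True
        show ?thesis
        proof (cases "z = 0")
          case True
          have "S \<le> (\<Sum>i<N. 0)" unfolding S_def
          proof (rule sum_mono)
            fix i
            have "real (2 * i + 1) * y = real (2 * i + 1) * pi" using True by (simp add: z_def)
            also have "cos \<dots> = -1" by (subst cos_npi) simp
            finally show "cos (real (2 * i + 1) * y) \<le> 0" by simp
          qed
          thus ?thesis by simp
        next
          case nz: False
          have "2 * real N * z \<le> pi" using True False by (simp add: field_simps)
          hence "sin (2 * real N * z) \<ge> 0" using z by (intro sin_ge_zero) auto
          moreover have "sin z > 0" using z nz by (intro sin_gt_zero) auto
          ultimately have "S \<le> 0" using S siny sin2
            by (metis mult_pos_pos neg_le_0_iff_le not_le zero_less_numeral)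
          thus ?thesis by (simp add: order_trans)
        qed
      next
        case z2: False
        have "1 / real N \<le> 2 * z / pi" using z2 False by (simp add: field_simps)
        also have "\<dots> \<le> sin y" unfolding siny using z by (intro sin_ge_two_pi) auto
        finally have s: "1 / real N \<le> sin y" .
        show ?thesis
        proof (rule ccontr)
          assume "\<not> ?thesis"
          hence "2 * (1 / real N) * (real N / 2) < 2 * sin y * S"
            using s False by (intro mult_le_less_imp_less) auto
          thus False using S sin_le_one[of "2 * real N * y"] False by simp
        qed
      qed
    qed
    have "(\<Sum>i\<in>{..<N} - A. 1 - cos (real (2 * i + 1) * x)) \<le> real (card ({..<N} - A)) * 2"
    proof (rule sum_bounded_above)
      fix i show "1 - cos (real (2 * i + 1) * x) \<le> 2"
        using cos_ge_minus_one[of "real (2 * i + 1) * x"] by linarith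
    qed
    hence "(\<Sum>i\<in>{..<N} - A. 1 - cos (real (2 * i + 1) * x)) \<le> real N / 4"
      using card8 by linarith
    moreover have "(\<Sum>i<N. 1 - cos (real (2 * i + 1) * x)) = real N - S"
      unfolding cosy S_def by (simp add: sum_subtractf)
    ultimately have "(\<Sum>i\<in>A. 1 - cos (real (2 * i + 1) * x)) \<ge> real N / 4"
      unfolding split using \<open>S \<le> real N / 2\<close> by linarith
    thus ?thesis by linarith
  qed
qed

section \<open>A local limit theorem\<close>

lemma integrable_inverse_one_plus_square: "integrable lborel (\<lambda>x::real. inverse (1 + x\<^sup>2))"
  using integrable_inverse_1_plus_square by (simp add: set_integrable_def)

lemma fourier_std_normal_density:
  "(\<integral>x. of_real (std_normal_density x) * cis (y * x) \<partial>lborel) = of_real (exp (- y\<^sup>2 / 2))"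
proof -
  have "char std_normal_distribution y = (\<integral>x. std_normal_density x *\<^sub>R iexp (y * x) \<partial>lborel)"
    unfolding char_def by (subst integral_density) auto
  thus ?thesis
    by (simp add: char_std_normal_distribution scaleR_conv_of_real cis_conv_exp)
qed

text \<open>Provides the integrable majorant, the same for all \<open>n\<close>, for dominated
  convergence. In the Gaussian regime \<open>V \<le> C * \<tau> ^ 3\<close> gives an exponent of at
  least \<open>a / C * x\<^sup>2\<close>. In the other regime
  \<open>x\<^sup>2 \<le> pi\<^sup>2 * V \<le> 10 * C * \<tau> ^ 3\<close>, which
  \<open>exp (a * \<tau>)\<close> absorbs by its cubic Taylor term; 60 is 10 times 3!.\<close>

lemma gaussian_norm_bound:
  fixes a C \<tau> V x :: real
  assumes "a > 0" "C > 0" "\<tau> > 0" "V > 0" "V \<le> C * \<tau> ^ 3" "\<bar>x\<bar> \<le> pi * sqrt V"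
  shows "exp (- min (a * \<tau> ^ 3 * (x / sqrt V)\<^sup>2) (a * \<tau>)) \<le> (1 + C / a + 60 * C / a ^ 3) * inverse (1 + x\<^sup>2)"
proof -
  define K where "K = 1 + C / a + 60 * C / a ^ 3"
  have pos: "1 + x\<^sup>2 > 0" by (simp add: add_pos_nonneg)
  have "exp (- (a * \<tau> ^ 3 * (x / sqrt V)\<^sup>2)) * (1 + x\<^sup>2) \<le> K"
  proof -
    have "a * \<tau> ^ 3 * (x / sqrt V)\<^sup>2 = a * x\<^sup>2 * (\<tau> ^ 3 / V)"
      using assms by (simp add: power_divide)
    also have "\<dots> \<ge> a * x\<^sup>2 * (1 / C)"
      using assms by (intro mult_left_mono) (auto simp: field_simps)
    finally have "exp (- (a * \<tau> ^ 3 * (x / sqrt V)\<^sup>2)) \<le> exp (- (a / C * x\<^sup>2))" by simp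
    also have "\<dots> \<le> 1 / (1 + a / C * x\<^sup>2)"
      using exp_ge_add_one_self[of "a / C * x\<^sup>2"] assms
      by (simp add: exp_minus divide_simps add_pos_nonneg mult.commute)
    finally have "exp (- (a * \<tau> ^ 3 * (x / sqrt V)\<^sup>2)) * (1 + x\<^sup>2) \<le> 1 / (1 + a / C * x\<^sup>2) * (1 + x\<^sup>2)"
      using pos by (intro mult_right_mono) auto
    also have "\<dots> \<le> 1 + C / a"
    proof -
      have "1 + x\<^sup>2 \<le> (1 + C / a) * (1 + a / C * x\<^sup>2)"
        using assms by (simp add: field_simps)
      thus ?thesis using assms by (simp add: divide_le_eq add_pos_nonneg)
    qed
    also have "\<dots> \<le> K" using assms by (simp add: K_def)
    finally show ?thesis .
  qed
  moreover have "exp (- (a * \<tau>)) * (1 + x\<^sup>2) \<le> K"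
  proof -
    have "x\<^sup>2 \<le> (pi * sqrt V)\<^sup>2" using assms(6) abs_le_square_iff[of x "pi * sqrt V"] by auto
    also have "\<dots> = pi\<^sup>2 * V" using assms by (simp add: power_mult_distrib)
    also have "\<dots> \<le> 10 * V"
    proof -
      have "pi\<^sup>2 \<le> (3.15 :: real)\<^sup>2" using pi_approx by (intro power_mono) auto
      thus ?thesis using assms by (intro mult_right_mono) (auto simp: power2_eq_square)
    qed
    finally have x: "x\<^sup>2 \<le> 10 * C * \<tau> ^ 3" using assms(5) by simp
    have "(a * \<tau>) ^ 3 / fact 3 \<le> exp (a * \<tau>)"
    proof -
      have "(\<lambda>n. (a * \<tau>) ^ n / fact n) sums exp (a * \<tau>)"
        using exp_converges[of "a * \<tau>"] by (simp add: divide_inverse mult.commute)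
      thus ?thesis
        using sum_le_suminf[of "\<lambda>n. (a * \<tau>) ^ n / fact n" "{3}"] assms by (auto simp: sums_iff)
    qed
    hence "a ^ 3 * \<tau> ^ 3 \<le> 6 * exp (a * \<tau>)"
      by (simp add: power_mult_distrib fact_numeral)
    hence "\<tau> ^ 3 \<le> 6 / a ^ 3 * exp (a * \<tau>)" using assms by (simp add: field_simps)
    hence "10 * C * \<tau> ^ 3 \<le> 10 * C * (6 / a ^ 3 * exp (a * \<tau>))"
      using assms by (intro mult_left_mono) auto
    hence "x\<^sup>2 \<le> 60 * C / a ^ 3 * exp (a * \<tau>)" using x by simp
    moreover have "1 \<le> 1 * exp (a * \<tau>)" using assms by simp
    ultimately have "1 + x\<^sup>2 \<le> (1 + 60 * C / a ^ 3) * exp (a * \<tau>)"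
      unfolding distrib_right by linarith
    hence "exp (- (a * \<tau>)) * (1 + x\<^sup>2) \<le> 1 + 60 * C / a ^ 3"
      by (simp add: exp_minus field_simps)
    also have "\<dots> \<le> K" using assms by (simp add: K_def)
    finally show ?thesis .
  qed
  ultimately have "exp (- min (a * \<tau> ^ 3 * (x / sqrt V)\<^sup>2) (a * \<tau>)) * (1 + x\<^sup>2) \<le> K"
    by (simp add: min_def)
  thus ?thesis using pos unfolding K_def[symmetric] by (simp add: field_simps)
qed

text \<open>Crude near 0, but linear in \<open>\<bar>y\<bar>\<close>: averaging the error over
  further random contributions to the size then needs their means only.\<close>

lemma one_minus_exp_square_le: "\<bar>exp (- y\<^sup>2 / 2) - 1\<bar> \<le> \<bar>y\<bar>" for y :: real
proof -
  have "1 + (- y\<^sup>2 / 2) \<le> exp (- y\<^sup>2 / 2)" by (rule exp_ge_add_one_self)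
  moreover have "exp (- y\<^sup>2 / 2) \<le> 1" "exp (- y\<^sup>2 / 2) > 0" by auto
  moreover have "y\<^sup>2 / 2 \<le> \<bar>y\<bar> \<or> 1 \<le> \<bar>y\<bar>"
  proof (cases "\<bar>y\<bar> \<le> 1")
    case True
    have "y\<^sup>2 = \<bar>y\<bar> * \<bar>y\<bar>" by (simp add: power2_eq_square)
    also have "\<dots> \<le> \<bar>y\<bar> * 1" using True by (intro mult_left_mono) auto
    finally show ?thesis using abs_ge_zero[of y] by linarith
  qed auto
  ultimately show ?thesis by linarith
qed

text \<open>\<open>P n i\<close> plays the role of a point probability with characteristic function \<open>\<phi> n\<close>, mean
  \<open>\<mu> n\<close> and variance \<open>V n\<close>. The Gaussian factor is already replaced by \<open>1\<close>, at the price of the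
  error \<open>\<bar>i - \<mu>\<bar> / sqrt V\<close>.\<close>
lemma local_limit:
  fixes \<phi> W :: "nat \<Rightarrow> real \<Rightarrow> complex" and \<mu> V T \<tau> :: "nat \<Rightarrow> real" and P :: "nat \<Rightarrow> nat \<Rightarrow> real"
  assumes a: "a > 0" and C: "C > 0"
    and meas: "\<And>n. \<phi> n \<in> borel_measurable borel"
    and \<tau>: "\<forall>\<^sub>F n in sequentially. \<tau> n > 0"
    and V: "filterlim V at_top sequentially" "\<forall>\<^sub>F n in sequentially. V n \<le> C * \<tau> n ^ 3"
    and decay: "\<forall>\<^sub>F n in sequentially. \<forall>\<theta>. \<bar>\<theta>\<bar> \<le> pi \<longrightarrow>
        norm (\<phi> n \<theta>) \<le> exp (- min (a * \<tau> n ^ 3 * \<theta>\<^sup>2) (a * \<tau> n))"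
    and W: "\<forall>\<^sub>F n in sequentially. \<forall>\<theta>. \<phi> n \<theta> = exp (W n \<theta>) \<and>
        norm (W n \<theta> - (\<i> * \<theta> * \<mu> n - \<theta>\<^sup>2 / 2 * V n)) \<le> \<bar>\<theta>\<bar> ^ 3 * T n"
    and T: "(\<lambda>n. T n / sqrt (V n) ^ 3) \<longlonglongrightarrow> 0"
    and P: "\<forall>\<^sub>F n in sequentially. \<forall>i.
        of_real (P n i) = (LBINT \<theta>:{-pi..pi}. \<phi> n \<theta> * cis (- (real i * \<theta>))) / (2 * pi)"
  shows "\<exists>\<delta>. \<delta> \<longlonglongrightarrow> 0 \<and> (\<forall>\<^sub>F n in sequentially. \<forall>i.
    \<bar>sqrt (2 * pi * V n) * P n i - 1\<bar> \<le> \<bar>real i - \<mu> n\<bar> / sqrt (V n) + \<delta> n)"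
proof -
  \<comment> \<open>\<open>G n\<close> is the centred characteristic function on the scale of the
    standard deviation, zero outside the image of \<open>{-pi..pi}\<close>. Its L1 distance to the
    Gaussian does not involve \<open>i\<close>, which makes the error \<open>\<delta>\<close>
    uniform in \<open>i\<close>.\<close>
  define G where "G = (\<lambda>n x. indicat_real {-(pi * sqrt (V n))..pi * sqrt (V n)} x *\<^sub>R
     (\<phi> n (x / sqrt (V n)) * cis (- (x / sqrt (V n) * \<mu> n))))"
  define g where "g = (\<lambda>x. complex_of_real (exp (- x\<^sup>2 / 2)))"
  define \<delta> where "\<delta> = (\<lambda>n. (\<integral>x. norm (G n x - g x) \<partial>lborel) / sqrt (2 * pi))"
  define K where "K = 1 + C / a + 60 * C / a ^ 3"
  have Vpos: "\<forall>\<^sub>F n in sequentially. V n > 0"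
    using V(1) by (rule filterlim_at_top_dense[THEN iffD1, rule_format])
  have [measurable]: "\<phi> n \<in> borel_measurable borel" for n by (rule meas)
  have cis_meas [measurable]: "cis \<in> borel_measurable borel"
    by (intro borel_measurable_continuous_onI continuous_intros)
  have G_meas [measurable]: "G n \<in> borel_measurable borel" for n
    unfolding G_def by measurable
  have g_meas [measurable]: "g \<in> borel_measurable borel"
    unfolding g_def by measurable
  have Gb: "\<forall>\<^sub>F n in sequentially. \<forall>x. norm (G n x) \<le> K * inverse (1 + x\<^sup>2)"
    using Vpos \<tau> V(2) decay
  proof eventually_elim
    case (elim n)
    show ?case
    proof
      fix x :: real
      show "norm (G n x) \<le> K * inverse (1 + x\<^sup>2)"
      proof (cases "\<bar>x\<bar> \<le> pi * sqrt (V n)")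
        case True
        have "\<bar>x / sqrt (V n)\<bar> \<le> pi" using True elim(1) by (simp add: field_simps)
        hence "norm (G n x) \<le> exp (- min (a * \<tau> n ^ 3 * (x / sqrt (V n))\<^sup>2) (a * \<tau> n))"
          using elim(4) True unfolding G_def by (auto simp: norm_mult indicator_def)
        also have "\<dots> \<le> K * inverse (1 + x\<^sup>2)"
          unfolding K_def by (rule gaussian_norm_bound) (use a C elim True in auto)
        finally show ?thesis .
      next
        case False
        hence "G n x = 0" by (auto simp: G_def indicator_def)
        moreover have "K \<ge> 0" using a C by (simp add: K_def)
        ultimately show ?thesis by (simp add: add_nonneg_nonneg)
      qed
    qed
  qed
  have gb: "norm (g x) \<le> 2 * inverse (1 + x\<^sup>2)" for x
  proof -
    have "1 + x\<^sup>2 \<le> 2 * exp (x\<^sup>2 / 2)"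
      using exp_ge_add_one_self[of "x\<^sup>2 / 2"] exp_ge_zero[of "x\<^sup>2 / 2"] by linarith
    moreover have "norm (g x) = 1 / exp (x\<^sup>2 / 2)"
      unfolding g_def norm_of_real abs_exp_cancel
      by (simp add: exp_minus inverse_eq_divide)
    moreover have "1 / exp (x\<^sup>2 / 2) \<le> 2 / (1 + x\<^sup>2)"
      using calculation(1) by (simp add: divide_simps add_pos_nonneg)
    ultimately show ?thesis
      by (simp only: inverse_eq_divide times_divide_eq_right mult_1_right)
  qed
  have gi: "integrable lborel g"
    by (rule Bochner_Integration.integrable_bound[OF integrable_mult_right[OF integrable_inverse_one_plus_square, of 2]])
      (use gb in \<open>auto simp: abs_mult\<close>)
  have Gi: "\<forall>\<^sub>F n in sequentially. integrable lborel (G n)"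
    using Gb
  proof eventually_elim
    case (elim n)
    show ?case
      by (rule Bochner_Integration.integrable_bound[OF integrable_mult_right[OF integrable_inverse_one_plus_square, of K]])
        (use elim in \<open>auto intro: order_trans[OF _ abs_ge_self]\<close>)
  qed
  have ptw: "(\<lambda>n. G n x) \<longlonglongrightarrow> g x" for x
  proof -
    define u where "u = (\<lambda>n. x / sqrt (V n))"
    have "\<forall>\<^sub>F n in sequentially. norm ((W n (u n) - \<i> * u n * \<mu> n) - (- (x\<^sup>2 / 2))) \<le> \<bar>x\<bar> ^ 3 * (T n / sqrt (V n) ^ 3)"
      using W Vpos
    proof eventually_elim
      case (elim n)
      have "(u n)\<^sup>2 * V n = x\<^sup>2" using elim(2) by (simp add: u_def power_divide)
      hence "of_real ((u n)\<^sup>2 / 2 * V n) = (of_real (x\<^sup>2 / 2) :: complex)" by simp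
      hence "(W n (u n) - \<i> * u n * \<mu> n) - (- (x\<^sup>2 / 2)) = W n (u n) - (\<i> * u n * \<mu> n - (u n)\<^sup>2 / 2 * V n)"
        by (simp add: algebra_simps)
      moreover have "\<bar>u n\<bar> ^ 3 * T n = \<bar>x\<bar> ^ 3 * (T n / sqrt (V n) ^ 3)"
        using elim(2) by (simp add: u_def power_divide abs_divide)
      ultimately show ?case using elim(1) by metis
    qed
    moreover have "(\<lambda>n. \<bar>x\<bar> ^ 3 * (T n / sqrt (V n) ^ 3)) \<longlonglongrightarrow> 0"
      using tendsto_mult[OF tendsto_const T] by simp
    ultimately have "(\<lambda>n. (W n (u n) - \<i> * u n * \<mu> n) - (- (x\<^sup>2 / 2))) \<longlonglongrightarrow> 0"
      by (rule Lim_null_comparison)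
    hence "(\<lambda>n. W n (u n) - \<i> * u n * \<mu> n) \<longlonglongrightarrow> of_real (- (x\<^sup>2 / 2))"
      by (subst (asm) LIM_zero_iff) simp
    hence "(\<lambda>n. exp (W n (u n) - \<i> * u n * \<mu> n)) \<longlonglongrightarrow> exp (of_real (- (x\<^sup>2 / 2)))"
      by (rule tendsto_exp)
    moreover have "exp (of_real (- (x\<^sup>2 / 2))) = g x"
      by (simp only: g_def exp_of_real minus_divide_left)
    moreover have "\<forall>\<^sub>F n in sequentially. G n x = exp (W n (u n) - \<i> * u n * \<mu> n)"
    proof -
      have "\<forall>\<^sub>F n in sequentially. V n > x\<^sup>2"
        using V(1) by (rule filterlim_at_top_dense[THEN iffD1, rule_format])
      with W show ?thesis
      proof eventually_elim
        case (elim n)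
        have "V n > 0" using elim(2) zero_le_power2[of x] by linarith
        have "\<bar>x\<bar> \<le> sqrt (V n)" using elim(2) by (intro real_le_rsqrt) auto
        also have "\<dots> \<le> pi * sqrt (V n)"
          using mult_right_mono[of 1 pi "sqrt (V n)"] pi_gt3 \<open>V n > 0\<close> by simp
        finally have "x \<in> {-(pi * sqrt (V n))..pi * sqrt (V n)}" by auto
        hence "G n x = exp (W n (u n)) * cis (- (u n * \<mu> n))"
          using elim(1) by (simp add: G_def u_def)
        also have "cis (- (u n * \<mu> n)) = exp (- (\<i> * u n * \<mu> n))"
          by (simp add: cis_conv_exp mult_ac)
        finally show ?case by (simp add: exp_diff exp_minus divide_inverse)
      qed
    qed
    ultimately show ?thesis by (simp add: filterlim_cong)
  qed
  have "\<delta> \<longlonglongrightarrow> 0"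
  proof -
    \<comment> \<open>The majorant is available only from some index on, hence the shifted sequence
      below.\<close>
    obtain N where N: "\<And>n x. n \<ge> N \<Longrightarrow> norm (G n x) \<le> K * inverse (1 + x\<^sup>2)"
      using Gb by (auto simp: eventually_sequentially)
    have "(\<lambda>n. \<integral>x. norm (G (n + N) x - g x) \<partial>lborel) \<longlonglongrightarrow> integral\<^sup>L (lborel :: real measure) (\<lambda>x. 0 :: real)"
    proof (rule integral_dominated_convergence[where w = "\<lambda>x. (K + 2) * inverse (1 + x\<^sup>2)"
        and s = "\<lambda>n x. norm (G (n + N) x - g x)" and f = "\<lambda>_. 0"])
      show "integrable lborel (\<lambda>x::real. (K + 2) * inverse (1 + x\<^sup>2))"
        by (intro integrable_mult_right integrable_inverse_one_plus_square)
      show "AE x in lborel. (\<lambda>n. norm (G (n + N) x - g x)) \<longlonglongrightarrow> 0"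
      proof (rule AE_I2)
        fix x
        have "(\<lambda>n. G (n + N) x) \<longlonglongrightarrow> g x" using LIMSEQ_ignore_initial_segment[OF ptw] .
        thus "(\<lambda>n. norm (G (n + N) x - g x)) \<longlonglongrightarrow> 0"
          by (intro tendsto_norm_zero) (simp add: LIM_zero)
      qed
      show "AE x in lborel. norm (norm (G (n + N) x - g x)) \<le> (K + 2) * inverse (1 + x\<^sup>2)" for n
      proof (rule AE_I2)
        fix x
        have "norm (G (n + N) x - g x) \<le> norm (G (n + N) x) + norm (g x)"
          by (rule norm_triangle_ineq4)
        thus "norm (norm (G (n + N) x - g x)) \<le> (K + 2) * inverse (1 + x\<^sup>2)"
          using N[of "n + N" x] gb[of x] by (simp add: distrib_right)
      qed
    qed auto
    hence "(\<lambda>n. \<integral>x. norm (G (n + N) x - g x) \<partial>lborel) \<longlonglongrightarrow> 0" by simp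
    hence "(\<lambda>n. \<integral>x. norm (G n x - g x) \<partial>lborel) \<longlonglongrightarrow> 0"
      by (rule LIMSEQ_offset)
    thus ?thesis unfolding \<delta>_def by (intro tendsto_divide_zero)
  qed
  moreover have "\<forall>\<^sub>F n in sequentially. \<forall>i.
    \<bar>sqrt (2 * pi * V n) * P n i - 1\<bar> \<le> \<bar>real i - \<mu> n\<bar> / sqrt (V n) + \<delta> n"
    using P Gi Vpos
  proof eventually_elim
    case (elim n)
    show ?case
    proof
      fix i
      define y where "y = (real i - \<mu> n) / sqrt (V n)"
      have "(LBINT \<theta>:{-pi..pi}. \<phi> n \<theta> * cis (- (real i * \<theta>))) =
          \<bar>1 / sqrt (V n)\<bar> *\<^sub>R (\<integral>x. indicat_real {-pi..pi} (0 + 1 / sqrt (V n) * x) *\<^sub>R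
             (\<phi> n (0 + 1 / sqrt (V n) * x) * cis (- (real i * (0 + 1 / sqrt (V n) * x)))) \<partial>lborel)"
        unfolding set_lebesgue_integral_def
        by (rule lborel_integral_real_affine) (use elim(3) in auto)
      also have "(\<lambda>x. indicat_real {-pi..pi} (0 + 1 / sqrt (V n) * x) *\<^sub>R
             (\<phi> n (0 + 1 / sqrt (V n) * x) * cis (- (real i * (0 + 1 / sqrt (V n) * x))))) =
          (\<lambda>x. G n x * cis (- y * x))"
      proof
        fix x
        have "indicat_real {-pi..pi} (x / sqrt (V n)) = indicat_real {-(pi * sqrt (V n))..pi * sqrt (V n)} x"
          using elim(3) by (auto simp: indicator_def field_simps)
        moreover have "cis (- (x / sqrt (V n) * \<mu> n)) * cis (- y * x) = cis (- (real i * (x / sqrt (V n))))"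
          using elim(3) by (simp add: cis_mult y_def field_simps)
        ultimately show "indicat_real {-pi..pi} (0 + 1 / sqrt (V n) * x) *\<^sub>R
             (\<phi> n (0 + 1 / sqrt (V n) * x) * cis (- (real i * (0 + 1 / sqrt (V n) * x)))) = G n x * cis (- y * x)"
          by (simp add: G_def mult.assoc)
      qed
      finally have I: "(LBINT \<theta>:{-pi..pi}. \<phi> n \<theta> * cis (- (real i * \<theta>))) =
          of_real (1 / sqrt (V n)) * (\<integral>x. G n x * cis (- y * x) \<partial>lborel)"
        using elim(3) by (simp add: scaleR_conv_of_real)
      have "of_real (2 * pi * sqrt (V n) * P n i) = of_real (2 * pi * sqrt (V n)) * (of_real (P n i) :: complex)"
        by simp
      also have "of_real (P n i) = (LBINT \<theta>:{-pi..pi}. \<phi> n \<theta> * cis (- (real i * \<theta>))) / (2 * pi)"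
        using elim(1) by blast
      also have "of_real (2 * pi * sqrt (V n)) * \<dots> = (\<integral>x. G n x * cis (- y * x) \<partial>lborel)"
        unfolding I using elim(3) by simp
      finally have 1: "of_real (2 * pi * sqrt (V n) * P n i) = (\<integral>x. G n x * cis (- y * x) \<partial>lborel)" .
      have 2: "(\<integral>x. g x * cis (- y * x) \<partial>lborel) = of_real (sqrt (2 * pi) * exp (- y\<^sup>2 / 2))"
      proof -
        have "g x * cis (- y * x) = of_real (sqrt (2 * pi)) * (of_real (std_normal_density x) * cis (- y * x))" for x
          by (simp add: g_def std_normal_density_def)
        thus ?thesis using fourier_std_normal_density[of "- y"] by (simp add: mult.assoc)
      qed
      have i1: "integrable lborel (\<lambda>x. f x * cis (- y * x))" if "integrable lborel f" for f :: "real \<Rightarrow> complex"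
        by (rule Bochner_Integration.integrable_bound[OF that])
          (use that in \<open>auto simp: norm_mult\<close>)
      have "norm (of_real (2 * pi * sqrt (V n) * P n i) - of_real (sqrt (2 * pi) * exp (- y\<^sup>2 / 2)) :: complex)
        = norm (\<integral>x. (G n x - g x) * cis (- y * x) \<partial>lborel)"
        unfolding 1 2[symmetric] left_diff_distrib
        by (subst Bochner_Integration.integral_diff) (use i1[OF gi] i1[OF elim(2)] in auto)
      also have "\<dots> \<le> (\<integral>x. norm ((G n x - g x) * cis (- y * x)) \<partial>lborel)"
        by (rule integral_norm_bound)
      also have "\<dots> = sqrt (2 * pi) * \<delta> n"
        by (simp add: \<delta>_def norm_mult)
      finally have "\<bar>2 * pi * sqrt (V n) * P n i - sqrt (2 * pi) * exp (- y\<^sup>2 / 2)\<bar> \<le> sqrt (2 * pi) * \<delta> n"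
        by (simp only: norm_of_real flip: of_real_diff)
      also have "2 * pi * sqrt (V n) * P n i - sqrt (2 * pi) * exp (- y\<^sup>2 / 2) =
          sqrt (2 * pi) * (sqrt (2 * pi * V n) * P n i - exp (- y\<^sup>2 / 2))"
      proof -
        have "2 * pi = sqrt (2 * pi) * sqrt (2 * pi)" by simp
        thus ?thesis by (simp only: real_sqrt_mult[of _ "V n"] right_diff_distrib mult.assoc[symmetric])
      qed
      finally have "\<bar>sqrt (2 * pi * V n) * P n i - exp (- y\<^sup>2 / 2)\<bar> \<le> \<delta> n"
        by (simp add: abs_mult)
      moreover have "\<bar>exp (- y\<^sup>2 / 2) - 1\<bar> \<le> \<bar>real i - \<mu> n\<bar> / sqrt (V n)"
        using one_minus_exp_square_le[of y] elim(3) by (simp add: y_def abs_divide)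
      ultimately show "\<bar>sqrt (2 * pi * V n) * P n i - 1\<bar> \<le> \<bar>real i - \<mu> n\<bar> / sqrt (V n) + \<delta> n"
        by linarith
    qed
  qed
  ultimately show ?thesis by blast
qed

section \<open>Mean and variance of the size\<close>

lemma exp_minus_le_inverse: "exp (- x) \<le> 1 / (1 + x)" if "x \<ge> 0" for x :: real
  using exp_ge_add_one_self[of x] that by (simp add: exp_minus divide_simps)

lemma one_minus_exp_minus_ge: "x / (1 + x) \<le> 1 - exp (- x)" if "x \<ge> 0" for x :: real
  using exp_minus_le_inverse[OF that] that by (simp add: field_simps)

lemma geometric_mean_le:
  fixes \<tau> :: real
  assumes "\<tau> > 0" "j > 0"
  shows "real j * exp (- (1 / \<tau>)) ^ j / (1 - exp (- (1 / \<tau>)) ^ j) \<le> \<tau>"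
proof -
  define x where "x = real j / \<tau>"
  have x: "x > 0" using assms by (simp add: x_def)
  have p: "exp (- (1 / \<tau>)) ^ j = exp (- x)"
    by (simp add: x_def flip: exp_of_nat_mult)
  have "x * exp (- x) \<le> 1 - exp (- x)"
    using exp_minus_le_inverse[of x] x by (simp add: field_simps)
  moreover have "1 - exp (- x) > 0" using x by simp
  ultimately have "x * exp (- x) / (1 - exp (- x)) \<le> 1" by simp
  hence "\<tau> * (x * exp (- x) / (1 - exp (- x))) \<le> \<tau> * 1"
    using assms by (intro mult_left_mono) auto
  thus ?thesis unfolding p using assms by (simp add: x_def)
qed

lemma square_mult_exp_le: "(1 + x)\<^sup>2 * exp (- x) \<le> 8 * exp (- (x / 2))" if "x \<ge> 0" for x :: real
proof -
  have "1 + x / 2 + (x / 2)\<^sup>2 / 2 \<le> exp (x / 2)"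
    using exp_lower_Taylor_quadratic[of "x / 2"] that by simp
  hence "(1 + x)\<^sup>2 \<le> 8 * exp (x / 2)" using that by (simp add: power2_eq_square field_simps)
  hence "(1 + x)\<^sup>2 * exp (- x) \<le> 8 * exp (x / 2) * exp (- x)" by (intro mult_right_mono) auto
  also have "\<dots> = 8 * exp (- (x / 2))" by (simp flip: exp_add)
  finally show ?thesis .
qed

lemma cube_mult_exp_le: "(1 + x) ^ 3 * exp (- x) \<le> 18" if "x \<ge> 0" for x :: real
proof -
  have "(1 + x) ^ 3 / fact 3 \<le> exp (1 + x)"
  proof -
    have "(\<lambda>n. (1 + x) ^ n / fact n) sums exp (1 + x)"
      using exp_converges[of "1 + x"] by (simp add: divide_inverse mult.commute)
    thus ?thesis
      using sum_le_suminf[of "\<lambda>n. (1 + x) ^ n / fact n" "{3}"] that by (auto simp: sums_iff)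
  qed
  hence "(1 + x) ^ 3 \<le> 6 * exp (1 + x)" by (simp add: fact_numeral)
  hence "(1 + x) ^ 3 * exp (- x) \<le> 6 * exp (1 + x) * exp (- x)" by (intro mult_right_mono) auto
  also have "\<dots> = 6 * exp 1" by (simp flip: exp_add)
  also have "\<dots> \<le> 18" using exp_le by simp
  finally show ?thesis .
qed

text \<open>In the variable \<open>x = j / \<tau>\<close> this is
  \<open>x / (1 - exp (- x)) \<le> 1 + x\<close>. The case \<open>k = 2\<close> serves the variance,
  \<open>k = 3\<close> the cubic remainder.\<close>

lemma geometric_moment_le:
  fixes \<tau> :: real
  assumes "\<tau> > 0" "j > 0"
  shows "real j ^ k * exp (- (1 / \<tau>)) ^ j / (1 - exp (- (1 / \<tau>)) ^ j) ^ k
    \<le> \<tau> ^ k * ((1 + real j / \<tau>) ^ k * exp (- (real j / \<tau>)))"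
proof -
  define x where "x = real j / \<tau>"
  have x: "x > 0" using assms by (simp add: x_def)
  have p: "exp (- (1 / \<tau>)) ^ j = exp (- x)"
    by (simp add: x_def flip: exp_of_nat_mult)
  have "x / (1 - exp (- x)) \<le> 1 + x"
    using one_minus_exp_minus_ge[of x] x by (simp add: field_simps)
  hence "(x / (1 - exp (- x))) ^ k \<le> (1 + x) ^ k"
    using x by (intro power_mono) auto
  hence "\<tau> ^ k * ((x / (1 - exp (- x))) ^ k * exp (- x)) \<le> \<tau> ^ k * ((1 + x) ^ k * exp (- x))"
    using assms by (intro mult_left_mono mult_right_mono) auto
  moreover have "real j = \<tau> * x" using assms by (simp add: x_def)
  ultimately show ?thesis unfolding p x_def[symmetric]
    by (simp add: power_divide power_mult_distrib)
qed

text \<open>Half of the exponential decay pays for the factor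
  \<open>(1 + j / \<tau>)\<^sup>2\<close>; the other half, \<open>r ^ j\<close>, is summed as a
  geometric series with value at most \<open>3 * \<tau>\<close>, so that 48 is 16 times 3.\<close>

lemma variance_le:
  fixes \<tau> :: real
  assumes "\<tau> \<ge> 1" "finite J" "0 \<notin> J"
  shows "(\<Sum>j\<in>J. 2 * (real j)\<^sup>2 * exp (- (1 / \<tau>)) ^ j / (1 - exp (- (1 / \<tau>)) ^ j)\<^sup>2) \<le> 48 * \<tau> ^ 3"
proof -
  define r where "r = exp (- (1 / (2 * \<tau>)))"
  have r: "0 < r" "r < 1" using assms by (auto simp: r_def)
  have "(\<Sum>j\<in>J. 2 * (real j)\<^sup>2 * exp (- (1 / \<tau>)) ^ j / (1 - exp (- (1 / \<tau>)) ^ j)\<^sup>2) \<le>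
      (\<Sum>j\<in>J. 16 * \<tau>\<^sup>2 * r ^ j)"
  proof (rule sum_mono)
    fix j assume "j \<in> J"
    hence j: "j > 0" using assms by (auto intro: Nat.gr0I)
    have "real j ^ 2 * exp (- (1 / \<tau>)) ^ j / (1 - exp (- (1 / \<tau>)) ^ j) ^ 2
      \<le> \<tau> ^ 2 * ((1 + real j / \<tau>) ^ 2 * exp (- (real j / \<tau>)))"
      by (rule geometric_moment_le) (use assms j in auto)
    also have "\<dots> \<le> \<tau>\<^sup>2 * (8 * exp (- (real j / \<tau> / 2)))"
      using assms by (intro mult_left_mono square_mult_exp_le) auto
    also have "exp (- (real j / \<tau> / 2)) = r ^ j"
      by (simp add: r_def flip: exp_of_nat_mult)
    finally show "2 * (real j)\<^sup>2 * exp (- (1 / \<tau>)) ^ j / (1 - exp (- (1 / \<tau>)) ^ j)\<^sup>2 \<le> 16 * \<tau>\<^sup>2 * r ^ j"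
      by simp
  qed
  also have "\<dots> = 16 * \<tau>\<^sup>2 * (\<Sum>j\<in>J. r ^ j)" by (simp add: sum_distrib_left)
  also have "(\<Sum>j\<in>J. r ^ j) \<le> 1 / (1 - r)"
    using sum_le_suminf[of "\<lambda>j. r ^ j" J] geometric_sums[of r] r assms by (simp add: sums_iff)
  also have "1 / (1 - r) \<le> 1 + 2 * \<tau>"
  proof -
    have "1 / (2 * \<tau>) / (1 + 1 / (2 * \<tau>)) \<le> 1 - r"
      unfolding r_def by (rule one_minus_exp_minus_ge) (use assms in auto)
    moreover have "1 / (2 * \<tau>) / (1 + 1 / (2 * \<tau>)) = 1 / (1 + 2 * \<tau>)"
      using assms by (simp add: field_simps)
    ultimately show ?thesis using r assms by (simp add: field_simps)
  qed
  also have "1 + 2 * \<tau> \<le> 3 * \<tau>" using assms by simp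
  finally show ?thesis using assms
    by (simp add: mult_left_mono power2_eq_square power3_eq_cube)
qed

text \<open>Every term is at most \<open>18 * \<tau> ^ 3\<close>, and there are at most
  \<open>M\<close> of them. Against the expected order \<open>\<tau> ^ 4\<close> this loses only the
  logarithm contained in \<open>M\<close>, while the remainder is compared with
  \<open>\<tau> powr (9/2)\<close>.\<close>

lemma third_moment_le:
  fixes \<tau> :: real
  assumes "\<tau> > 0" "finite J" "J \<subseteq> {1..M}"
  shows "(\<Sum>j\<in>J. real j ^ 3 * exp (- (1 / \<tau>)) ^ j / (1 - exp (- (1 / \<tau>)) ^ j) ^ 3) \<le> 18 * real M * \<tau> ^ 3"
proof -
  have "(\<Sum>j\<in>J. real j ^ 3 * exp (- (1 / \<tau>)) ^ j / (1 - exp (- (1 / \<tau>)) ^ j) ^ 3) \<le> real (card J) * (18 * \<tau> ^ 3)"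
  proof (rule sum_bounded_above)
    fix j assume "j \<in> J"
    hence j: "j > 0" using assms by auto
    have "real j ^ 3 * exp (- (1 / \<tau>)) ^ j / (1 - exp (- (1 / \<tau>)) ^ j) ^ 3
      \<le> \<tau> ^ 3 * ((1 + real j / \<tau>) ^ 3 * exp (- (real j / \<tau>)))"
      by (rule geometric_moment_le) (use assms j in auto)
    also have "\<dots> \<le> \<tau> ^ 3 * 18"
      using assms by (intro mult_left_mono cube_mult_exp_le) auto
    finally show "real j ^ 3 * exp (- (1 / \<tau>)) ^ j / (1 - exp (- (1 / \<tau>)) ^ j) ^ 3 \<le> 18 * \<tau> ^ 3" by simp
  qed
  also have "card J \<le> M" using card_mono[OF _ assms(3)] by simp
  hence "real (card J) * (18 * \<tau> ^ 3) \<le> real M * (18 * \<tau> ^ 3)"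
    using assms by (intro mult_right_mono) auto
  finally show ?thesis by simp
qed

lemma exp_minus_div_ge:
  fixes \<tau> :: real
  assumes "\<tau> > 0" "real j \<le> \<tau>"
  shows "exp (- (1 / \<tau>)) ^ j \<ge> 1 / 3"
proof -
  have "1 / 3 \<le> exp (- 1 :: real)" using exp_le by (simp add: exp_minus field_simps)
  also have "\<dots> \<le> exp (- (real j / \<tau>))" using assms by simp
  also have "\<dots> = exp (- (1 / \<tau>)) ^ j" by (simp flip: exp_of_nat_mult)
  finally show ?thesis .
qed

text \<open>The numerical hypothesis on \<open>D\<close> is tailored to
  \<open>sum_one_minus_cos_odd_ge\<close>: as \<open>N > \<tau> / 2 - 1\<close>, removing
  \<open>D\<close> takes away at most an eighth of the indices.\<close>

lemma small_odd_parts: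
  fixes \<tau> :: real
  assumes "\<tau> \<ge> 4" "finite D" "16 * real (card D) \<le> \<tau> - 2"
  defines "N \<equiv> nat \<lfloor>\<tau> / 2\<rfloor>"
  defines "A \<equiv> {i. i < N \<and> 2 * i + 1 \<notin> D}"
  shows "A \<subseteq> {..<N}" "8 * card ({..<N} - A) \<le> N" "real N \<ge> \<tau> / 4" "i \<in> A \<Longrightarrow> real (2 * i + 1) \<le> \<tau>"
    "real (card A) \<ge> \<tau> / 8"
proof -
  have N: "real N \<le> \<tau> / 2" "real N > \<tau> / 2 - 1"
    using assms(1) unfolding N_def by linarith+
  show sub: "A \<subseteq> {..<N}" by (auto simp: A_def)
  have "card ({..<N} - A) \<le> card D"
  proof -
    have "(\<lambda>i. 2 * i + 1) ` ({..<N} - A) \<subseteq> D" by (auto simp: A_def)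
    moreover have "inj_on (\<lambda>i. 2 * i + 1 :: nat) ({..<N} - A)" by (auto intro: inj_onI)
    ultimately show ?thesis using assms(2) card_inj_on_le by blast
  qed
  hence "real (8 * card ({..<N} - A)) \<le> real N" using assms(3) N by simp
  thus c: "8 * card ({..<N} - A) \<le> N" by (simp only: of_nat_le_iff)
  show "real N \<ge> \<tau> / 4" using N assms(1) by linarith
  show "real (2 * i + 1) \<le> \<tau>" if "i \<in> A"
  proof -
    have "real i + 1 \<le> real N" using that by (auto simp: A_def)
    thus ?thesis using N by simp
  qed
  have "card ({..<N} - A) = N - card A"
    using sub by (subst card_Diff_subset) (auto intro: finite_subset)
  moreover have "card A \<le> N" using card_mono[OF _ sub] by simp
  ultimately have "7 * real N \<le> 8 * real (card A)" using c by linarith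
  thus "real (card A) \<ge> \<tau> / 8" using \<open>real N \<ge> \<tau> / 4\<close> by linarith
qed

text \<open>Both bounds already come from the odd parts up to \<tau> outside \<open>D\<close>: there
  \<open>q ^ j \<ge> 1 / 3\<close>, so the weights can be replaced by a constant and only counting
  remains.\<close>

lemma
  fixes \<tau> :: real
  assumes \<tau>: "\<tau> \<ge> 4" "real M \<ge> \<tau>" and D: "finite D" "16 * real (card D) \<le> \<tau> - 2"
  shows variance_ge: "(\<Sum>j\<in>odds_upto M - D. 2 * (real j)\<^sup>2 * exp (- (1 / \<tau>)) ^ j / (1 - exp (- (1 / \<tau>)) ^ j)\<^sup>2)
      \<ge> \<tau> ^ 3 / 12"
    and decay_exponent_ge: "\<bar>\<theta>\<bar> \<le> pi \<Longrightarrow>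
      2 * (\<Sum>j\<in>odds_upto M - D. exp (- (1 / \<tau>)) ^ j * (1 - cos (real j * \<theta>)))
        \<ge> min (\<tau> ^ 3 * \<theta>\<^sup>2 / 1000) (\<tau> / 1000)"
proof -
  define N where "N = nat \<lfloor>\<tau> / 2\<rfloor>"
  define A where "A = {i. i < N \<and> 2 * i + 1 \<notin> D}"
  note sp = small_odd_parts[OF \<tau>(1) D, folded N_def, folded A_def]
  define q where "q = exp (- (1 / \<tau>))"
  have q: "0 < q" "q < 1" using \<tau> by (auto simp: q_def)
  have sub: "(\<lambda>i. 2 * i + 1) ` A \<subseteq> odds_upto M - D"
  proof safe
    fix i assume i: "i \<in> A"
    hence "real (2 * i + 1) \<le> real M" using sp(4) \<tau> by force
    thus "2 * i + 1 \<in> odds_upto M" by (auto simp: odds_upto_def)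
  qed (auto simp: A_def)
  have "inj_on (\<lambda>i. 2 * i + 1 :: nat) A" by (auto intro: inj_onI)
  have le: "(\<Sum>i\<in>A. f (2 * i + 1)) \<le> (\<Sum>j\<in>odds_upto M - D. f j)"
    if "\<And>j. j > 0 \<Longrightarrow> f j \<ge> 0" for f :: "nat \<Rightarrow> real"
  proof -
    have "(\<Sum>i\<in>A. f (2 * i + 1)) = (\<Sum>j\<in>(\<lambda>i. 2 * i + 1) ` A. f j)"
      using \<open>inj_on _ A\<close> by (simp add: sum.reindex)
    also have "\<dots> \<le> (\<Sum>j\<in>odds_upto M - D. f j)"
      by (rule sum_mono2[OF _ sub]) (auto intro!: that simp: odds_upto_def intro: odd_pos)
    finally show ?thesis .
  qed
  have ge: "q ^ (2 * i + 1) \<ge> 1 / 3" if "i \<in> A" for i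
    unfolding q_def by (rule exp_minus_div_ge) (use sp(4)[OF that] \<tau> in auto)
  have "\<tau> ^ 3 / 12 \<le> real (card A) * (2 / 3 * \<tau>\<^sup>2)"
  proof -
    have "\<tau> / 8 * (2 / 3 * \<tau>\<^sup>2) \<le> real (card A) * (2 / 3 * \<tau>\<^sup>2)"
      by (intro mult_right_mono sp(5)) auto
    thus ?thesis by (simp add: power2_eq_square power3_eq_cube)
  qed
  also have "\<dots> \<le> (\<Sum>i\<in>A. 2 * (real (2 * i + 1))\<^sup>2 * q ^ (2 * i + 1) / (1 - q ^ (2 * i + 1))\<^sup>2)"
  proof (rule sum_bounded_below)
    fix i assume i: "i \<in> A"
    define x where "x = real (2 * i + 1) / \<tau>"
    have x: "x > 0" using \<tau> by (simp add: x_def add_pos_nonneg)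
    have qx: "q ^ (2 * i + 1) = exp (- x)"
      unfolding q_def x_def exp_of_nat_mult[symmetric] by simp
    have "1 - exp (- x) \<le> x" using exp_ge_add_one_self[of "- x"] by linarith
    moreover have "1 - exp (- x) > 0" using x by simp
    ultimately have "1 \<le> (x / (1 - exp (- x)))\<^sup>2"
      by (intro one_le_power) (simp add: field_simps)
    hence "2 * \<tau>\<^sup>2 * (1 / 3 * 1) \<le> 2 * \<tau>\<^sup>2 * (exp (- x) * (x / (1 - exp (- x)))\<^sup>2)"
      using ge[OF i] unfolding qx by (intro mult_left_mono mult_mono) auto
    moreover have "real (2 * i + 1) = \<tau> * x" using \<tau> by (simp add: x_def)
    ultimately show "2 / 3 * \<tau>\<^sup>2 \<le> 2 * (real (2 * i + 1))\<^sup>2 * q ^ (2 * i + 1) / (1 - q ^ (2 * i + 1))\<^sup>2"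
      unfolding qx by (simp add: power_mult_distrib power_divide mult_ac)
  qed
  also have "\<dots> \<le> (\<Sum>j\<in>odds_upto M - D. 2 * (real j)\<^sup>2 * q ^ j / (1 - q ^ j)\<^sup>2)"
    by (rule le[of "\<lambda>j. 2 * (real j)\<^sup>2 * q ^ j / (1 - q ^ j)\<^sup>2"]) (use q in auto)
  finally show "(\<Sum>j\<in>odds_upto M - D. 2 * (real j)\<^sup>2 * exp (- (1 / \<tau>)) ^ j / (1 - exp (- (1 / \<tau>)) ^ j)\<^sup>2)
      \<ge> \<tau> ^ 3 / 12"
    by (simp add: q_def)
  assume \<theta>: "\<bar>\<theta>\<bar> \<le> pi"
  \<comment> \<open>The constant 1000 rounds up 960: \<open>2/3\<close> from the weights,
    \<open>1/64\<close> from \<open>N \<ge> \<tau> / 4\<close>, and \<open>1/10\<close> from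
    \<open>pi\<^sup>2 < 10\<close>.\<close>
  have "min (\<tau> ^ 3 * \<theta>\<^sup>2 / 1000) (\<tau> / 1000) \<le> 2 / 3 * min (real N / 4) (real N ^ 3 * \<theta>\<^sup>2 / pi\<^sup>2)"
  proof -
    have "(\<tau> / 4) ^ 3 \<le> real N ^ 3" by (intro power_mono sp(3)) (use \<tau> in auto)
    hence "(\<tau> / 4) ^ 3 * \<theta>\<^sup>2 / pi\<^sup>2 \<le> real N ^ 3 * \<theta>\<^sup>2 / pi\<^sup>2"
      by (intro divide_right_mono mult_right_mono) auto
    moreover have "(\<tau> / 4) ^ 3 * \<theta>\<^sup>2 / 10 \<le> (\<tau> / 4) ^ 3 * \<theta>\<^sup>2 / pi\<^sup>2"
    proof -
      have "pi\<^sup>2 \<le> (3.15 :: real)\<^sup>2" using pi_approx by (intro power_mono) auto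
      thus ?thesis using \<tau> by (intro divide_left_mono) (auto simp: power2_eq_square)
    qed
    moreover have "0 \<le> \<tau> ^ 3 * \<theta>\<^sup>2" using \<tau> by simp
    moreover have "(\<tau> / 4) ^ 3 * \<theta>\<^sup>2 = \<tau> ^ 3 * \<theta>\<^sup>2 / 64" by (simp add: power_divide)
    moreover have "a / 1000 \<le> 2 / 3 * d" if "b / pi\<^sup>2 \<le> d" "b / 10 \<le> b / pi\<^sup>2" "0 \<le> a" "b = a / 64"
      for a b d :: real using that by linarith
    ultimately have "\<tau> ^ 3 * \<theta>\<^sup>2 / 1000 \<le> 2 / 3 * (real N ^ 3 * \<theta>\<^sup>2 / pi\<^sup>2)" by blast
    moreover have "\<tau> / 1000 \<le> 2 / 3 * (real N / 4)" using sp(3) \<tau> by linarith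
    ultimately show ?thesis by linarith
  qed
  also have "\<dots> \<le> 2 / 3 * (\<Sum>i\<in>A. 1 - cos (real (2 * i + 1) * \<theta>))"
    by (intro mult_left_mono sum_one_minus_cos_odd_ge \<theta> sp(1,2)) auto
  also have "\<dots> \<le> 2 * (\<Sum>i\<in>A. q ^ (2 * i + 1) * (1 - cos (real (2 * i + 1) * \<theta>)))"
  proof -
    have "(\<Sum>i\<in>A. 1 / 3 * (1 - cos (real (2 * i + 1) * \<theta>))) \<le>
        (\<Sum>i\<in>A. q ^ (2 * i + 1) * (1 - cos (real (2 * i + 1) * \<theta>)))"
      using ge by (intro sum_mono mult_right_mono) auto
    thus ?thesis by (simp only: sum_distrib_left[symmetric])
  qed
  also have "\<dots> \<le> 2 * (\<Sum>j\<in>odds_upto M - D. q ^ j * (1 - cos (real j * \<theta>)))"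
    by (intro mult_left_mono le) (use q in auto)
  finally show "2 * (\<Sum>j\<in>odds_upto M - D. exp (- (1 / \<tau>)) ^ j * (1 - cos (real j * \<theta>)))
        \<ge> min (\<tau> ^ 3 * \<theta>\<^sup>2 / 1000) (\<tau> / 1000)"
    by (simp add: q_def)
qed

section \<open>Leading term of the expected size\<close>

lemma sums_odd_mult_power:
  fixes y :: real
  assumes "0 < y" "y < 1"
  shows "(\<lambda>j. of_bool (odd j) * (real j * y ^ j)) sums (y / (1 - y)\<^sup>2 - 2 * (y\<^sup>2 / (1 - y\<^sup>2)\<^sup>2))"
proof -
  have y2: "\<bar>y\<^sup>2\<bar> < 1" using assms by (simp add: power_less_one_iff)
  have all: "(\<lambda>j. real j * y ^ j) sums (y / (1 - y)\<^sup>2)"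
    using assms by (intro sums_nat_mult_power) auto
  have "(\<lambda>i. 2 * (real i * (y\<^sup>2) ^ i)) sums (2 * (y\<^sup>2 / (1 - y\<^sup>2)\<^sup>2))"
    by (intro sums_mult sums_nat_mult_power y2)
  hence "(\<lambda>i. of_bool (even (2 * i)) * (real (2 * i) * y ^ (2 * i))) sums (2 * (y\<^sup>2 / (1 - y\<^sup>2)\<^sup>2))"
    by (simp add: power_mult mult.assoc)
  moreover have "strict_mono (\<lambda>i. 2 * i :: nat)" by (auto simp: strict_mono_def)
  ultimately have "(\<lambda>j. of_bool (even j) * (real j * y ^ j)) sums (2 * (y\<^sup>2 / (1 - y\<^sup>2)\<^sup>2))"
    by (subst (asm) sums_mono_reindex) (auto simp: image_iff elim!: evenE)
  from sums_diff[OF all this] show ?thesis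
    by (rule back_subst[of "\<lambda>f. f sums _"]) (auto simp: fun_eq_iff)
qed

text \<open>The quotient equals \<open>1 / (4 * (sinh y)\<^sup>2)\<close> with
  \<open>y = x / 2\<close>, and the two bounds are \<open>y \<le> sinh y\<close> and
  \<open>sinh y \<le> y * cosh y\<close>.\<close>

lemma exp_double_pole_bounds:
  fixes x :: real
  assumes "x > 0"
  shows "exp (- x) / (1 - exp (- x))\<^sup>2 \<le> 1 / x\<^sup>2" "1 / x\<^sup>2 - 1 / 4 \<le> exp (- x) / (1 - exp (- x))\<^sup>2"
proof -
  define y where "y = x / 2"
  have y: "y > 0" using assms by (simp add: y_def)
  have x: "x = 2 * y" by (simp add: y_def)
  have e: "exp (- x) / (1 - exp (- x))\<^sup>2 = 1 / (4 * (sinh y)\<^sup>2)"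
  proof -
    have "1 - exp (- x) = exp (- y) * (2 * sinh y)"
      unfolding x by (simp add: sinh_field_def algebra_simps flip: exp_add)
    moreover have "exp (- x) = exp (- y) ^ 2"
      unfolding x by (simp add: power2_eq_square flip: exp_add)
    moreover have "sinh y > 0" using y by simp
    ultimately show ?thesis by (simp add: power_mult_distrib)
  qed
  have sinh: "y \<le> sinh y"
  proof -
    have "sinh 0 - 0 \<le> sinh y - y"
      by (rule DERIV_nonneg_imp_nondecreasing[of 0 y "\<lambda>x. sinh x - x"])
        (use y in \<open>auto intro!: exI derivative_eq_intros cosh_real_ge_1\<close>)
    thus ?thesis by simp
  qed
  have tanh: "sinh y \<le> y * cosh y"
  proof -
    have "0 * cosh 0 - sinh 0 \<le> y * cosh y - sinh y"
    proof (rule DERIV_nonneg_imp_nondecreasing[of 0 y "\<lambda>x. x * cosh x - sinh x"])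
      fix z assume z: "0 \<le> z" "z \<le> y"
      have "((\<lambda>x. x * cosh x - sinh x) has_real_derivative z * sinh z) (at z)"
        by (auto intro!: derivative_eq_intros)
      thus "\<exists>d. ((\<lambda>x. x * cosh x - sinh x) has_real_derivative d) (at z) \<and> 0 \<le> d"
        using z by (intro exI[of _ "z * sinh z"]) auto
    qed (use y in auto)
    thus ?thesis by simp
  qed
  have sp: "sinh y > 0" using y by simp
  have "y\<^sup>2 \<le> (sinh y)\<^sup>2" using sinh y by (intro power_mono) auto
  thus "exp (- x) / (1 - exp (- x))\<^sup>2 \<le> 1 / x\<^sup>2"
    unfolding e unfolding x using y sp by (simp add: power_mult_distrib divide_simps)
  have "(sinh y)\<^sup>2 \<le> (y * cosh y)\<^sup>2" using tanh sp by (intro power_mono) auto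
  also have "\<dots> = y\<^sup>2 * (1 + (sinh y)\<^sup>2)" by (simp add: power_mult_distrib cosh_square_eq)
  finally have "(sinh y)\<^sup>2 \<le> y\<^sup>2 * (1 + (sinh y)\<^sup>2)" .
  thus "1 / x\<^sup>2 - 1 / 4 \<le> exp (- x) / (1 - exp (- x))\<^sup>2"
    unfolding e unfolding x using y sp by (simp add: power_mult_distrib field_simps)
qed

text \<open>This is the sum of \<open>j * exp (- j * x)\<close> over all odd \<open>j\<close>.\<close>
definition odd_pole :: "real \<Rightarrow> real" where
  "odd_pole x = exp (- x) / (1 - exp (- x))\<^sup>2 - 2 * (exp (- x) ^ 2 / (1 - exp (- x) ^ 2)\<^sup>2)"

text \<open>The double poles at \<open>x\<close> and \<open>2 * x\<close> combine to
  \<open>1 / x\<^sup>2 - 2 / (2 * x)\<^sup>2\<close>. The error is at most \<open>1/2\<close> and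
  also at most \<open>1 / (2 * x\<^sup>2)\<close>; the power -5/4 interpolates between the two. It
  is below -1, so the errors at \<open>x = m / \<tau>\<close> are summable over \<open>m\<close>,
  and above -3/2, so their sum is \<open>o(\<tau> powr (3/2))\<close>.\<close>

lemma odd_pole_approx:
  assumes "x > 0"
  shows "\<bar>odd_pole x - 1 / (2 * x\<^sup>2)\<bar> \<le> 1/2 * x powr (- 5/4)"
proof -
  define A where "A = exp (- x) / (1 - exp (- x))\<^sup>2"
  define A2 where "A2 = exp (- (2 * x)) / (1 - exp (- (2 * x)))\<^sup>2"
  define u where "u = 1 / x\<^sup>2"
  have A: "A \<le> u" "u - 1 / 4 \<le> A"
    using exp_double_pole_bounds[OF assms] by (simp_all add: A_def u_def)
  have A2: "A2 \<le> u / 4" "u / 4 - 1 / 4 \<le> A2"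
    using exp_double_pole_bounds[of "2 * x"] assms by (simp_all add: A2_def u_def power_mult_distrib)
  have e: "exp (- x) ^ 2 = exp (- (2 * x))" by (simp add: power2_eq_square flip: exp_add)
  have o: "odd_pole x = A - 2 * A2" by (simp add: odd_pole_def A_def A2_def e)
  have A2_nonneg: "A2 \<ge> 0" by (simp add: A2_def)
  have h: "1 / (2 * x\<^sup>2) = u / 2" by (simp add: u_def)
  have nonneg: "odd_pole x \<ge> 0"
  proof -
    have "(\<lambda>j. of_bool (odd j) * (real j * exp (- x) ^ j)) sums odd_pole x"
      unfolding odd_pole_def by (rule sums_odd_mult_power) (use assms in auto)
    thus ?thesis using suminf_nonneg[of "\<lambda>j. of_bool (odd j) * (real j * exp (- x) ^ j)"]
      by (simp add: sums_iff)
  qed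
  have 1: "\<bar>odd_pole x - 1 / (2 * x\<^sup>2)\<bar> \<le> 1 / 2"
    using A A2 unfolding o h by linarith
  have 2: "\<bar>odd_pole x - 1 / (2 * x\<^sup>2)\<bar> \<le> u / 2"
    using A A2_nonneg nonneg unfolding h abs_le_iff using o by linarith
  show ?thesis
  proof (cases "x \<le> 1")
    case True
    have "1 powr (-5/4) \<le> x powr (-5/4)"
      using powr_mono2'[of "-5/4" x 1] True assms by simp
    thus ?thesis using 1 by simp
  next
    case False
    have "u = x powr (-2)" unfolding u_def using assms by (simp add: powr_minus powr_numeral divide_simps)
    also have "\<dots> \<le> x powr (-5/4)" using False by (intro powr_mono) auto
    finally show ?thesis using 2 by simp
  qed
qed

definition odd_tail :: "real \<Rightarrow> nat \<Rightarrow> real" where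
  "odd_tail q M = (\<Sum>j. of_bool (odd j \<and> j > M) * (real j * q ^ j))"

lemma summable_odd_tail:
  assumes "0 < q" "q < 1"
  shows "summable (\<lambda>j. of_bool (odd j \<and> j > M) * (real j * q ^ j))"
proof (rule summable_comparison_test'[of "\<lambda>j. real j * q ^ j" 0])
  show "summable (\<lambda>j. real j * q ^ j)"
    using sums_nat_mult_power[of q] assms by (auto simp: sums_iff)
qed (use assms in \<open>auto simp: abs_mult\<close>)

lemma odd_tail_nonneg: "0 < q \<Longrightarrow> q < 1 \<Longrightarrow> odd_tail q M \<ge> 0"
  unfolding odd_tail_def by (intro suminf_nonneg summable_odd_tail) auto

lemma odd_tail_le:
  assumes "0 < q" "q < 1"
  shows "odd_tail q M \<le> q ^ M * (1 / (1 - q)\<^sup>2 + real M / (1 - q))"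
proof -
  have "odd_tail q M = (\<Sum>i. of_bool (odd (i + Suc M) \<and> i + Suc M > M) * (real (i + Suc M) * q ^ (i + Suc M)))"
    unfolding odd_tail_def
    by (subst suminf_split_initial_segment[OF summable_odd_tail[OF assms], of _ "Suc M"]) simp
  also have "\<dots> \<le> (\<Sum>i. q ^ M * (real (Suc i) * q ^ i + real M * q ^ i))"
  proof (rule suminf_le)
    have "(\<lambda>i. q ^ M * (real (Suc i) * q ^ i + real M * q ^ i)) sums
        (q ^ M * (1 / (1 - q)\<^sup>2 + real M * (1 / (1 - q))))"
      using assms geometric_deriv_sums[of q] by (intro sums_mult sums_add geometric_sums) auto
    thus "summable (\<lambda>i. q ^ M * (real (Suc i) * q ^ i + real M * q ^ i))" by (simp add: sums_iff)
    show "summable (\<lambda>i. of_bool (odd (i + Suc M) \<and> i + Suc M > M) * (real (i + Suc M) * q ^ (i + Suc M)))"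
      using summable_ignore_initial_segment[OF summable_odd_tail[OF assms]] .
    fix i
    have "real (i + Suc M) * q ^ (i + Suc M) \<le> real (i + Suc M) * q ^ (i + M)"
      using assms by (intro mult_left_mono power_decreasing) auto
    also have "\<dots> = q ^ M * (real (Suc i) * q ^ i + real M * q ^ i)"
      by (simp add: power_add algebra_simps)
    finally have "real (i + Suc M) * q ^ (i + Suc M) \<le> q ^ M * (real (Suc i) * q ^ i + real M * q ^ i)" .
    thus "of_bool (odd (i + Suc M) \<and> i + Suc M > M) * (real (i + Suc M) * q ^ (i + Suc M)) \<le>
        q ^ M * (real (Suc i) * q ^ i + real M * q ^ i)"
      using assms by (auto intro!: mult_nonneg_nonneg add_nonneg_nonneg)
  qed
  also have "\<dots> = q ^ M * (1 / (1 - q)\<^sup>2 + real M * (1 / (1 - q)))"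
    using assms geometric_deriv_sums[of q]
    by (intro sums_unique[symmetric] sums_mult sums_add geometric_sums) auto
  finally show ?thesis by simp
qed

lemma mean_above_le:
  assumes "0 < q" "q < 1" "finite J" "\<And>j. j \<in> J \<Longrightarrow> odd j \<and> j > M" "q ^ M \<le> 1 / 2"
  shows "(\<Sum>j\<in>J. 2 * real j * q ^ j / (1 - q ^ j)) \<le> 4 * odd_tail q M"
proof -
  have "(\<Sum>j\<in>J. 2 * real j * q ^ j / (1 - q ^ j)) \<le> (\<Sum>j\<in>J. 4 * (of_bool (odd j \<and> j > M) * (real j * q ^ j)))"
  proof (rule sum_mono)
    fix j assume j: "j \<in> J"
    have "q ^ j \<le> q ^ M" using assms j by (intro power_decreasing) (auto intro: less_imp_le)
    hence "1 / (1 - q ^ j) \<le> 2" using assms(5) by (simp add: divide_simps)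
    hence "2 * real j * q ^ j * (1 / (1 - q ^ j)) \<le> 2 * real j * q ^ j * 2"
      using assms by (intro mult_left_mono) auto
    thus "2 * real j * q ^ j / (1 - q ^ j) \<le> 4 * (of_bool (odd j \<and> j > M) * (real j * q ^ j))"
      using assms(4)[OF j] by simp
  qed
  also have "\<dots> = 4 * (\<Sum>j\<in>J. of_bool (odd j \<and> j > M) * (real j * q ^ j))"
    by (simp add: sum_distrib_left)
  also have "(\<Sum>j\<in>J. of_bool (odd j \<and> j > M) * (real j * q ^ j)) \<le> odd_tail q M"
    unfolding odd_tail_def
    by (intro sum_le_suminf summable_odd_tail assms) (use assms(1) in auto)
  finally show ?thesis by simp
qed

text \<open>Expanding \<open>1 / (1 - q ^ j)\<close> geometrically and summing over \<open>j\<close>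
  first turns the mean, up to the parts above \<open>M\<close>, into the sum of
  \<open>2 * odd_pole (m / \<tau>)\<close> over positive \<open>m\<close>. The main terms add up to
  \<open>pi\<^sup>2 * \<tau>\<^sup>2 / 6\<close> by the Basel series.\<close>

lemma mean_approx:
  fixes \<tau> :: real
  assumes \<tau>: "\<tau> > 0"
  defines "q \<equiv> exp (- (1 / \<tau>))"
  assumes qM: "q ^ M \<le> 1 / 2"
  shows "\<bar>(\<Sum>j\<in>odds_upto M. 2 * real j * q ^ j / (1 - q ^ j)) - pi\<^sup>2 * \<tau>\<^sup>2 / 6\<bar>
    \<le> \<tau> powr (5/4) * (\<Sum>m. real (Suc m) powr (- 5/4)) + 4 * odd_tail q M"
proof -
  have q: "0 < q" "q < 1" using \<tau> by (auto simp: q_def)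
  define h where "h = (\<lambda>m. \<Sum>j\<in>odds_upto M. real j * (q ^ j) ^ Suc m)"
  define t where "t = (\<lambda>m. \<Sum>j. of_bool (odd j \<and> j > M) * (real j * (q ^ Suc m) ^ j))"
  have h_sums: "h sums (\<Sum>j\<in>odds_upto M. real j * (q ^ j / (1 - q ^ j)))"
    unfolding h_def
  proof (intro sums_sum sums_mult)
    fix j assume "j \<in> odds_upto M"
    hence "j > 0" by (auto simp: odds_upto_def odd_pos)
    hence "norm (q ^ j) < 1" using q by (simp add: power_less_one_iff)
    from sums_mult[OF geometric_sums[OF this], of "q ^ j"]
    show "(\<lambda>m. (q ^ j) ^ Suc m) sums (q ^ j / (1 - q ^ j))" by simp
  qed
  have odd_split: "odd_pole (real (Suc m) / \<tau>) = h m + t m" for m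
  proof -
    have qm: "0 < q ^ Suc m" "q ^ Suc m < 1" using q by (simp_all add: power_less_one_iff del: power_Suc)
    have e: "exp (- (real (Suc m) / \<tau>)) = q ^ Suc m"
      unfolding q_def exp_of_nat_mult[symmetric] by simp
    have "(\<lambda>j. of_bool (odd j) * (real j * (q ^ Suc m) ^ j)) sums odd_pole (real (Suc m) / \<tau>)"
      unfolding odd_pole_def e by (rule sums_odd_mult_power[OF qm])
    moreover have "(\<lambda>j. of_bool (j \<in> odds_upto M) * (real j * (q ^ Suc m) ^ j)
        + of_bool (odd j \<and> j > M) * (real j * (q ^ Suc m) ^ j)) sums (h m + t m)"
    proof (intro sums_add)
      have "(\<lambda>j. of_bool (j \<in> odds_upto M) * (real j * (q ^ Suc m) ^ j)) sums
          (\<Sum>j\<in>odds_upto M. of_bool (j \<in> odds_upto M) * (real j * (q ^ Suc m) ^ j))"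
        by (rule sums_finite) auto
      also have "(\<Sum>j\<in>odds_upto M. of_bool (j \<in> odds_upto M) * (real j * (q ^ Suc m) ^ j)) = h m"
        unfolding h_def by (intro sum.cong refl) (simp add: mult.commute flip: power_mult power_Suc)
      finally show "(\<lambda>j. of_bool (j \<in> odds_upto M) * (real j * (q ^ Suc m) ^ j)) sums h m" .
      show "(\<lambda>j. of_bool (odd j \<and> j > M) * (real j * (q ^ Suc m) ^ j)) sums t m"
        unfolding t_def by (rule summable_sums[OF summable_odd_tail[OF qm]])
    qed
    moreover have "(\<lambda>j. of_bool (j \<in> odds_upto M) * (real j * (q ^ Suc m) ^ j)
        + of_bool (odd j \<and> j > M) * (real j * (q ^ Suc m) ^ j)) =
        (\<lambda>j. of_bool (odd j) * (real j * (q ^ Suc m) ^ j))"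
      by (auto simp: fun_eq_iff odds_upto_def)
    ultimately show ?thesis using sums_unique2 by metis
  qed
  have t_nonneg: "t m \<ge> 0" for m
    unfolding t_def using q
    by (intro suminf_nonneg summable_odd_tail) (simp_all add: power_less_one_iff del: power_Suc)
  \<comment> \<open>In the tail \<open>j > M\<close>, so a factor \<open>(q ^ M) ^ m\<close> splits
    off and the tails are dominated by a geometric series with ratio at most
    \<open>1/2\<close>.\<close>
  have t_le: "t m \<le> odd_tail q M * (q ^ M) ^ m" for m
  proof -
    have qm: "0 < q ^ Suc m" "q ^ Suc m < 1" using q by (simp_all add: power_less_one_iff del: power_Suc)
    have "t m \<le> (\<Sum>j. of_bool (odd j \<and> j > M) * (real j * q ^ j) * (q ^ M) ^ m)"
      unfolding t_def
    proof (intro suminf_le summable_odd_tail qm summable_mult2 q)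
      fix j
      show "of_bool (odd j \<and> j > M) * (real j * (q ^ Suc m) ^ j) \<le>
          of_bool (odd j \<and> j > M) * (real j * q ^ j) * (q ^ M) ^ m"
      proof (cases "odd j \<and> j > M")
        case True
        have "(q ^ j) ^ m \<le> (q ^ M) ^ m"
          using True q by (intro power_mono power_decreasing) auto
        hence "real j * q ^ j * (q ^ j) ^ m \<le> real j * q ^ j * (q ^ M) ^ m"
          using q by (intro mult_left_mono) auto
        thus ?thesis using True
          by (simp add: power_mult_distrib power_mult[symmetric] mult_ac)
      qed auto
    qed
    also have "\<dots> = odd_tail q M * (q ^ M) ^ m"
      unfolding odd_tail_def by (rule suminf_mult2[symmetric, OF summable_odd_tail[OF q]])
    finally show ?thesis .
  qed
  have geo: "(\<lambda>m. odd_tail q M * (q ^ M) ^ m) sums (odd_tail q M * (1 / (1 - q ^ M)))"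
    using q qM by (intro sums_mult geometric_sums) auto
  have t_sm: "summable t"
    by (rule summable_comparison_test'[OF sums_summable[OF geo], of 0]) (use t_le t_nonneg in auto)
  have t_sum: "0 \<le> suminf t" "suminf t \<le> 2 * odd_tail q M"
  proof -
    show "0 \<le> suminf t" by (rule suminf_nonneg[OF t_sm t_nonneg])
    have "suminf t \<le> odd_tail q M * (1 / (1 - q ^ M))"
      using suminf_le[OF t_le t_sm sums_summable[OF geo]] geo by (simp add: sums_iff)
    also have "\<dots> \<le> odd_tail q M * 2"
      using qM odd_tail_nonneg[OF q] by (intro mult_left_mono) (auto simp: divide_simps)
    finally show "suminf t \<le> 2 * odd_tail q M" by simp
  qed
  have sq: "(\<lambda>m. 1 / (2 * (real (Suc m) / \<tau>)\<^sup>2)) sums (pi\<^sup>2 * \<tau>\<^sup>2 / 12)"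
  proof -
    have "(\<lambda>m. 1 / (real m + 1)\<^sup>2) sums (pi\<^sup>2 / 6)"
      using inverse_squares_sums by (simp add: add.commute)
    hence "(\<lambda>m. \<tau>\<^sup>2 / 2 * (1 / (real m + 1)\<^sup>2)) sums (\<tau>\<^sup>2 / 2 * (pi\<^sup>2 / 6))"
      by (rule sums_mult)
    thus ?thesis by (simp add: power_divide mult_ac add.commute)
  qed
  have pw: "summable (\<lambda>m. real (Suc m) powr (- 5/4))"
    by (subst summable_Suc_iff) (simp add: summable_real_powr_iff)
  have o_sums: "(\<lambda>m. odd_pole (real (Suc m) / \<tau>)) sums ((\<Sum>j\<in>odds_upto M. real j * (q ^ j / (1 - q ^ j))) + suminf t)"
    unfolding odd_split by (intro sums_add h_sums summable_sums t_sm)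
  have dle: "norm (odd_pole (real (Suc m) / \<tau>) - 1 / (2 * (real (Suc m) / \<tau>)\<^sup>2))
      \<le> \<tau> powr (5/4) / 2 * real (Suc m) powr (- 5/4)" for m
  proof -
    have "norm (odd_pole (real (Suc m) / \<tau>) - 1 / (2 * (real (Suc m) / \<tau>)\<^sup>2)) \<le> 1/2 * (real (Suc m) / \<tau>) powr (- 5/4)"
      unfolding real_norm_def by (rule odd_pole_approx) (use \<tau> in auto)
    also have "\<dots> = \<tau> powr (5/4) / 2 * real (Suc m) powr (- 5/4)"
      using \<tau> by (simp add: powr_divide powr_minus divide_simps)
    finally show ?thesis .
  qed
  have "norm ((\<Sum>j\<in>odds_upto M. real j * (q ^ j / (1 - q ^ j))) + suminf t - pi\<^sup>2 * \<tau>\<^sup>2 / 12)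
      \<le> \<tau> powr (5/4) / 2 * (\<Sum>m. real (Suc m) powr (- 5/4))"
    using norm_suminf_le[OF dle summable_mult[OF pw]]
    unfolding sums_unique[OF sums_diff[OF o_sums sq], symmetric] suminf_mult[OF pw] .
  hence main: "\<bar>(\<Sum>j\<in>odds_upto M. real j * (q ^ j / (1 - q ^ j))) - pi\<^sup>2 * \<tau>\<^sup>2 / 12\<bar>
      \<le> \<tau> powr (5/4) / 2 * (\<Sum>m. real (Suc m) powr (- 5/4)) + 2 * odd_tail q M"
    using t_sum unfolding real_norm_def by linarith
  have eq: "(\<Sum>j\<in>odds_upto M. 2 * real j * q ^ j / (1 - q ^ j)) =
      2 * (\<Sum>j\<in>odds_upto M. real j * (q ^ j / (1 - q ^ j)))"
    by (simp add: sum_distrib_left mult.assoc)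
  have scale: "\<bar>2 * a - b / 6\<bar> \<le> c * d + 4 * e" if "\<bar>a - b / 12\<bar> \<le> c / 2 * d + 2 * e" for a b c d e :: real
    using that by (simp add: abs_le_iff field_simps)
  show ?thesis unfolding eq by (rule scale[OF main])
qed

section \<open>Factoring out the small parts\<close>

lemma fps_nth_mult_mono:
  fixes f g f' g' :: "real fps"
  assumes "\<And>i. 0 \<le> fps_nth f i" "\<And>i. fps_nth f i \<le> fps_nth f' i"
    "\<And>i. 0 \<le> fps_nth g i" "\<And>i. fps_nth g i \<le> fps_nth g' i"
  shows "0 \<le> fps_nth (f * g) i" "fps_nth (f * g) i \<le> fps_nth (f' * g') i"
  unfolding fps_mult_nth using assms
  by (auto intro!: sum_nonneg mult_nonneg_nonneg sum_mono mult_mono intro: order_trans)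

lemma fps_nth_prod_mono:
  fixes f g :: "nat \<Rightarrow> real fps"
  assumes "\<And>j i. j \<in> J \<Longrightarrow> 0 \<le> fps_nth (f j) i" "\<And>j i. j \<in> J \<Longrightarrow> fps_nth (f j) i \<le> fps_nth (g j) i"
  shows "(\<forall>i. 0 \<le> fps_nth (\<Prod>j\<in>J. f j) i) \<and> (\<forall>i. fps_nth (\<Prod>j\<in>J. f j) i \<le> fps_nth (\<Prod>j\<in>J. g j) i)"
  using assms
proof (induction J rule: infinite_finite_induct)
  case (insert j J)
  have "(\<forall>i. 0 \<le> fps_nth (\<Prod>j\<in>J. f j) i) \<and> (\<forall>i. fps_nth (\<Prod>j\<in>J. f j) i \<le> fps_nth (\<Prod>j\<in>J. g j) i)"
    using insert by auto
  hence "0 \<le> fps_nth (f j * (\<Prod>j\<in>J. f j)) i \<and>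
      fps_nth (f j * (\<Prod>j\<in>J. f j)) i \<le> fps_nth (g j * (\<Prod>j\<in>J. g j)) i" for i
    using insert.prems
      fps_nth_mult_mono[where f = "f j" and f' = "g j" and g = "prod f J" and g' = "prod g J" and i = i]
    by auto
  thus ?case using insert.hyps by simp
qed auto

lemma fps_nth_part_fps_mono:
  "0 \<le> (fps_nth (part_fps C j) i :: real)" "fps_nth (part_fps C j) i \<le> (fps_nth (geom_fps j) i :: real)"
  by (auto simp: part_fps_def)

lemma sums_eval_real_fps:
  fixes f :: "real fps"
  assumes "fps_conv_radius f \<ge> 1" "0 < q" "q < 1"
  shows "(\<lambda>i. fps_nth f i * q ^ i) sums eval_fps f q"
  by (intro sums_eval_fps ereal_norm_less_radius) (use assms in auto)

lemma eval_fps_mono: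
  fixes f g :: "real fps"
  assumes "fps_conv_radius f \<ge> 1" "fps_conv_radius g \<ge> 1" "0 < q" "q < 1"
    "\<And>i. fps_nth f i \<le> fps_nth g i"
  shows "eval_fps f q \<le> eval_fps g q"
  by (rule sums_le[OF _ sums_eval_real_fps sums_eval_real_fps])
    (use assms in \<open>auto intro!: mult_right_mono\<close>)

lemma fps_nth_le_eval:
  fixes f :: "real fps"
  assumes "fps_conv_radius f \<ge> 1" "0 < q" "q < 1" "\<And>i. 0 \<le> fps_nth f i"
  shows "fps_nth f k * q ^ k \<le> eval_fps f q"
  using sums_eval_real_fps[OF assms(1-3)] assms
    sum_le_suminf[of "\<lambda>i. fps_nth f i * q ^ i" "{k}"] by (auto simp: sums_iff)

text \<open>Here \<open>f\<close> carries the smooth part of the size and \<open>h\<close> the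
  constrained remainder. If \<open>f\<close> were flat, the convolution would just produce the value
  of \<open>h\<close> at \<open>q\<close>; the deviation is linear in the displacement
  \<open>c + r\<close>, and summing it gives the mean. Measuring errors with the majorant
  \<open>g\<close> makes the bound independent of the constraints.\<close>

lemma convolution_approx:
  fixes f h g :: "real fps" and \<beta> \<delta> \<kappa> \<mu> q :: real
  assumes q: "0 < q" "q < 1"
    and rad: "fps_conv_radius h \<ge> 1" "fps_conv_radius g \<ge> 1"
    and mono: "\<And>i. 0 \<le> fps_nth h i" "\<And>i. fps_nth h i \<le> fps_nth g i"
    and smooth: "\<And>i. \<bar>\<kappa> * (fps_nth f i * q ^ i / S) - 1\<bar> \<le> \<beta> * \<bar>real i - \<mu>\<bar> + \<delta>"
    and \<beta>\<delta>: "0 \<le> \<beta>" "0 \<le> \<delta>" and c: "c \<le> n" "n > 0"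
  shows "\<bar>\<kappa> * (q ^ n * fps_nth (f * h) (n - c)) / S - q ^ c * eval_fps h q\<bar>
    \<le> q ^ c * ((\<beta> * \<bar>real n - \<mu>\<bar> + \<delta> + (\<beta> + 1 / n) * c) * eval_fps g q +
         (\<beta> + 1 / n) * eval_fps (fps_X * fps_deriv g) q)"
proof -
  define P where "P = (\<lambda>i. fps_nth f i * q ^ i / S)"
  define k where "k = n - c"
  define u where "u = (\<lambda>r. fps_nth h r * q ^ r * of_bool (r \<le> k) * (\<kappa> * P (k - r)))"
  define b where "b = (\<lambda>r. (\<beta> * \<bar>real n - \<mu>\<bar> + \<delta> + (\<beta> + 1 / n) * c) * (fps_nth g r * q ^ r) +
      (\<beta> + 1 / n) * (fps_nth (fps_X * fps_deriv g) r * q ^ r))"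
  have radX: "fps_conv_radius (fps_X * fps_deriv g) \<ge> 1"
    using rad(2) fps_conv_radius_deriv[of g]
    by (intro fps_conv_radius_mult_ge) (auto intro: order_trans)
  have u_sums: "u sums (\<Sum>r\<le>k. u r)"
    by (rule sums_finite) (auto simp: u_def)
  have u_sum: "(\<Sum>r\<le>k. u r) = \<kappa> * (q ^ k * fps_nth (f * h) k) / S"
  proof -
    have "fps_nth (f * h) k = (\<Sum>r\<le>k. fps_nth h r * fps_nth f (k - r))"
      by (subst mult.commute) (simp add: fps_mult_nth atLeast0AtMost)
    hence "\<kappa> * (q ^ k * fps_nth (f * h) k) / S = (\<Sum>r\<le>k. \<kappa> * (q ^ k * (fps_nth h r * fps_nth f (k - r))) / S)"
      by (simp add: sum_distrib_left sum_divide_distrib)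
    also have "\<dots> = (\<Sum>r\<le>k. u r)"
    proof (intro sum.cong refl)
      fix r assume r: "r \<in> {..k}"
      hence "q ^ k = q ^ r * q ^ (k - r)" by (simp flip: power_add)
      thus "\<kappa> * (q ^ k * (fps_nth h r * fps_nth f (k - r))) / S = u r"
        using r by (simp add: u_def P_def)
    qed
    finally show ?thesis ..
  qed
  have b_sums: "b sums ((\<beta> * \<bar>real n - \<mu>\<bar> + \<delta> + (\<beta> + 1 / n) * c) * eval_fps g q +
         (\<beta> + 1 / n) * eval_fps (fps_X * fps_deriv g) q)"
    unfolding b_def by (intro sums_add sums_mult sums_eval_real_fps rad radX q)
  have "norm (u r - fps_nth h r * q ^ r) \<le> b r" for r
  proof -
    have ub: "\<bar>of_bool (r \<le> k) * (\<kappa> * P (k - r)) - 1\<bar> \<le>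
        \<beta> * \<bar>real n - \<mu>\<bar> + \<delta> + (\<beta> + 1 / n) * c + (\<beta> + 1 / n) * r"
    proof -
      define b1 b2 b3 where "b1 = \<beta> * \<bar>real n - \<mu>\<bar>" and "b2 = \<beta> * (real c + real r)"
        and "b3 = 1 / real n * (real c + real r)"
      have nonneg: "0 \<le> b1" "0 \<le> b2" "0 \<le> b3"
        using \<beta>\<delta> by (simp_all add: b1_def b2_def b3_def)
      have "\<bar>of_bool (r \<le> k) * (\<kappa> * P (k - r)) - 1\<bar> \<le> b1 + b2 + b3 + \<delta>"
      proof (cases "r \<le> k")
        case True
        have "real (k - r) = real n - real c - real r" using True c by (simp add: k_def)
        hence "\<bar>real (k - r) - \<mu>\<bar> \<le> \<bar>real n - \<mu>\<bar> + (real c + real r)" by linarith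
        hence "\<beta> * \<bar>real (k - r) - \<mu>\<bar> \<le> \<beta> * (\<bar>real n - \<mu>\<bar> + (real c + real r))"
          using \<beta>\<delta> by (intro mult_left_mono)
        hence "\<beta> * \<bar>real (k - r) - \<mu>\<bar> \<le> b1 + b2" by (simp only: b1_def b2_def distrib_left)
        moreover have "of_bool (r \<le> k) * (\<kappa> * P (k - r)) = \<kappa> * P (k - r)" using True by simp
        ultimately show ?thesis
          using smooth[of "k - r"] nonneg unfolding P_def by linarith
      next
        \<comment> \<open>The remainder already exceeds the available size and the flatness of
          \<open>f\<close> cannot be used. The defect is exactly 1, at most
          \<open>(c + r) / n\<close> as in Markov's inequality; this is the origin of
          \<open>1 / n\<close> beside \<open>\<beta>\<close>.\<close>
        case False
        hence "real n \<le> real c + real r" using c by (simp add: k_def)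
        hence "1 \<le> b3" using c by (simp add: b3_def divide_simps)
        moreover have "of_bool (r \<le> k) * (\<kappa> * P (k - r)) = 0" using False by simp
        ultimately show ?thesis using nonneg \<beta>\<delta> by linarith
      qed
      also have "b1 + b2 + b3 + \<delta> = \<beta> * \<bar>real n - \<mu>\<bar> + \<delta> + (\<beta> + 1 / n) * c + (\<beta> + 1 / n) * r"
        by (simp add: b1_def b2_def b3_def distrib_left distrib_right add_divide_distrib)
      finally show ?thesis .
    qed
    have "norm (u r - fps_nth h r * q ^ r) = fps_nth h r * q ^ r * \<bar>of_bool (r \<le> k) * (\<kappa> * P (k - r)) - 1\<bar>"
    proof -
      have "u r - fps_nth h r * q ^ r = fps_nth h r * q ^ r * (of_bool (r \<le> k) * (\<kappa> * P (k - r)) - 1)"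
        by (simp add: u_def algebra_simps)
      thus ?thesis using mono(1)[of r] q by (simp add: abs_mult)
    qed
    also have "\<dots> \<le> fps_nth g r * q ^ r * (\<beta> * \<bar>real n - \<mu>\<bar> + \<delta> + (\<beta> + 1 / n) * c + (\<beta> + 1 / n) * r)"
      using mono[of r] q ub by (intro mult_mono) auto
    also have "\<dots> = b r"
    proof -
      have "fps_nth (fps_X * fps_deriv g) r = real r * fps_nth g r"
        by (cases r) auto
      thus ?thesis unfolding b_def by (simp add: algebra_simps)
    qed
    finally show ?thesis .
  qed
  from norm_suminf_le[OF this sums_summable[OF b_sums]]
  have "\<bar>\<kappa> * (q ^ k * fps_nth (f * h) k) / S - eval_fps h q\<bar> \<le>
      (\<beta> * \<bar>real n - \<mu>\<bar> + \<delta> + (\<beta> + 1 / n) * c) * eval_fps g q +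
         (\<beta> + 1 / n) * eval_fps (fps_X * fps_deriv g) q"
    using sums_diff[OF u_sums sums_eval_real_fps[OF rad(1) q]] b_sums
    unfolding u_sum by (simp add: sums_iff)
  hence "q ^ c * \<bar>\<kappa> * (q ^ k * fps_nth (f * h) k) / S - eval_fps h q\<bar> \<le>
      q ^ c * ((\<beta> * \<bar>real n - \<mu>\<bar> + \<delta> + (\<beta> + 1 / n) * c) * eval_fps g q +
         (\<beta> + 1 / n) * eval_fps (fps_X * fps_deriv g) q)"
    using q by (intro mult_left_mono) auto
  moreover have "q ^ c * \<bar>\<kappa> * (q ^ k * fps_nth (f * h) k) / S - eval_fps h q\<bar> =
      \<bar>q ^ c * (\<kappa> * (q ^ k * fps_nth (f * h) k) / S - eval_fps h q)\<bar>"
    using q by (simp add: abs_mult)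
  moreover have "q ^ c * (\<kappa> * (q ^ k * fps_nth (f * h) k) / S - eval_fps h q) =
      \<kappa> * (q ^ n * fps_nth (f * h) (n - c)) / S - q ^ c * eval_fps h q"
  proof -
    have "q ^ n = q ^ c * q ^ k" using c by (simp add: k_def flip: power_add)
    thus ?thesis by (simp add: k_def algebra_simps)
  qed
  ultimately show ?thesis by simp
qed

lemma eval_prod_pair_fps:
  fixes z :: "'a::{banach,real_normed_field}"
  assumes "norm z < 1"
  shows "eval_fps (\<Prod>j\<in>J. part_fps (A j) j * part_fps (B j) j) z =
    (\<Prod>j\<in>J. eval_fps (part_fps (A j) j) z * eval_fps (part_fps (B j) j) z)"
  using assms ereal_norm_less_radius[OF assms fps_conv_radius_part_fps]
  by (subst eval_fps_prod)
    (auto intro!: fps_conv_radius_mult_ge fps_conv_radius_part_fps prod.cong eval_fps_mult)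

lemma eval_prod_geom_fps:
  fixes z :: "'a::{banach,real_normed_field}"
  assumes "norm z < 1" "0 \<notin> J"
  shows "eval_fps (\<Prod>j\<in>J. geom_fps j * geom_fps j) z = (\<Prod>j\<in>J. 1 / (1 - z ^ j)\<^sup>2)"
  unfolding eval_prod_pair_fps[OF assms(1)]
proof (intro prod.cong refl)
  fix j assume "j \<in> J"
  hence "j > 0" using assms(2) by (auto intro: Nat.gr0I)
  thus "eval_fps (geom_fps j) z * eval_fps (geom_fps j) z = 1 / (1 - z ^ j)\<^sup>2"
    using assms(1) by (simp add: eval_geom_fps power2_eq_square)
qed

text \<open>Weight of the peak \<open>c\<close> together with all parts above \<open>M\<close> on
  both sides; the factors for parts up to \<open>M\<close> are common to all high peaks and left
  out.\<close>

definition peak_weight :: "real \<Rightarrow> nat \<Rightarrow> nat \<Rightarrow> real" where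
  "peak_weight q M c = q ^ c * (\<Prod>j\<in>odds_upto c - odds_upto M. 1 / (1 - q ^ j)\<^sup>2)"

definition high_peaks :: "nat \<Rightarrow> nat \<Rightarrow> nat set" where
  "high_peaks M n = {c \<in> odds_upto n. M \<le> c}"

lemma peak_weight_nonneg: "0 < q \<Longrightarrow> peak_weight q M c \<ge> 0"
  by (auto simp: peak_weight_def intro!: mult_nonneg_nonneg prod_nonneg)

text \<open>The Boltzmann measure at \<open>q\<close> makes the parts in \<open>D\<close> independent of all other data once the
  peak is at least \<open>M\<close>; \<open>smooth\<close> says that the point probabilities of the remaining parts
  below \<open>M\<close> are nearly constant around \<open>n\<close>.\<close>
lemma restricted_count_approx:
  fixes C :: "side \<Rightarrow> nat \<Rightarrow> nat set" and q \<beta> \<delta> \<kappa> \<mu> R1 R2 R3 :: real and n M :: nat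
  assumes q: "0 < q" "q < 1" and D: "D \<subseteq> odds_upto M"
    and C: "\<And>j m. 0 \<in> C j m" "\<And>j m. m \<notin> D \<Longrightarrow> C j m = UNIV"
  defines "F \<equiv> (\<Prod>j\<in>odds_upto M - D. geom_fps j * geom_fps j) :: real fps"
  defines "Z \<equiv> (\<Sum>c\<in>high_peaks M n. peak_weight q M c)"
  defines "Q \<equiv> (\<Prod>j\<in>D. 1 / (1 - q ^ j)\<^sup>2)"
  assumes smooth: "\<And>i. \<bar>\<kappa> * (fps_nth F i * q ^ i / eval_fps F q) - 1\<bar> \<le> \<beta> * \<bar>real i - \<mu>\<bar> + \<delta>"
    and \<beta>\<delta>: "0 \<le> \<beta>" "0 \<le> \<delta>" and \<kappa>: "0 \<le> \<kappa>" and n: "n > 0" and Z: "Z > 0"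
    and R1: "(\<Sum>c\<in>high_peaks M n. real c * peak_weight q M c) \<le> R1 * Z"
    and R2: "(\<Sum>j\<in>D. 2 * real j * q ^ j / (1 - q ^ j)) \<le> R2"
    and R3: "\<And>c. (\<Sum>j\<in>odds_upto c - odds_upto M. 2 * real j * q ^ j / (1 - q ^ j)) \<le> R3"
  shows "\<bar>\<kappa> * q ^ n * real (card {s \<in> odd_unimodal n. \<forall>j m. num_parts j m s \<in> C j m}) / (eval_fps F q * Q * Z)
      - (\<Prod>m\<in>D. eval_fps (part_fps (C LeftSide m) m) q * eval_fps (part_fps (C RightSide m) m) q * (1 - q ^ m)\<^sup>2)\<bar>
    \<le> \<beta> * \<bar>real n - \<mu>\<bar> + \<delta> + (\<beta> + 1 / n) * (R1 + R2 + R3) + \<kappa> * M / Z"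
proof -
  define X where "X = (\<lambda>J. \<Prod>m\<in>J. part_fps (C LeftSide m) m * part_fps (C RightSide m) m :: real fps)"
  define G where "G = (\<lambda>J. \<Prod>m\<in>J. geom_fps m * geom_fps m :: real fps)"
  define U where "U = (\<lambda>c. D \<union> (odds_upto c - odds_upto M))"
  define p where "p = (\<Prod>m\<in>D. eval_fps (part_fps (C LeftSide m) m) q * eval_fps (part_fps (C RightSide m) m) q * (1 - q ^ m)\<^sup>2)"
  define S where "S = eval_fps F q"
  have nq: "norm q < 1" using q by simp
  have finD: "finite D" using D finite_subset by blast
  have pos: "j > 0" if "j \<in> odds_upto c" for j c using that by (auto simp: odds_upto_def odd_pos)
  have lt1: "q ^ j < 1" if "j \<in> odds_upto c" for j c
    using q pos[OF that] by (simp add: power_less_one_iff)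
  have fac_pos: "1 / (1 - q ^ j)\<^sup>2 > 0" if "j \<in> odds_upto c" for j c
    using lt1[OF that] by simp
  have evG: "eval_fps (G J) q = (\<Prod>j\<in>J. 1 / (1 - q ^ j)\<^sup>2)" if "0 \<notin> J" for J
    unfolding G_def by (rule eval_prod_geom_fps[OF nq that])
  have radX: "fps_conv_radius (X J) \<ge> 1" and radG: "fps_conv_radius (G J) \<ge> 1" for J
    unfolding X_def G_def
    by (intro fps_conv_radius_prod_ge fps_conv_radius_mult_ge fps_conv_radius_part_fps)+
  have mono: "0 \<le> fps_nth (X J) i" "fps_nth (X J) i \<le> fps_nth (G J) i" for J i
  proof -
    have pair: "0 \<le> fps_nth (part_fps A j * part_fps B j :: real fps) i"
      "fps_nth (part_fps A j * part_fps B j :: real fps) i \<le> fps_nth (geom_fps j * geom_fps j) i" for A B j i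
      by (rule fps_nth_mult_mono; rule fps_nth_part_fps_mono)+
    show "0 \<le> fps_nth (X J) i" "fps_nth (X J) i \<le> fps_nth (G J) i"
      unfolding X_def G_def
      using fps_nth_prod_mono[of J "\<lambda>m. part_fps (C LeftSide m) m * part_fps (C RightSide m) m"
        "\<lambda>m. geom_fps m * geom_fps m", OF pair] by blast+
  qed
  have zero: "0 \<notin> D" "0 \<notin> U c" for c using D by (auto simp: U_def)
  have Q_pos: "Q > 0" unfolding Q_def using D fac_pos by (intro prod_pos) blast
  have S_eq: "S = (\<Prod>j\<in>odds_upto M - D. 1 / (1 - q ^ j)\<^sup>2)"
    unfolding S_def F_def using evG[of "odds_upto M - D"] by (simp add: G_def)
  have S_pos: "S > 0" unfolding S_eq using fac_pos by (intro prod_pos) blast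
  have SQ: "S * Q = eval_fps (G (odds_upto M)) q"
    unfolding evG[OF zero_notin_odds_upto] S_eq Q_def using D finite_odds_upto
    by (subst prod.subset_diff[of D]) auto
  have evGU: "q ^ c * eval_fps (G (U c)) q = Q * peak_weight q M c" for c
    unfolding evG[OF zero(2)] unfolding peak_weight_def Q_def U_def using D finD
    by (subst prod.union_disjoint) auto
  have evXU: "q ^ c * eval_fps (X (U c)) q = p * Q * peak_weight q M c" for c
  proof -
    have "eval_fps (X (U c)) q = (\<Prod>j\<in>U c. eval_fps (part_fps (C LeftSide j) j) q * eval_fps (part_fps (C RightSide j) j) q)"
      unfolding X_def by (rule eval_prod_pair_fps[OF nq])
    also have "\<dots> = (\<Prod>j\<in>D. eval_fps (part_fps (C LeftSide j) j) q * eval_fps (part_fps (C RightSide j) j) q) *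
        (\<Prod>j\<in>odds_upto c - odds_upto M. eval_fps (part_fps (C LeftSide j) j) q * eval_fps (part_fps (C RightSide j) j) q)"
      unfolding U_def using D finD by (intro prod.union_disjoint) auto
    also have "(\<Prod>j\<in>D. eval_fps (part_fps (C LeftSide j) j) q * eval_fps (part_fps (C RightSide j) j) q) = p * Q"
      unfolding p_def Q_def prod.distrib[symmetric]
    proof (intro prod.cong refl)
      fix j assume "j \<in> D"
      hence "(1 - q ^ j)\<^sup>2 \<noteq> 0" using lt1[of j M] D by auto
      thus "eval_fps (part_fps (C LeftSide j) j) q * eval_fps (part_fps (C RightSide j) j) q =
        eval_fps (part_fps (C LeftSide j) j) q * eval_fps (part_fps (C RightSide j) j) q * (1 - q ^ j)\<^sup>2 * (1 / (1 - q ^ j)\<^sup>2)"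
        by simp
    qed
    also have "(\<Prod>j\<in>odds_upto c - odds_upto M. eval_fps (part_fps (C LeftSide j) j) q * eval_fps (part_fps (C RightSide j) j) q) =
        (\<Prod>j\<in>odds_upto c - odds_upto M. 1 / (1 - q ^ j)\<^sup>2)"
    proof (intro prod.cong refl)
      fix j assume j: "j \<in> odds_upto c - odds_upto M"
      hence "C LeftSide j = UNIV" "C RightSide j = UNIV" using C(2) D by auto
      thus "eval_fps (part_fps (C LeftSide j) j) q * eval_fps (part_fps (C RightSide j) j) q = 1 / (1 - q ^ j)\<^sup>2"
        using eval_geom_fps[of j q] pos[of j c] j nq by (simp add: power2_eq_square)
    qed
    finally show ?thesis by (simp add: peak_weight_def)
  qed
  have meanGU: "q ^ c * eval_fps (fps_X * fps_deriv (G (U c))) q \<le> Q * peak_weight q M c * (R2 + R3)" for c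
  proof -
    have "q ^ c * eval_fps (fps_X * fps_deriv (G (U c))) q =
        q ^ c * eval_fps (G (U c)) q * (\<Sum>j\<in>U c. 2 * real j * q ^ j / (1 - q ^ j))"
      unfolding evG[OF zero(2)] unfolding G_def
      by (subst eval_fps_X_deriv_prod_geom_fps[OF _ zero(2) nq]) (auto simp: U_def finD)
    also have "(\<Sum>j\<in>U c. 2 * real j * q ^ j / (1 - q ^ j)) =
        (\<Sum>j\<in>D. 2 * real j * q ^ j / (1 - q ^ j)) + (\<Sum>j\<in>odds_upto c - odds_upto M. 2 * real j * q ^ j / (1 - q ^ j))"
      unfolding U_def using D finD by (intro sum.union_disjoint) auto
    also have "q ^ c * eval_fps (G (U c)) q * \<dots> \<le> q ^ c * eval_fps (G (U c)) q * (R2 + R3)"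
      unfolding evGU using R2 R3[of c] Q_pos peak_weight_nonneg[OF q(1)]
      by (intro mult_left_mono add_mono mult_nonneg_nonneg) auto
    finally show ?thesis by (simp only: evGU)
  qed
  have card_eq: "real (card {s \<in> odd_unimodal n. \<forall>j m. num_parts j m s \<in> C j m}) =
      (\<Sum>c\<in>odds_upto n. fps_nth (X (odds_upto c)) (n - c))"
    using card_odd_unimodal_restricted[of C n, where 'a = real, OF C(1)]
    by (simp add: X_def prod.distrib)
  define high where "high = (\<Sum>c\<in>high_peaks M n. fps_nth (X (odds_upto c)) (n - c))"
  define low where "low = (\<Sum>c\<in>odds_upto n - high_peaks M n. fps_nth (X (odds_upto c)) (n - c))"
  have fin_high: "finite (high_peaks M n)" by (simp add: high_peaks_def)
  have card_split: "real (card {s \<in> odd_unimodal n. \<forall>j m. num_parts j m s \<in> C j m}) = low + high"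
    unfolding card_eq low_def high_def
    by (rule sum.subset_diff) (auto simp: high_peaks_def)
  \<comment> \<open>Low peaks are bounded without any smoothness: a coefficient times its power of
    \<open>q\<close> is at most the value of the series, which is at most the full product up to
    \<open>M\<close>, that is \<open>S * Q\<close>. After normalisation the bound is small only if
    \<open>Z\<close> is large.\<close>
  have low: "0 \<le> low" "q ^ n * low \<le> M * (S * Q)"
  proof -
    show "0 \<le> low" unfolding low_def by (intro sum_nonneg mono)
    have "q ^ n * low = (\<Sum>c\<in>odds_upto n - high_peaks M n. q ^ n * fps_nth (X (odds_upto c)) (n - c))"
      by (simp add: low_def sum_distrib_left)
    also have "\<dots> \<le> real (card (odds_upto n - high_peaks M n)) * (S * Q)"
    proof (rule sum_bounded_above)
      fix c assume c: "c \<in> odds_upto n - high_peaks M n"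
      hence cM: "c < M" "c \<le> n" by (auto simp: high_peaks_def odds_upto_def)
      have "q ^ n * fps_nth (X (odds_upto c)) (n - c) \<le> q ^ (n - c) * fps_nth (X (odds_upto c)) (n - c)"
        using q mono by (intro mult_right_mono power_decreasing) auto
      also have "\<dots> \<le> eval_fps (X (odds_upto c)) q"
        using fps_nth_le_eval[OF radX q mono(1)] by (simp add: mult.commute)
      also have "\<dots> \<le> eval_fps (G (odds_upto c)) q"
        by (intro eval_fps_mono radX radG q mono)
      also have "\<dots> \<le> eval_fps (G (odds_upto M)) q"
        unfolding evG[OF zero_notin_odds_upto]
      proof (rule prod_mono2)
        show "odds_upto c \<subseteq> odds_upto M" using cM by (auto simp: odds_upto_def)
        fix j assume j: "j \<in> odds_upto M - odds_upto c"
        hence "0 < 1 - q ^ j" "1 - q ^ j \<le> 1" using lt1[of j M] q by auto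
        thus "1 \<le> 1 / (1 - q ^ j)\<^sup>2" by (simp add: power_le_one)
      next
        fix j assume "j \<in> odds_upto c"
        thus "0 \<le> 1 / (1 - q ^ j)\<^sup>2" by simp
      qed auto
      finally show "q ^ n * fps_nth (X (odds_upto c)) (n - c) \<le> S * Q" by (simp only: SQ)
    qed
    also have "\<dots> \<le> M * (S * Q)"
    proof -
      have "odds_upto n - high_peaks M n \<subseteq> {..<M}" by (auto simp: high_peaks_def)
      from card_mono[OF _ this] have "card (odds_upto n - high_peaks M n) \<le> M" by simp
      thus ?thesis using S_pos Q_pos by (intro mult_right_mono) auto
    qed
    finally show "q ^ n * low \<le> M * (S * Q)" .
  qed
  have high: "\<bar>\<kappa> * (q ^ n * high) / S - p * Q * Z\<bar> \<le>
      Q * Z * (\<beta> * \<bar>real n - \<mu>\<bar> + \<delta> + (\<beta> + 1 / n) * (R1 + R2 + R3))"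
  proof -
    define A where "A = \<beta> * \<bar>real n - \<mu>\<bar> + \<delta>"
    define B where "B = \<beta> + 1 / n"
    have B: "B \<ge> 0" using \<beta>\<delta> by (simp add: B_def)
    have "\<kappa> * (q ^ n * high) / S - p * Q * Z =
        (\<Sum>c\<in>high_peaks M n. \<kappa> * (q ^ n * fps_nth (X (odds_upto c)) (n - c)) / S - p * Q * peak_weight q M c)"
      by (simp add: high_def Z_def sum_distrib_left sum_subtractf sum_divide_distrib)
    also have "\<bar>\<dots>\<bar> \<le> (\<Sum>c\<in>high_peaks M n. Q * peak_weight q M c * (A + B * c) + B * (Q * peak_weight q M c * (R2 + R3)))"
    proof (rule order_trans[OF sum_abs sum_mono])
      fix c assume "c \<in> high_peaks M n"
      hence c: "M \<le> c" "c \<le> n" by (auto simp: high_peaks_def odds_upto_def)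
      have "odds_upto c = (odds_upto M - D) \<union> U c"
        using D c by (auto simp: U_def odds_upto_def)
      hence "X (odds_upto c) = X (odds_upto M - D) * X (U c)"
        unfolding X_def using finD by (simp only:) (rule prod.union_disjoint, auto simp: U_def)
      also have "X (odds_upto M - D) = F"
        unfolding X_def F_def using C(2) by (intro prod.cong refl) auto
      finally have XF: "X (odds_upto c) = F * X (U c)" .
      have "\<bar>\<kappa> * (q ^ n * fps_nth (X (odds_upto c)) (n - c)) / S - q ^ c * eval_fps (X (U c)) q\<bar>
          \<le> q ^ c * ((\<beta> * \<bar>real n - \<mu>\<bar> + \<delta> + (\<beta> + 1 / n) * c) * eval_fps (G (U c)) q +
         (\<beta> + 1 / n) * eval_fps (fps_X * fps_deriv (G (U c))) q)"
        unfolding XF using smooth c n \<beta>\<delta> q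
        by (intro convolution_approx radX radG mono) (auto simp: S_def)
      also have "\<dots> = q ^ c * eval_fps (G (U c)) q * (A + B * c) + B * (q ^ c * eval_fps (fps_X * fps_deriv (G (U c))) q)"
        by (simp add: A_def B_def algebra_simps)
      also have "\<dots> \<le> Q * peak_weight q M c * (A + B * c) + B * (Q * peak_weight q M c * (R2 + R3))"
        unfolding evGU using B meanGU by (intro add_left_mono mult_left_mono)
      finally show "\<bar>\<kappa> * (q ^ n * fps_nth (X (odds_upto c)) (n - c)) / S - p * Q * peak_weight q M c\<bar> \<le>
          Q * peak_weight q M c * (A + B * c) + B * (Q * peak_weight q M c * (R2 + R3))"
        unfolding evXU .
    qed
    also have "\<dots> = Q * (A + B * (R2 + R3)) * Z + Q * B * (\<Sum>c\<in>high_peaks M n. real c * peak_weight q M c)"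
      unfolding Z_def sum_distrib_left sum.distrib[symmetric]
      by (intro sum.cong refl) (simp add: algebra_simps)
    also have "\<dots> \<le> Q * (A + B * (R2 + R3)) * Z + Q * B * (R1 * Z)"
      using R1 Q_pos B by (intro add_left_mono mult_left_mono) auto
    also have "\<dots> = Q * Z * (A + B * (R1 + R2 + R3))" by (simp add: algebra_simps)
    finally show ?thesis by (simp only: A_def B_def)
  qed
  have QZ: "Q * Z > 0" using Q_pos Z by simp
  have SQZ: "S * Q * Z > 0" using S_pos Q_pos Z by (intro mult_pos_pos)
  define E where "E = \<beta> * \<bar>real n - \<mu>\<bar> + \<delta> + (\<beta> + 1 / n) * (R1 + R2 + R3)"
  have "\<kappa> * q ^ n * (low + high) / (S * Q * Z) - p = \<kappa> * (q ^ n * low) / (S * Q * Z) + (\<kappa> * (q ^ n * high) / S - p * Q * Z) / (Q * Z)"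
    using Q_pos Z S_pos by (simp add: field_simps)
  moreover have "\<bar>(\<kappa> * (q ^ n * high) / S - p * Q * Z) / (Q * Z)\<bar> \<le> E"
  proof -
    have "\<bar>\<kappa> * (q ^ n * high) / S - p * Q * Z\<bar> \<le> E * (Q * Z)"
      using high unfolding E_def by (simp only: mult.commute)
    thus ?thesis using QZ unfolding abs_divide by (simp add: divide_le_eq)
  qed
  moreover have "0 \<le> \<kappa> * (q ^ n * low) / (S * Q * Z)"
    using \<kappa> q low SQZ by (intro divide_nonneg_pos mult_nonneg_nonneg) auto
  moreover have "\<kappa> * (q ^ n * low) / (S * Q * Z) \<le> \<kappa> * M / Z"
  proof -
    have "\<kappa> * (q ^ n * low) \<le> \<kappa> * (M * (S * Q))" using low \<kappa> by (intro mult_left_mono)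
    hence "\<kappa> * (q ^ n * low) / (S * Q * Z) \<le> \<kappa> * (M * (S * Q)) / (S * Q * Z)"
      by (rule divide_right_mono) (rule less_imp_le[OF SQZ])
    also have "\<dots> = \<kappa> * M / Z" using S_pos Q_pos Z by simp
    finally show ?thesis .
  qed
  moreover have "\<bar>x - y\<bar> \<le> a + b" if "x - y = u + v" "\<bar>v\<bar> \<le> a" "0 \<le> u" "u \<le> b" for x y u v a b :: real
    using that by linarith
  ultimately have "\<bar>\<kappa> * q ^ n * (low + high) / (S * Q * Z) - p\<bar> \<le> E + \<kappa> * M / Z"
    by blast
  thus ?thesis unfolding card_split S_def E_def p_def .
qed

section \<open>The peak\<close>

lemma inverse_one_minus_le_exp: "1 / (1 - p) \<le> exp (2 * p)" if "0 \<le> p" "p \<le> 1/2" for p :: real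
proof -
  have "p * p \<le> p * (1/2)" using that by (intro mult_left_mono) auto
  hence "1 \<le> (1 + 2 * p) * (1 - p)" by (simp add: algebra_simps)
  also have "\<dots> \<le> exp (2 * p) * (1 - p)"
    using that by (intro mult_right_mono exp_ge_add_one_self) auto
  finally show ?thesis using that by (simp add: divide_simps)
qed

lemma exp_le_inverse_one_minus: "exp p \<le> 1 / (1 - p)" if "p < 1" for p :: real
  using exp_ge_add_one_self[of "- p"] that by (simp add: exp_minus field_simps)

lemma sum_powers_above_le:
  fixes q :: real
  assumes "0 < q" "q < 1" "finite J" "\<And>j. j \<in> J \<Longrightarrow> M < j"
  shows "(\<Sum>j\<in>J. q ^ j) \<le> q ^ M / (1 - q)"
proof -
  have "(\<Sum>j\<in>J. q ^ j) = q ^ M * (\<Sum>j\<in>J. q ^ (j - M))"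
    using assms(4) by (auto simp: sum_distrib_left less_imp_le simp flip: power_add intro!: sum.cong)
  also have "(\<Sum>j\<in>J. q ^ (j - M)) = (\<Sum>i\<in>(\<lambda>j. j - M) ` J. q ^ i)"
    using assms(4) by (subst sum.reindex) (force intro!: inj_onI simp: comp_def)+
  also have "\<dots> \<le> (\<Sum>i. q ^ i)"
    using assms by (intro sum_le_suminf) auto
  also have "\<dots> = 1 / (1 - q)" using assms by (simp add: suminf_geometric)
  finally show ?thesis using assms by (simp add: mult_left_mono)
qed

lemma peak_weight_le:
  assumes q: "0 < q" "q < 1" "q ^ M \<le> 1/2"
  shows "peak_weight q M c \<le> q ^ c * exp (4 * (q ^ M / (1 - q)))"
proof -
  have "(\<Prod>j\<in>odds_upto c - odds_upto M. 1 / (1 - q ^ j)\<^sup>2) \<le> (\<Prod>j\<in>odds_upto c - odds_upto M. exp (4 * q ^ j))"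
  proof (rule prod_mono)
    fix j assume "j \<in> odds_upto c - odds_upto M"
    hence "M < j" by (auto simp: odds_upto_def)
    hence "q ^ j \<le> q ^ M" using q by (intro power_decreasing) auto
    hence "q ^ j \<le> 1/2" using q(3) by linarith
    hence p: "0 \<le> q ^ j" "q ^ j \<le> 1/2" using q(1) by simp_all
    have "(1 / (1 - q ^ j)) ^ 2 \<le> (exp (2 * q ^ j)) ^ 2"
      using p by (intro power_mono inverse_one_minus_le_exp) auto
    also have "\<dots> = exp (4 * q ^ j)" by (simp add: power2_eq_square flip: exp_add)
    finally show "0 \<le> 1 / (1 - q ^ j)\<^sup>2 \<and> 1 / (1 - q ^ j)\<^sup>2 \<le> exp (4 * q ^ j)"
      by (simp add: power_divide)
  qed
  also have "\<dots> = exp (4 * (\<Sum>j\<in>odds_upto c - odds_upto M. q ^ j))"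
    by (simp add: exp_sum sum_distrib_left)
  also have "\<dots> \<le> exp (4 * (q ^ M / (1 - q)))"
    unfolding exp_le_cancel_iff
  proof (rule mult_left_mono)
    show "(\<Sum>j\<in>odds_upto c - odds_upto M. q ^ j) \<le> q ^ M / (1 - q)"
      by (rule sum_powers_above_le[OF q(1,2)]) (auto simp: odds_upto_def)
  qed simp
  finally show ?thesis unfolding peak_weight_def using q by (intro mult_left_mono) auto
qed

text \<open>The odd numbers \<open>c\<close>, \<open>c - 2\<close>, ... , \<open>L div 2\<close> in
  number, lie above \<open>M\<close>, and each contributes a factor of at least
  \<open>exp (2 * q ^ c)\<close>. Rounding in \<open>L div 2\<close> costs the -1.\<close>

lemma peak_weight_ge:
  assumes q: "0 < q" "q < 1" and c: "odd c" "M + L \<le> c"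
  shows "peak_weight q M c \<ge> q ^ c * exp ((real L - 1) * q ^ c)"
proof -
  define K where "K = L div 2"
  have "(\<lambda>i. c - 2 * i) ` {..<K} \<subseteq> odds_upto c - odds_upto M"
    using c by (auto simp: K_def odds_upto_def)
  moreover have "inj_on (\<lambda>i. c - 2 * i) {..<K}"
    using c by (auto simp: K_def intro!: inj_onI)
  ultimately have K: "K \<le> card (odds_upto c - odds_upto M)"
    using card_inj_on_le[of "\<lambda>i. c - 2 * i" "{..<K}" "odds_upto c - odds_upto M"] by auto
  have "real L \<le> 2 * real K + 1" by (simp add: K_def)
  hence "(real L - 1) * q ^ c \<le> 2 * real K * q ^ c"
    using q by (intro mult_right_mono) auto
  also have "\<dots> \<le> 2 * (real (card (odds_upto c - odds_upto M)) * q ^ c)"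
    using K q by (auto intro!: mult_right_mono)
  also have "real (card (odds_upto c - odds_upto M)) * q ^ c \<le> (\<Sum>j\<in>odds_upto c - odds_upto M. q ^ j)"
    by (rule sum_bounded_below) (use q in \<open>auto simp: odds_upto_def intro!: power_decreasing\<close>)
  finally have "exp ((real L - 1) * q ^ c) \<le> exp (2 * (\<Sum>j\<in>odds_upto c - odds_upto M. q ^ j))"
    by simp
  also have "\<dots> = (\<Prod>j\<in>odds_upto c - odds_upto M. exp (q ^ j) ^ 2)"
    by (simp add: exp_sum sum_distrib_left exp_double)
  also have "\<dots> \<le> (\<Prod>j\<in>odds_upto c - odds_upto M. 1 / (1 - q ^ j)\<^sup>2)"
  proof (rule prod_mono)
    fix j assume "j \<in> odds_upto c - odds_upto M"
    hence "j > 0" by (auto simp: odds_upto_def odd_pos)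
    hence "q ^ j < 1" using q by (simp add: power_less_one_iff)
    hence "exp (q ^ j) ^ 2 \<le> (1 / (1 - q ^ j)) ^ 2"
      by (intro power_mono exp_le_inverse_one_minus) auto
    thus "0 \<le> exp (q ^ j) ^ 2 \<and> exp (q ^ j) ^ 2 \<le> 1 / (1 - q ^ j)\<^sup>2"
      by (simp add: power_divide)
  qed
  finally show ?thesis unfolding peak_weight_def using q by (intro mult_left_mono) auto
qed

text \<open>With this threshold the peak exceeds \<open>peak_cutoff \<tau>\<close> with overwhelming probability, while
  the parts above it contribute only \<open>o(\<tau> powr (3/2))\<close> to the size.\<close>
definition peak_cutoff :: "real \<Rightarrow> nat" where
  "peak_cutoff \<tau> = nat \<lceil>3/4 * \<tau> * ln \<tau>\<rceil>"

lemma peak_cutoff_bounds: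
  assumes "\<tau> \<ge> 1"
  shows "3/4 * \<tau> * ln \<tau> \<le> peak_cutoff \<tau>" "peak_cutoff \<tau> \<le> 3/4 * \<tau> * ln \<tau> + 1"
    "exp (- (1 / \<tau>)) ^ peak_cutoff \<tau> \<le> \<tau> powr (- 3/4)"
proof -
  have "0 \<le> 3/4 * \<tau> * ln \<tau>" using assms by (intro mult_nonneg_nonneg) auto
  thus b: "3/4 * \<tau> * ln \<tau> \<le> peak_cutoff \<tau>" "peak_cutoff \<tau> \<le> 3/4 * \<tau> * ln \<tau> + 1"
    unfolding peak_cutoff_def by linarith+
  have "3/4 * ln \<tau> \<le> peak_cutoff \<tau> / \<tau>" using b(1) assms by (simp add: field_simps)
  moreover have "exp (- (1 / \<tau>)) ^ peak_cutoff \<tau> = exp (- (peak_cutoff \<tau> / \<tau>))"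
    by (simp flip: exp_of_nat_mult)
  moreover have "\<tau> powr (- 3/4) = exp (- (3/4 * ln \<tau>))" using assms by (simp add: powr_def)
  ultimately show "exp (- (1 / \<tau>)) ^ peak_cutoff \<tau> \<le> \<tau> powr (- 3/4)" by simp
qed

lemma inverse_one_minus_exp_le:
  fixes \<tau> :: real
  assumes "\<tau> > 0"
  shows "1 / (1 - exp (- (1 / \<tau>))) \<le> 1 + \<tau>"
proof -
  have "1 / \<tau> / (1 + 1 / \<tau>) \<le> 1 - exp (- (1 / \<tau>))"
    by (rule one_minus_exp_minus_ge) (use assms in auto)
  moreover have "1 / \<tau> / (1 + 1 / \<tau>) = 1 / (1 + \<tau>)" using assms by (simp add: field_simps)
  ultimately have "1 \<le> (1 + \<tau>) * (1 - exp (- (1 / \<tau>)))"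
    using assms by (simp add: divide_le_eq mult.commute)
  thus ?thesis using assms by (subst pos_divide_le_eq) auto
qed

definition peak_total :: "real \<Rightarrow> nat \<Rightarrow> real" where
  "peak_total \<tau> n = (\<Sum>c\<in>high_peaks (peak_cutoff \<tau>) n. peak_weight (exp (- (1 / \<tau>))) (peak_cutoff \<tau>) c)"

text \<open>A single peak at distance about \<tau> above the cutoff suffices: its own weight still
  has order \<open>\<tau> powr (- 3/4)\<close>, while the roughly \<open>\<tau> / 2\<close> odd
  parts below it and above the cutoff contribute an exponential of order
  \<open>\<tau> powr (1/4)\<close> in the exponent.\<close>

lemma peak_total_ge:
  assumes \<tau>: "\<tau> \<ge> 1" and n: "3/4 * \<tau> * ln \<tau> + \<tau> + 3 \<le> real n"
  defines "\<rho> \<equiv> exp (- 4) * \<tau> powr (- 3/4)"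
  shows "peak_total \<tau> n \<ge> \<rho> * exp ((\<tau> - 1) * \<rho>)"
proof -
  define q where "q = exp (- (1 / \<tau>))"
  define M where "M = peak_cutoff \<tau>"
  define L where "L = nat \<lceil>\<tau>\<rceil>"
  have q: "0 < q" "q < 1" using \<tau> by (auto simp: q_def)
  have L: "\<tau> \<le> real L" "real L \<le> \<tau> + 1" using \<tau> unfolding L_def by linarith+
  obtain c where c: "odd c" "M + L \<le> c" "c \<le> M + L + 1"
  proof (cases "odd (M + L)")
    case True
    thus ?thesis using that[of "M + L"] by simp
  next
    case False
    thus ?thesis using that[of "M + L + 1"] by simp
  qed
  \<comment> \<open>The 3 collects one unit each for rounding the cutoff, for rounding \<tau> and
    for the parity of \<open>c\<close>.\<close>
  have cr: "real c \<le> 3/4 * \<tau> * ln \<tau> + \<tau> + 3"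
    using peak_cutoff_bounds(2)[OF \<tau>] L c by (simp add: M_def)
  have "real c / \<tau> \<le> (3/4 * \<tau> * ln \<tau> + \<tau> + 3) / \<tau>"
    using cr \<tau> by (intro divide_right_mono) auto
  also have "\<dots> = 3/4 * ln \<tau> + 1 + 3 / \<tau>"
    using \<tau> by (simp add: field_simps)
  also have "\<dots> \<le> 3/4 * ln \<tau> + 4" using \<tau> by (simp add: field_simps)
  finally have "- 4 + (- 3/4) * ln \<tau> \<le> - (real c / \<tau>)" by simp
  hence "exp (- 4 + (- 3/4) * ln \<tau>) \<le> exp (- (real c / \<tau>))" by (simp only: exp_le_cancel_iff)
  moreover have "exp (- 4 + (- 3/4) * ln \<tau>) = \<rho>"
    using \<tau> unfolding exp_add by (simp add: \<rho>_def powr_def)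
  moreover have "exp (- (real c / \<tau>)) = q ^ c" by (simp add: q_def flip: exp_of_nat_mult)
  ultimately have \<rho>: "\<rho> \<le> q ^ c" by simp
  have "\<rho> * exp ((\<tau> - 1) * \<rho>) \<le> q ^ c * exp ((real L - 1) * q ^ c)"
  proof (intro mult_mono \<rho>)
    show "exp ((\<tau> - 1) * \<rho>) \<le> exp ((real L - 1) * q ^ c)"
      unfolding exp_le_cancel_iff using \<rho> L \<tau> by (intro mult_mono) (auto simp: \<rho>_def)
  qed (use q in auto)
  also have "\<dots> \<le> peak_weight q M c" by (rule peak_weight_ge[OF q c(1,2)])
  also have "\<dots> \<le> (\<Sum>c\<in>high_peaks M n. peak_weight q M c)"
  proof (rule member_le_sum)
    have "real c \<le> real n" using cr n by linarith
    thus "c \<in> high_peaks M n" using c by (auto simp: high_peaks_def odds_upto_def)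
  qed (auto simp: high_peaks_def peak_weight_nonneg q)
  finally show ?thesis by (simp add: peak_total_def q_def M_def)
qed

text \<open>Peaks up to \<open>\<tau> powr (4/3)\<close> are bounded by that value, which is
  \<open>o(\<tau> powr (3/2))\<close>. Beyond it
  \<open>q ^ c \<le> exp (- (\<tau> powr (1/3)))\<close>, which beats the product over the parts
  above the cutoff, an exponential of order \<open>\<tau> powr (1/4)\<close> in the exponent; so 4/3
  has to lie between 5/4 and 3/2. \<open>Z \<ge> 1\<close> turns the additive remainder into a
  multiple of the total weight.\<close>

lemma peak_mean_le:
  assumes \<tau>: "\<tau> \<ge> 3" and Z: "peak_total \<tau> n \<ge> 1"
  shows "(\<Sum>c\<in>high_peaks (peak_cutoff \<tau>) n. real c * peak_weight (exp (- (1 / \<tau>))) (peak_cutoff \<tau>) c) \<le>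
    (\<tau> powr (4/3) + (real n)\<^sup>2 * exp (4 * (\<tau> powr (- 3/4) * (1 + \<tau>)) - \<tau> powr (1/3))) * peak_total \<tau> n"
proof -
  define q where "q = exp (- (1 / \<tau>))"
  define M where "M = peak_cutoff \<tau>"
  define H where "H = high_peaks M n"
  define e where "e = exp (4 * (\<tau> powr (- 3/4) * (1 + \<tau>)) - \<tau> powr (1/3))"
  have q: "0 < q" "q < 1" using \<tau> by (auto simp: q_def)
  have qM: "q ^ M \<le> \<tau> powr (- 3/4)"
    unfolding q_def M_def by (rule peak_cutoff_bounds) (use \<tau> in auto)
  have "\<tau> powr (- 3/4) \<le> 3 powr (- 3/4)"
    using powr_mono2'[of "- 3/4" 3 \<tau>] \<tau> by simp
  also have "\<dots> \<le> 1 / 2"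
  proof -
    have "(2::real) = (2 powr (4/3)) powr (3/4)" by (simp add: powr_powr)
    also have "\<dots> \<le> 3 powr (3/4)"
    proof (intro powr_mono2)
      have "2 powr (4/3) = (16::real) powr (1/3)"
        using powr_powr[of "2::real" 4 "1/3"] by simp
      also have "\<dots> \<le> 27 powr (1/3)" by (intro powr_mono2) auto
      also have "\<dots> = (3::real)" using powr_powr[of "3::real" 3 "1/3"] by simp
      finally show "2 powr (4/3) \<le> (3::real)" .
    qed auto
    finally show ?thesis by (simp add: powr_minus divide_simps)
  qed
  finally have half: "q ^ M \<le> 1/2" using qM by linarith
  have "real c * peak_weight q M c \<le> \<tau> powr (4/3) * peak_weight q M c + real n * e" if c: "c \<in> H" for c
  proof (cases "real c \<le> \<tau> powr (4/3)")
    case True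
    hence "real c * peak_weight q M c \<le> \<tau> powr (4/3) * peak_weight q M c"
      using peak_weight_nonneg[OF q(1)] by (intro mult_right_mono) auto
    moreover have "0 \<le> real n * e" by (simp add: e_def)
    ultimately show ?thesis by linarith
  next
    case False
    have "\<tau> powr (1/3) = \<tau> powr (4/3) / \<tau>" using powr_add[of \<tau> "1/3" 1] \<tau> by simp
    also have "\<dots> \<le> real c / \<tau>" using False \<tau> by (intro divide_right_mono) auto
    finally have "exp (- (real c / \<tau>)) \<le> exp (- (\<tau> powr (1/3)))" by simp
    hence qc: "q ^ c \<le> exp (- (\<tau> powr (1/3)))" by (simp add: q_def flip: exp_of_nat_mult)
    have "q ^ M / (1 - q) = q ^ M * (1 / (1 - q))" by simp
    also have "\<dots> \<le> \<tau> powr (- 3/4) * (1 + \<tau>)"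
      using inverse_one_minus_exp_le[of \<tau>] \<tau> q by (intro mult_mono qM) (auto simp: q_def)
    finally have "exp (4 * (q ^ M / (1 - q))) \<le> exp (4 * (\<tau> powr (- 3/4) * (1 + \<tau>)))" by simp
    hence "q ^ c * exp (4 * (q ^ M / (1 - q))) \<le> exp (- (\<tau> powr (1/3))) * exp (4 * (\<tau> powr (- 3/4) * (1 + \<tau>)))"
      using qc q by (intro mult_mono) auto
    also have "\<dots> = e" by (simp add: e_def flip: exp_add)
    finally have "peak_weight q M c \<le> e" using peak_weight_le[OF q half, of c] by linarith
    moreover have "c \<le> n" using c by (auto simp: H_def high_peaks_def odds_upto_def)
    ultimately have "real c * peak_weight q M c \<le> real n * e"
      using peak_weight_nonneg[OF q(1)] by (intro mult_mono) auto
    moreover have "0 \<le> \<tau> powr (4/3) * peak_weight q M c" using peak_weight_nonneg[OF q(1)] by simp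
    ultimately show ?thesis by linarith
  qed
  hence "(\<Sum>c\<in>H. real c * peak_weight q M c) \<le> (\<Sum>c\<in>H. \<tau> powr (4/3) * peak_weight q M c + real n * e)"
    by (intro sum_mono)
  also have "\<dots> = \<tau> powr (4/3) * peak_total \<tau> n + real (card H) * (real n * e)"
    by (simp add: sum.distrib sum_distrib_left peak_total_def H_def M_def q_def)
  also have "real (card H) * (real n * e) \<le> (real n)\<^sup>2 * e * peak_total \<tau> n"
  proof -
    have "H \<subseteq> {1..n}" by (auto simp: H_def high_peaks_def odds_upto_def Suc_le_eq odd_pos)
    from card_mono[OF _ this] have "card H \<le> n" by simp
    hence "real (card H) * (real n * e) \<le> real n * (real n * e)"
      by (intro mult_right_mono) (auto simp: e_def)
    also have "\<dots> = (real n)\<^sup>2 * e * 1" by (simp add: power2_eq_square)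
    also have "\<dots> \<le> (real n)\<^sup>2 * e * peak_total \<tau> n"
      using Z by (intro mult_left_mono) (auto simp: e_def)
    finally show ?thesis .
  qed
  finally show ?thesis by (simp add: H_def M_def q_def e_def algebra_simps)
qed

section \<open>Asymptotics\<close>

text \<open>Counting uses real series, Fourier inversion complex ones; their coefficients are the
  same numbers.\<close>

lemma of_real_fps_nth_prod_geom_fps:
  "complex_of_real (fps_nth (\<Prod>j\<in>J. geom_fps j * geom_fps j) i) =
    fps_nth (\<Prod>j\<in>J. geom_fps j * geom_fps j) i"
proof -
  have mult: "complex_of_real (fps_nth (f * g) i) = fps_nth (f' * g') i"
    if "\<And>i. complex_of_real (fps_nth f i) = fps_nth f' i" "\<And>i. complex_of_real (fps_nth g i) = fps_nth g' i"
    for f g f' g' i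
    by (simp add: fps_mult_nth that)
  have geom: "complex_of_real (fps_nth (geom_fps j) i) = fps_nth (geom_fps j) i" for j i
    by (simp add: part_fps_def)
  show ?thesis
  proof (induction J arbitrary: i rule: infinite_finite_induct)
    case (insert j J)
    have "complex_of_real (fps_nth (geom_fps j * geom_fps j * (\<Prod>j\<in>J. geom_fps j * geom_fps j)) i) =
        fps_nth (geom_fps j * geom_fps j * (\<Prod>j\<in>J. geom_fps j * geom_fps j)) i"
      by (intro mult geom insert.IH)
    thus ?case using insert.hyps by simp
  qed auto
qed

definition size_char :: "real \<Rightarrow> nat set \<Rightarrow> real \<Rightarrow> complex" where
  "size_char q J \<theta> = (\<Prod>j\<in>J. (1 - q ^ j) / (1 - (q * cis \<theta>) ^ j))\<^sup>2"

definition size_mean :: "real \<Rightarrow> nat set \<Rightarrow> real" where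
  "size_mean q J = (\<Sum>j\<in>J. 2 * real j * q ^ j / (1 - q ^ j))"

definition size_var :: "real \<Rightarrow> nat set \<Rightarrow> real" where
  "size_var q J = (\<Sum>j\<in>J. 2 * (real j)\<^sup>2 * q ^ j / (1 - q ^ j)\<^sup>2)"

definition size_prob :: "real \<Rightarrow> nat set \<Rightarrow> nat \<Rightarrow> real" where
  "size_prob q J i = fps_nth (\<Prod>j\<in>J. geom_fps j * geom_fps j) i * q ^ i /
     eval_fps (\<Prod>j\<in>J. geom_fps j * geom_fps j) q"

lemma size_prob_fourier:
  assumes q: "0 < q" "q < 1" and J: "finite J" "0 \<notin> J"
  shows "of_real (size_prob q J i) =
    (LBINT \<theta>:{-pi..pi}. size_char q J \<theta> * cis (- (real i * \<theta>))) / (2 * pi)"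
proof -
  let ?F = "(\<Prod>j\<in>J. geom_fps j * geom_fps j) :: real fps"
  let ?G = "(\<Prod>j\<in>J. geom_fps j * geom_fps j) :: complex fps"
  have "fps_conv_radius ?G \<ge> 1"
    by (intro fps_conv_radius_prod_ge fps_conv_radius_mult_ge fps_conv_radius_part_fps)
  hence rad: "ereal q < fps_conv_radius ?G"
    using ereal_norm_less_radius[of "complex_of_real q" ?G] q by simp
  have nz: "(1 - complex_of_real q ^ j)\<^sup>2 \<noteq> 0" if "j \<in> J" for j
  proof -
    have "j > 0" using that J by (auto intro: Nat.gr0I)
    hence "q ^ j < 1" using q by (simp add: power_less_one_iff)
    hence "complex_of_real (1 - q ^ j) \<noteq> 0" by (simp only: of_real_eq_0_iff)
    thus ?thesis by simp
  qed
  have char: "size_char q J \<theta> = 1 / of_real (eval_fps ?F q) * eval_fps ?G (of_real q * cis \<theta>)" for \<theta>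
  proof -
    have e1: "complex_of_real (eval_fps ?F q) = (\<Prod>j\<in>J. 1 / (1 - of_real q ^ j)\<^sup>2)"
      using q J by (subst eval_prod_geom_fps) simp_all
    have e2: "eval_fps ?G (of_real q * cis \<theta>) = (\<Prod>j\<in>J. 1 / (1 - (of_real q * cis \<theta>) ^ j)\<^sup>2)"
      using q J by (intro eval_prod_geom_fps) (simp_all add: norm_mult)
    have "1 / complex_of_real (eval_fps ?F q) = (\<Prod>j\<in>J. (1 - of_real q ^ j)\<^sup>2)"
      unfolding e1 using nz by (simp add: prod_dividef)
    thus ?thesis unfolding e2
      by (simp add: size_char_def power_divide prod_dividef flip: prod_power_distrib)
  qed
  have "(LBINT \<theta>:{-pi..pi}. size_char q J \<theta> * cis (- (real i * \<theta>))) =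
      1 / of_real (eval_fps ?F q) * (LBINT \<theta>:{-pi..pi}. eval_fps ?G (of_real q * cis \<theta>) * cis (- (real i * \<theta>)))"
    unfolding char mult.assoc by (rule set_integral_mult_right)
  also have "\<dots> / (2 * pi) = 1 / of_real (eval_fps ?F q) * (fps_nth ?G i * of_real (q ^ i))"
    unfolding fps_nth_fourier[OF q(1) rad] by simp
  also have "\<dots> = of_real (size_prob q J i)"
    unfolding size_prob_def of_real_fps_nth_prod_geom_fps[symmetric] by simp
  finally show ?thesis ..
qed

lemma size_char_measurable: "size_char q J \<in> borel_measurable borel"
proof -
  have [measurable]: "cis \<in> borel_measurable borel"
    by (intro borel_measurable_continuous_onI continuous_intros)
  show ?thesis unfolding size_char_def by measurable
qed

lemma size_local_limit:
  fixes \<tau> :: "nat \<Rightarrow> real" and M :: "nat \<Rightarrow> nat" and D :: "nat \<Rightarrow> nat set"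
  assumes \<tau>: "filterlim \<tau> at_top sequentially"
    and M: "\<forall>\<^sub>F n in sequentially. \<tau> n \<le> M n \<and> M n \<le> 3/4 * \<tau> n * ln (\<tau> n) + 1"
    and D: "\<forall>\<^sub>F n in sequentially. finite (D n) \<and> 16 * real (card (D n)) \<le> \<tau> n - 2"
  defines "q \<equiv> \<lambda>n. exp (- (1 / \<tau> n))" and "J \<equiv> \<lambda>n. odds_upto (M n) - D n"
  shows "\<exists>\<delta>. \<delta> \<longlonglongrightarrow> 0 \<and> (\<forall>\<^sub>F n in sequentially. \<forall>i.
    \<bar>sqrt (2 * pi * size_var (q n) (J n)) * size_prob (q n) (J n) i - 1\<bar>
      \<le> \<bar>real i - size_mean (q n) (J n)\<bar> / sqrt (size_var (q n) (J n)) + \<delta> n)"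
proof -
  define T where "T = (\<lambda>n. \<Sum>j\<in>J n. real j ^ 3 * q n ^ j / (1 - q n ^ j) ^ 3)"
  have \<tau>_ge: "\<forall>\<^sub>F n in sequentially. \<tau> n \<ge> c" for c
    using \<tau> by (rule filterlim_at_top[THEN iffD1, rule_format])
  have J: "finite (J n)" "0 \<notin> J n" "J n \<subseteq> {1..M n}" for n
    by (auto simp: J_def odds_upto_def Suc_le_eq odd_pos)
  have good: "\<forall>\<^sub>F n in sequentially. \<tau> n \<ge> 4 \<and> 0 < q n \<and> q n < 1"
    using \<tau>_ge[of 4] by eventually_elim (auto simp: q_def)
  define good_log where "good_log = (\<lambda>n \<theta> w. exp w = size_char (q n) (J n) \<theta> \<and>
      Re w \<le> - 2 * (\<Sum>j\<in>J n. q n ^ j * (1 - cos (real j * \<theta>))) \<and>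
      norm (w - (\<i> * \<theta> * size_mean (q n) (J n) - \<theta>\<^sup>2 / 2 * size_var (q n) (J n))) \<le> \<bar>\<theta>\<bar> ^ 3 * T n)"
  \<comment> \<open>A logarithm is known to exist only for each \<open>n\<close> and angle
    separately. A pointwise choice is harmless, as measurability is asked of the characteristic
    function and not of its logarithm.\<close>
  define W where "W = (\<lambda>n \<theta>. SOME w. good_log n \<theta> w)"
  have W': "good_log n \<theta> (W n \<theta>)" if "0 < q n" "q n < 1" for n \<theta>
    unfolding W_def
  proof (rule someI_ex)
    show "\<exists>w. good_log n \<theta> w"
      by (rule prod_geometric_char_exp[OF J(1,2)[of n] that, of \<theta>])
        (auto simp: good_log_def size_char_def size_mean_def size_var_def T_def)
  qed
  have W: "exp (W n \<theta>) = size_char (q n) (J n) \<theta>"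
      "Re (W n \<theta>) \<le> - 2 * (\<Sum>j\<in>J n. q n ^ j * (1 - cos (real j * \<theta>)))"
      "norm (W n \<theta> - (\<i> * \<theta> * size_mean (q n) (J n) - \<theta>\<^sup>2 / 2 * size_var (q n) (J n))) \<le> \<bar>\<theta>\<bar> ^ 3 * T n"
    if "0 < q n" "q n < 1" for n \<theta>
    using W'[OF that, of \<theta>] unfolding good_log_def by blast+
  have V_ge: "\<forall>\<^sub>F n in sequentially. size_var (q n) (J n) \<ge> \<tau> n ^ 3 / 12"
    using good M D
  proof eventually_elim
    case (elim n)
    thus ?case unfolding size_var_def q_def J_def by (intro variance_ge) auto
  qed
  show ?thesis
  proof (rule local_limit[where C = 48 and a = "1/1000" and W = W and \<tau> = \<tau> and T = T
        and \<phi> = "\<lambda>n. size_char (q n) (J n)"])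
    show "size_char (q n) (J n) \<in> borel_measurable borel" for n by (rule size_char_measurable)
    show "\<forall>\<^sub>F n in sequentially. \<tau> n > 0" using \<tau>_ge[of 4] by eventually_elim auto
    show "filterlim (\<lambda>n. size_var (q n) (J n)) at_top sequentially"
    proof (rule filterlim_at_top_mono[OF _ V_ge])
      have "filterlim (\<lambda>x::real. x ^ 3 / 12) at_top at_top" by real_asymp
      thus "filterlim (\<lambda>n. \<tau> n ^ 3 / 12) at_top sequentially" by (rule filterlim_compose[OF _ \<tau>])
    qed
    show "\<forall>\<^sub>F n in sequentially. size_var (q n) (J n) \<le> 48 * \<tau> n ^ 3"
      using good
    proof eventually_elim
      case (elim n)
      thus ?case unfolding size_var_def q_def by (intro variance_le J) auto
    qed
    show "\<forall>\<^sub>F n in sequentially. \<forall>\<theta>. \<bar>\<theta>\<bar> \<le> pi \<longrightarrow>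
        norm (size_char (q n) (J n) \<theta>) \<le> exp (- min (1/1000 * \<tau> n ^ 3 * \<theta>\<^sup>2) (1/1000 * \<tau> n))"
      using good M D
    proof eventually_elim
      case (elim n)
      show ?case
      proof (intro allI impI)
        fix \<theta> :: real assume \<theta>: "\<bar>\<theta>\<bar> \<le> pi"
        have "2 * (\<Sum>j\<in>J n. q n ^ j * (1 - cos (real j * \<theta>))) \<ge> min (\<tau> n ^ 3 * \<theta>\<^sup>2 / 1000) (\<tau> n / 1000)"
          unfolding q_def J_def using elim \<theta> by (intro decay_exponent_ge) auto
        hence "Re (W n \<theta>) \<le> - min (1/1000 * \<tau> n ^ 3 * \<theta>\<^sup>2) (1/1000 * \<tau> n)"
          using W(2)[of n \<theta>] elim by simp
        moreover have "norm (size_char (q n) (J n) \<theta>) = exp (Re (W n \<theta>))"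
          using W(1)[of n \<theta>] elim by (metis norm_exp_eq_Re)
        ultimately show "norm (size_char (q n) (J n) \<theta>) \<le> exp (- min (1/1000 * \<tau> n ^ 3 * \<theta>\<^sup>2) (1/1000 * \<tau> n))"
          by simp
      qed
    qed
    show "\<forall>\<^sub>F n in sequentially. \<forall>\<theta>. size_char (q n) (J n) \<theta> = exp (W n \<theta>) \<and>
        norm (W n \<theta> - (\<i> * \<theta> * size_mean (q n) (J n) - \<theta>\<^sup>2 / 2 * size_var (q n) (J n))) \<le> \<bar>\<theta>\<bar> ^ 3 * T n"
      using good by eventually_elim (use W(1,3) in auto)
    \<comment> \<open>The bound is of order
      \<open>\<tau> ^ 4 * ln \<tau> / \<tau> powr (9/2)\<close>, that is
      \<open>ln \<tau> / sqrt \<tau>\<close>.\<close>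
    show "(\<lambda>n. T n / sqrt (size_var (q n) (J n)) ^ 3) \<longlonglongrightarrow> 0"
    proof (rule Lim_null_comparison)
      show "\<forall>\<^sub>F n in sequentially. norm (T n / sqrt (size_var (q n) (J n)) ^ 3) \<le>
          18 * (3/4 * \<tau> n * ln (\<tau> n) + 1) * \<tau> n ^ 3 / sqrt (\<tau> n ^ 3 / 12) ^ 3"
        using good M V_ge
      proof eventually_elim
        case (elim n)
        have "T n \<ge> 0" unfolding T_def using elim J
          by (intro sum_nonneg divide_nonneg_nonneg zero_le_power) (auto simp: power_le_one)
        moreover have "T n \<le> 18 * real (M n) * \<tau> n ^ 3"
          unfolding T_def q_def by (rule third_moment_le[OF _ J(1,3)]) (use elim in auto)
        moreover have "18 * real (M n) * \<tau> n ^ 3 \<le> 18 * (3/4 * \<tau> n * ln (\<tau> n) + 1) * \<tau> n ^ 3"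
          using elim by (intro mult_right_mono) auto
        ultimately have T: "0 \<le> T n" "T n \<le> 18 * (3/4 * \<tau> n * ln (\<tau> n) + 1) * \<tau> n ^ 3" by linarith+
        have "sqrt (\<tau> n ^ 3 / 12) ^ 3 \<le> sqrt (size_var (q n) (J n)) ^ 3"
          using elim by (intro power_mono) auto
        moreover have "sqrt (\<tau> n ^ 3 / 12) ^ 3 > 0" using elim by simp
        ultimately have "T n / sqrt (size_var (q n) (J n)) ^ 3 \<le>
            18 * (3/4 * \<tau> n * ln (\<tau> n) + 1) * \<tau> n ^ 3 / sqrt (\<tau> n ^ 3 / 12) ^ 3"
          using T by (intro frac_le) linarith+
        moreover have "T n / sqrt (size_var (q n) (J n)) ^ 3 \<ge> 0"
          using T \<open>sqrt (\<tau> n ^ 3 / 12) ^ 3 \<le> _\<close> \<open>sqrt (\<tau> n ^ 3 / 12) ^ 3 > 0\<close>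
          by (intro divide_nonneg_nonneg) linarith+
        ultimately show ?case by simp
      qed
      have "((\<lambda>x::real. 18 * (3/4 * x * ln x + 1) * x ^ 3 / sqrt (x ^ 3 / 12) ^ 3) \<longlongrightarrow> 0) at_top"
        by real_asymp
      thus "(\<lambda>n. 18 * (3/4 * \<tau> n * ln (\<tau> n) + 1) * \<tau> n ^ 3 / sqrt (\<tau> n ^ 3 / 12) ^ 3) \<longlonglongrightarrow> 0"
        by (rule filterlim_compose[OF _ \<tau>])
    qed
    show "\<forall>\<^sub>F n in sequentially. \<forall>i. of_real (size_prob (q n) (J n) i) =
        (LBINT \<theta>:{-pi..pi}. size_char (q n) (J n) \<theta> * cis (- (real i * \<theta>))) / (2 * pi)"
      using good by eventually_elim (use size_prob_fourier[OF _ _ J(1,2)] in auto)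
  qed auto
qed

section \<open>Error terms of the counts\<close>

lemma quotient_approx:
  fixes x y p \<epsilon> :: real
  assumes "\<bar>x - p\<bar> \<le> \<epsilon>" "\<bar>y - 1\<bar> \<le> \<epsilon>" "0 \<le> p" "p \<le> 1" "\<epsilon> \<le> 1/2"
  shows "\<bar>x / y - p\<bar> \<le> 4 * \<epsilon>"
proof -
  have y: "y \<ge> 1/2" using assms by linarith
  have "p * \<bar>y - 1\<bar> \<le> 1 * \<epsilon>" using assms by (intro mult_mono) auto
  moreover have "x - p * y = (x - p) - p * (y - 1)" by (simp add: algebra_simps)
  moreover have "\<bar>p * (y - 1)\<bar> = p * \<bar>y - 1\<bar>" using assms by (simp add: abs_mult)
  ultimately have "\<bar>x - p * y\<bar> \<le> 2 * \<epsilon>" using assms(1) by linarith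
  moreover have "0 \<le> \<epsilon>" using assms by linarith
  hence "4 * \<epsilon> * (1/2) \<le> 4 * \<epsilon> * y" using y by (intro mult_left_mono) auto
  moreover have "x / y - p = (x - p * y) / y" using y by (simp add: field_simps)
  ultimately show ?thesis using y by (simp add: abs_divide divide_le_eq)
qed

text \<open>The bound of \<open>odd_tail_le\<close> with the estimates for the cutoff inserted; it
  has order \<open>x powr (5/4) * ln x\<close>.\<close>

definition cutoff_tail :: "real \<Rightarrow> real" where
  "cutoff_tail x = x powr (- 3/4) * ((1 + x)\<^sup>2 + (3/4 * x * ln x + 1) * (1 + x))"

lemma odd_tail_cutoff_le:
  assumes "\<tau> \<ge> 1"
  shows "odd_tail (exp (- (1 / \<tau>))) (peak_cutoff \<tau>) \<le> cutoff_tail \<tau>"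
proof -
  define q where "q = exp (- (1 / \<tau>))"
  define M where "M = peak_cutoff \<tau>"
  have q: "0 < q" "q < 1" using assms by (auto simp: q_def)
  have i: "1 / (1 - q) \<le> 1 + \<tau>"
    unfolding q_def by (rule inverse_one_minus_exp_le) (use assms in auto)
  have i0: "0 \<le> 1 / (1 - q)" using q by simp
  have M: "q ^ M \<le> \<tau> powr (- 3/4)" "real M \<le> 3/4 * \<tau> * ln \<tau> + 1"
    using peak_cutoff_bounds[OF assms] by (simp_all add: q_def M_def)
  have "odd_tail q M \<le> q ^ M * (1 / (1 - q)\<^sup>2 + real M / (1 - q))"
    by (rule odd_tail_le[OF q])
  also have "\<dots> = q ^ M * ((1 / (1 - q))\<^sup>2 + real M * (1 / (1 - q)))"
    by (simp add: power_divide)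
  also have "\<dots> \<le> \<tau> powr (- 3/4) * ((1 + \<tau>)\<^sup>2 + (3/4 * \<tau> * ln \<tau> + 1) * (1 + \<tau>))"
    using i i0 M q assms
    by (intro mult_mono add_mono power_mono) (auto intro!: add_nonneg_nonneg mult_nonneg_nonneg)
  finally show ?thesis by (simp add: cutoff_tail_def q_def M_def)
qed

text \<open>The errors of \<open>restricted_count_approx\<close> that depend on neither
  \<open>D\<close> nor the local limit theorem: the shift of the mean by the tail, the peak with the
  parts above the cutoff, and the low peaks. The size is written as
  \<open>pi\<^sup>2 * x\<^sup>2 / 6\<close>.\<close>

definition count_error :: "real \<Rightarrow> real" where
  "count_error x = 4 * cutoff_tail x / sqrt (x ^ 3 / 12) +
     (1 / sqrt (x ^ 3 / 12) + 1 / (pi\<^sup>2 * x\<^sup>2 / 6)) *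
       (x powr (4/3) + (pi\<^sup>2 * x\<^sup>2 / 6)\<^sup>2 * exp (4 * (x powr (- 3/4) * (1 + x)) - x powr (1/3)) + 4 * cutoff_tail x) +
     sqrt (2 * pi * (48 * x ^ 3)) * (3/4 * x * ln x + 1) /
       (exp (- 4) * x powr (- 3/4) * exp ((x - 1) * (exp (- 4) * x powr (- 3/4))))"

lemma count_error_tendsto: "(count_error \<longlongrightarrow> 0) at_top"
proof -
  have "((\<lambda>x. 4 * cutoff_tail x / sqrt (x ^ 3 / 12)) \<longlongrightarrow> 0) at_top"
    unfolding cutoff_tail_def by real_asymp
  moreover have "((\<lambda>x. (1 / sqrt (x ^ 3 / 12) + 1 / (pi\<^sup>2 * x\<^sup>2 / 6)) * x powr (4/3)) \<longlongrightarrow> 0) at_top"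
    by real_asymp
  moreover have "((\<lambda>x. (1 / sqrt (x ^ 3 / 12) + 1 / (pi\<^sup>2 * x\<^sup>2 / 6)) *
      ((pi\<^sup>2 * x\<^sup>2 / 6)\<^sup>2 * exp (4 * (x powr (- 3/4) * (1 + x)) - x powr (1/3)))) \<longlongrightarrow> 0) at_top"
    by real_asymp
  moreover have "((\<lambda>x. (1 / sqrt (x ^ 3 / 12) + 1 / (pi\<^sup>2 * x\<^sup>2 / 6)) * (4 * cutoff_tail x)) \<longlongrightarrow> 0) at_top"
    unfolding cutoff_tail_def by real_asymp
  moreover have "((\<lambda>x. sqrt (2 * pi * (48 * x ^ 3)) * (3/4 * x * ln x + 1) /
       (exp (- 4) * x powr (- 3/4) * exp ((x - 1) * (exp (- 4) * x powr (- 3/4))))) \<longlongrightarrow> 0) at_top"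
    by real_asymp
  ultimately have "((\<lambda>x. 4 * cutoff_tail x / sqrt (x ^ 3 / 12) +
      ((1 / sqrt (x ^ 3 / 12) + 1 / (pi\<^sup>2 * x\<^sup>2 / 6)) * x powr (4/3) +
       (1 / sqrt (x ^ 3 / 12) + 1 / (pi\<^sup>2 * x\<^sup>2 / 6)) *
         ((pi\<^sup>2 * x\<^sup>2 / 6)\<^sup>2 * exp (4 * (x powr (- 3/4) * (1 + x)) - x powr (1/3))) +
       (1 / sqrt (x ^ 3 / 12) + 1 / (pi\<^sup>2 * x\<^sup>2 / 6)) * (4 * cutoff_tail x)) +
      sqrt (2 * pi * (48 * x ^ 3)) * (3/4 * x * ln x + 1) /
       (exp (- 4) * x powr (- 3/4) * exp ((x - 1) * (exp (- 4) * x powr (- 3/4))))) \<longlongrightarrow> 0 + (0 + 0 + 0) + 0) at_top"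
    by (intro tendsto_add)
  thus ?thesis unfolding count_error_def distrib_left by simp
qed

lemma OU_prob_eq_quotient:
  assumes "n \<ge> 1"
  shows "OU_prob n E = real (card {s \<in> odd_unimodal n. E s}) / real (card (odd_unimodal n))"
  unfolding OU_prob_def
  by (subst measure_pmf_of_set[OF odd_unimodal_nonempty[OF assms] finite_odd_unimodal])
    (simp add: Int_def)

text \<open>Removing \<open>D\<close> shifts the mean by at most \<open>2 * card D * \<tau>\<close>.
  All error terms are small against \<open>\<tau> powr (3/2)\<close> once
  \<open>card D = o(sqrt \<tau>)\<close>, so the size \<open>n\<close> stays where the point
  probabilities are flat.\<close>

lemma size_mean_cutoff_approx:
  fixes \<tau> :: real
  assumes \<tau>: "\<tau> \<ge> 3" and D: "D \<subseteq> odds_upto (peak_cutoff \<tau>)"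
    and half: "exp (- (1 / \<tau>)) ^ peak_cutoff \<tau> \<le> 1/2"
  shows "\<bar>pi\<^sup>2 * \<tau>\<^sup>2 / 6 - size_mean (exp (- (1 / \<tau>))) (odds_upto (peak_cutoff \<tau>) - D)\<bar>
    \<le> \<tau> powr (5/4) * (\<Sum>m. real (Suc m) powr (- 5/4)) + 4 * cutoff_tail \<tau> + 2 * real (card D) * \<tau>"
    and "size_mean (exp (- (1 / \<tau>))) D \<le> 2 * real (card D) * \<tau>"
proof -
  define q where "q = exp (- (1 / \<tau>))"
  define M where "M = peak_cutoff \<tau>"
  have q: "0 < q" "q < 1" using \<tau> by (auto simp: q_def)
  have finD: "finite D" using D finite_subset by blast
  have bound: "0 \<le> 2 * real j * q ^ j / (1 - q ^ j)" "2 * real j * q ^ j / (1 - q ^ j) \<le> 2 * \<tau>" if "j \<in> D" for j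
  proof -
    have "j > 0" using that D by (auto simp: odds_upto_def odd_pos)
    from geometric_mean_le[OF _ this, of \<tau>] \<tau>
    show "2 * real j * q ^ j / (1 - q ^ j) \<le> 2 * \<tau>" by (simp add: q_def)
    show "0 \<le> 2 * real j * q ^ j / (1 - q ^ j)" using q by (simp add: power_le_one)
  qed
  have mD: "size_mean q D \<le> 2 * real (card D) * \<tau>"
    using sum_bounded_above[OF bound(2)] by (simp add: size_mean_def mult_ac)
  thus "size_mean (exp (- (1 / \<tau>))) D \<le> 2 * real (card D) * \<tau>" by (simp add: q_def)
  have mD0: "0 \<le> size_mean q D" unfolding size_mean_def using bound(1) by (intro sum_nonneg)
  have split: "size_mean q (odds_upto M) = size_mean q (odds_upto M - D) + size_mean q D"
    unfolding size_mean_def by (rule sum.subset_diff) (use D in \<open>auto simp: M_def\<close>)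
  have "\<bar>size_mean q (odds_upto M) - pi\<^sup>2 * \<tau>\<^sup>2 / 6\<bar> \<le>
      \<tau> powr (5/4) * (\<Sum>m. real (Suc m) powr (- 5/4)) + 4 * odd_tail q M"
    unfolding size_mean_def q_def by (rule mean_approx) (use \<tau> half in \<open>auto simp: M_def\<close>)
  moreover have "odd_tail q M \<le> cutoff_tail \<tau>"
    unfolding q_def M_def by (rule odd_tail_cutoff_le) (use \<tau> in auto)
  ultimately have "\<bar>pi\<^sup>2 * \<tau>\<^sup>2 / 6 - size_mean q (odds_upto M - D)\<bar>
    \<le> \<tau> powr (5/4) * (\<Sum>m. real (Suc m) powr (- 5/4)) + 4 * cutoff_tail \<tau> + 2 * real (card D) * \<tau>"
    using mD mD0 unfolding split by linarith
  thus "\<bar>pi\<^sup>2 * \<tau>\<^sup>2 / 6 - size_mean (exp (- (1 / \<tau>))) (odds_upto (peak_cutoff \<tau>) - D)\<bar>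
    \<le> \<tau> powr (5/4) * (\<Sum>m. real (Suc m) powr (- 5/4)) + 4 * cutoff_tail \<tau> + 2 * real (card D) * \<tau>"
    by (simp add: q_def M_def)
qed

text \<open>Common source of all three limits: each factor is the probability that a geometric
  variable with ratio \<open>q ^ m\<close> does not exceed its bound. The error depends on the
  constraints only through \<open>D\<close>, so the bounds \<open>a\<close> may vary with
  \<open>n\<close> in any way.\<close>

theorem OU_prob_small_parts:
  fixes D :: "nat \<Rightarrow> nat set" and a :: "nat \<Rightarrow> side \<Rightarrow> nat \<Rightarrow> nat"
  defines "\<tau> \<equiv> \<lambda>n::nat. sqrt 6 / pi * sqrt (real n)"
  defines "q \<equiv> \<lambda>n. exp (- (1 / \<tau> n))"
  assumes D: "\<forall>\<^sub>F n in sequentially. D n \<subseteq> odds_upto (peak_cutoff (\<tau> n))"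
    and card: "(\<lambda>n. real (card (D n)) / sqrt (\<tau> n)) \<longlonglongrightarrow> 0"
  shows "(\<lambda>n. OU_prob n (\<lambda>s. \<forall>m\<in>D n. \<forall>j. num_parts j m s \<le> a n j m) -
     (\<Prod>m\<in>D n. (1 - q n ^ (m * (a n LeftSide m + 1))) * (1 - q n ^ (m * (a n RightSide m + 1))))) \<longlonglongrightarrow> 0"
proof -
  define M where "M = (\<lambda>n. peak_cutoff (\<tau> n))"
  define J where "J = (\<lambda>n. odds_upto (M n) - D n)"
  define p where "p = (\<lambda>n. \<Prod>m\<in>D n. (1 - q n ^ (m * (a n LeftSide m + 1))) * (1 - q n ^ (m * (a n RightSide m + 1))))"
  have \<tau>_lim: "filterlim \<tau> at_top sequentially" unfolding \<tau>_def by real_asymp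
  have ev: "\<forall>\<^sub>F n in sequentially. P (\<tau> n)" if "eventually P at_top" for P
    using eventually_compose_filterlim[OF that \<tau>_lim] .
  have \<tau>_ge: "\<forall>\<^sub>F n in sequentially. \<tau> n \<ge> c" for c by (rule ev) (rule eventually_ge_at_top)
  have M_ge: "\<forall>\<^sub>F n in sequentially. \<tau> n \<le> M n \<and> M n \<le> 3/4 * \<tau> n * ln (\<tau> n) + 1"
  proof -
    have "\<forall>\<^sub>F x::real in at_top. x \<le> 3/4 * x * ln x" by real_asymp
    from ev[OF this] \<tau>_ge[of 1] show ?thesis
    proof eventually_elim
      case (elim n)
      thus ?case using peak_cutoff_bounds(1,2)[of "\<tau> n"] unfolding M_def by linarith
    qed
  qed
  have card_small: "\<forall>\<^sub>F n in sequentially. finite (D n) \<and> 16 * real (card (D n)) \<le> \<tau> n - 2"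
  proof -
    have "\<forall>\<^sub>F x::real in at_top. 16 * sqrt x \<le> x - 2" by real_asymp
    note e = ev[OF this]
    have "\<forall>\<^sub>F n in sequentially. real (card (D n)) / sqrt (\<tau> n) < 1"
      using card by (rule order_tendstoD) simp
    with e show ?thesis using D \<tau>_ge[of 1]
    proof eventually_elim
      case (elim n)
      have "real (card (D n)) < sqrt (\<tau> n)" using elim by (simp add: divide_less_eq)
      thus ?case using elim finite_subset[OF elim(3)] by auto
    qed
  qed
  obtain \<delta> where \<delta>: "\<delta> \<longlonglongrightarrow> 0" and llt: "\<forall>\<^sub>F n in sequentially. \<forall>i.
    \<bar>sqrt (2 * pi * size_var (q n) (J n)) * size_prob (q n) (J n) i - 1\<bar>
      \<le> \<bar>real i - size_mean (q n) (J n)\<bar> / sqrt (size_var (q n) (J n)) + \<delta> n"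
    using size_local_limit[OF \<tau>_lim M_ge card_small] unfolding q_def J_def by blast
  define S where "S = (\<Sum>m. real (Suc m) powr (- 5/4))"
  \<comment> \<open>The last summand is a combination of
    \<open>card D * \<tau> / \<tau> powr (3/2)\<close> and
    \<open>card D * \<tau> / \<tau>\<^sup>2\<close>; pulling out \<open>card D / sqrt \<tau>\<close>
    leaves a convergent bracket.\<close>
  define \<epsilon> where "\<epsilon> = (\<lambda>n. count_error (\<tau> n) + \<tau> n powr (5/4) * S / sqrt (\<tau> n ^ 3 / 12) + \<bar>\<delta> n\<bar> +
     real (card (D n)) / sqrt (\<tau> n) * (4 * \<tau> n * sqrt (\<tau> n) / sqrt (\<tau> n ^ 3 / 12) +
        2 * \<tau> n * sqrt (\<tau> n) / (pi\<^sup>2 * (\<tau> n)\<^sup>2 / 6)))"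
  have \<epsilon>_lim: "\<epsilon> \<longlonglongrightarrow> 0"
  proof -
    have "(\<lambda>n. count_error (\<tau> n)) \<longlonglongrightarrow> 0"
      by (rule filterlim_compose[OF count_error_tendsto \<tau>_lim])
    moreover have "(\<lambda>n. \<tau> n powr (5/4) * S / sqrt (\<tau> n ^ 3 / 12)) \<longlonglongrightarrow> 0"
    proof -
      have "((\<lambda>x::real. x powr (5/4) / sqrt (x ^ 3 / 12)) \<longlongrightarrow> 0) at_top" by real_asymp
      from tendsto_mult_left[OF filterlim_compose[OF this \<tau>_lim], of S] show ?thesis
        by (simp add: mult_ac)
    qed
    moreover have "(\<lambda>n. \<bar>\<delta> n\<bar>) \<longlonglongrightarrow> 0" using \<delta> by (rule tendsto_rabs_zero)
    moreover have "(\<lambda>n. real (card (D n)) / sqrt (\<tau> n) * (4 * \<tau> n * sqrt (\<tau> n) / sqrt (\<tau> n ^ 3 / 12) +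
        2 * \<tau> n * sqrt (\<tau> n) / (pi\<^sup>2 * (\<tau> n)\<^sup>2 / 6))) \<longlonglongrightarrow> 0"
    proof -
      have "((\<lambda>x::real. 4 * x * sqrt x / sqrt (x ^ 3 / 12) + 2 * x * sqrt x / (pi\<^sup>2 * x\<^sup>2 / 6)) \<longlongrightarrow> 4 * inverse ((1/12) powr (1/2))) at_top"
        by real_asymp
      from tendsto_mult[OF card filterlim_compose[OF this \<tau>_lim]] show ?thesis by simp
    qed
    ultimately have "\<epsilon> \<longlonglongrightarrow> 0 + 0 + 0 + 0" unfolding \<epsilon>_def by (intro tendsto_add)
    thus ?thesis by simp
  qed
  have "\<forall>\<^sub>F n in sequentially.
      norm (OU_prob n (\<lambda>s. \<forall>m\<in>D n. \<forall>j. num_parts j m s \<le> a n j m) - p n) \<le> 4 * \<epsilon> n"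
  proof -
    have "\<forall>\<^sub>F x::real in at_top. x powr (- 3/4) \<le> 1/2" by real_asymp
    note e1 = ev[OF this]
    have "\<forall>\<^sub>F x::real in at_top. 3/4 * x * ln x + x + 3 \<le> pi\<^sup>2 * x\<^sup>2 / 6" by real_asymp
    note e2 = ev[OF this]
    have "\<forall>\<^sub>F x::real in at_top. exp (- 4) * x powr (- 3/4) * exp ((x - 1) * (exp (- 4) * x powr (- 3/4))) \<ge> 1"
      by real_asymp
    note e3 = ev[OF this]
    have e4: "\<forall>\<^sub>F n in sequentially. \<epsilon> n < 1/2"
      using \<epsilon>_lim by (rule order_tendstoD) simp
    show ?thesis
      using D llt M_ge card_small e1 e2 e3 e4 \<tau>_ge[of 4] eventually_ge_at_top[of 1]
    proof eventually_elim
      case (elim n)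
      define x where "x = \<tau> n"
      define V where "V = size_var (q n) (J n)"
      define Z where "Z = peak_total x n"
      have x: "x \<ge> 4" using elim by (simp add: x_def)
      have qx: "q n = exp (- (1 / x))" by (simp add: q_def x_def)
      have q: "0 < q n" "q n < 1" using x by (auto simp: qx)
      have Mx: "M n = peak_cutoff x" by (simp add: M_def x_def)
      have DM: "D n \<subseteq> odds_upto (M n)" using elim(1) by (simp add: M_def)
      have finD: "finite (D n)" using elim(4) by simp
      \<comment> \<open>Here the value \<open>sqrt 6 / pi\<close> enters: the leading term of the
        mean is exactly the size.\<close>
      have nx: "real n = pi\<^sup>2 * x\<^sup>2 / 6"
        by (simp add: x_def \<tau>_def power_mult_distrib power_divide)
      have qM: "q n ^ M n \<le> x powr (- 3/4)"
        unfolding qx Mx by (rule peak_cutoff_bounds) (use x in auto)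
      have half: "q n ^ M n \<le> 1/2" using qM elim(5) by (simp add: x_def)
      have V: "V \<ge> x ^ 3 / 12" "V \<le> 48 * x ^ 3"
      proof -
        show "V \<ge> x ^ 3 / 12" unfolding V_def size_var_def qx J_def
          by (rule variance_ge) (use elim x in \<open>auto simp: x_def\<close>)
        show "V \<le> 48 * x ^ 3" unfolding V_def size_var_def qx
          by (rule variance_le) (use x in \<open>auto simp: J_def\<close>)
      qed
      have x3: "x ^ 3 / 12 > 0" using x by simp
      have Vpos: "V > 0" using V(1) x3 by linarith
      define \<beta> where "\<beta> = 1 / sqrt V"
      have \<beta>: "0 \<le> \<beta>" "\<beta> \<le> 1 / sqrt (x ^ 3 / 12)"
        using V(1) x3 Vpos by (auto simp: \<beta>_def intro!: divide_left_mono)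
      have Zlow: "Z \<ge> exp (- 4) * x powr (- 3/4) * exp ((x - 1) * (exp (- 4) * x powr (- 3/4)))"
        unfolding Z_def by (rule peak_total_ge) (use elim x nx in \<open>auto simp: x_def\<close>)
      have Z1: "Z \<ge> 1" using Zlow elim(7) unfolding x_def by linarith
      define R1 where "R1 = x powr (4/3) + (pi\<^sup>2 * x\<^sup>2 / 6)\<^sup>2 * exp (4 * (x powr (- 3/4) * (1 + x)) - x powr (1/3))"
      define R2 where "R2 = 2 * real (card (D n)) * x"
      define R3 where "R3 = 4 * cutoff_tail x"
      have tail: "odd_tail (q n) (M n) \<le> cutoff_tail x"
        unfolding qx Mx by (rule odd_tail_cutoff_le) (use x in auto)
      have tail0: "0 \<le> odd_tail (q n) (M n)" by (rule odd_tail_nonneg[OF q])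
      have mean: "\<bar>real n - size_mean (q n) (J n)\<bar> \<le> x powr (5/4) * S + R3 + R2"
        unfolding nx S_def qx J_def Mx R2_def R3_def
        by (rule size_mean_cutoff_approx) (use x DM half in \<open>auto simp: qx Mx\<close>)
      define E where "E = \<beta> * \<bar>real n - size_mean (q n) (J n)\<bar> + \<bar>\<delta> n\<bar> + (\<beta> + 1 / n) * (R1 + R2 + R3)
          + sqrt (2 * pi * V) * M n / Z"
      \<comment> \<open>Kept general in \<open>C\<close> because it is applied twice, to the given
        bounds and to \<open>UNIV\<close>; the quotient of the two normalised counts is the
        probability.\<close>
      have key: "\<bar>sqrt (2 * pi * V) * q n ^ n * real (card {s \<in> odd_unimodal n. \<forall>j m. num_parts j m s \<in> C j m}) /
            (eval_fps (\<Prod>j\<in>J n. geom_fps j * geom_fps j) (q n) * (\<Prod>j\<in>D n. 1 / (1 - q n ^ j)\<^sup>2) * Z)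
          - (\<Prod>m\<in>D n. eval_fps (part_fps (C LeftSide m) m) (q n) * eval_fps (part_fps (C RightSide m) m) (q n) * (1 - q n ^ m)\<^sup>2)\<bar>
          \<le> E"
        if C: "\<And>j m. 0 \<in> C j m" "\<And>j m. m \<notin> D n \<Longrightarrow> C j m = UNIV" for C :: "side \<Rightarrow> nat \<Rightarrow> nat set"
      proof -
        have Zeq: "Z = (\<Sum>c\<in>high_peaks (M n) n. peak_weight (q n) (M n) c)"
          by (simp add: Z_def peak_total_def qx Mx)
        show ?thesis
          unfolding E_def Zeq J_def
        proof (rule restricted_count_approx[OF q DM C])
          fix i
          have "\<bar>sqrt (2 * pi * V) * size_prob (q n) (J n) i - 1\<bar> \<le> \<bar>real i - size_mean (q n) (J n)\<bar> / sqrt V + \<delta> n"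
            unfolding V_def using elim(2) by blast
          also have "\<dots> \<le> \<beta> * \<bar>real i - size_mean (q n) (J n)\<bar> + \<bar>\<delta> n\<bar>"
            by (simp add: \<beta>_def)
          finally show "\<bar>sqrt (2 * pi * V) * (fps_nth (\<Prod>j\<in>odds_upto (M n) - D n. geom_fps j * geom_fps j) i * q n ^ i /
              eval_fps (\<Prod>j\<in>odds_upto (M n) - D n. geom_fps j * geom_fps j) (q n)) - 1\<bar>
              \<le> \<beta> * \<bar>real i - size_mean (q n) (odds_upto (M n) - D n)\<bar> + \<bar>\<delta> n\<bar>"
            by (simp only: size_prob_def J_def)
        next
          show "(\<Sum>c\<in>high_peaks (M n) n. real c * peak_weight (q n) (M n) c) \<le>
              R1 * (\<Sum>c\<in>high_peaks (M n) n. peak_weight (q n) (M n) c)"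
            using peak_mean_le[of x n] x Z1 unfolding Zeq[symmetric]
            by (simp add: Z_def R1_def nx qx Mx)
        next
          show "(\<Sum>j\<in>D n. 2 * real j * q n ^ j / (1 - q n ^ j)) \<le> R2"
            using size_mean_cutoff_approx(2)[of x "D n"] x DM half
            by (simp add: size_mean_def R2_def qx Mx)
        next
          fix c
          have "(\<Sum>j\<in>odds_upto c - odds_upto (M n). 2 * real j * q n ^ j / (1 - q n ^ j)) \<le> 4 * odd_tail (q n) (M n)"
            by (rule mean_above_le[OF q _ _ half]) (auto simp: odds_upto_def)
          thus "(\<Sum>j\<in>odds_upto c - odds_upto (M n). 2 * real j * q n ^ j / (1 - q n ^ j)) \<le> R3"
            using tail by (simp add: R3_def)
        qed (use \<beta> Vpos elim Z1 Zeq in auto)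
      qed
      have E_le: "E \<le> \<epsilon> n"
      proof -
        have tail_nonneg: "0 \<le> cutoff_tail x" using tail tail0 by linarith
        have R: "0 \<le> R1" "0 \<le> R2" "0 \<le> R3"
          using x tail_nonneg by (auto simp: R1_def R2_def R3_def intro!: add_nonneg_nonneg)
        have "\<beta> * \<bar>real n - size_mean (q n) (J n)\<bar> \<le> 1 / sqrt (x ^ 3 / 12) * (x powr (5/4) * S + R3 + R2)"
          using \<beta> mean x3 by (intro mult_mono) auto
        moreover have "(\<beta> + 1 / n) * (R1 + R2 + R3) \<le> (1 / sqrt (x ^ 3 / 12) + 1 / (pi\<^sup>2 * x\<^sup>2 / 6)) * (R1 + R2 + R3)"
          using \<beta> R unfolding nx by (intro mult_right_mono) auto
        moreover have "sqrt (2 * pi * V) * M n / Z \<le> sqrt (2 * pi * (48 * x ^ 3)) * (3/4 * x * ln x + 1) /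
            (exp (- 4) * x powr (- 3/4) * exp ((x - 1) * (exp (- 4) * x powr (- 3/4))))"
        proof (intro frac_le mult_mono)
          show "real (M n) \<le> 3/4 * x * ln x + 1" using elim(3) by (simp add: x_def)
          show "sqrt (2 * pi * V) \<le> sqrt (2 * pi * (48 * x ^ 3))" using V(2) by simp
          show "0 < exp (- 4) * x powr (- 3/4) * exp ((x - 1) * (exp (- 4) * x powr (- 3/4)))" using x by simp
        qed (use x Zlow in auto)
        moreover have "1 / sqrt (x ^ 3 / 12) * (x powr (5/4) * S + R3 + R2) +
            (1 / sqrt (x ^ 3 / 12) + 1 / (pi\<^sup>2 * x\<^sup>2 / 6)) * (R1 + R2 + R3) =
            4 * cutoff_tail x / sqrt (x ^ 3 / 12) + x powr (5/4) * S / sqrt (x ^ 3 / 12) +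
            (1 / sqrt (x ^ 3 / 12) + 1 / (pi\<^sup>2 * x\<^sup>2 / 6)) * (R1 + 4 * cutoff_tail x) +
            real (card (D n)) / sqrt x * (4 * x * sqrt x / sqrt (x ^ 3 / 12) + 2 * x * sqrt x / (pi\<^sup>2 * x\<^sup>2 / 6))"
        proof -
          define u w where "u = 1 / sqrt (x ^ 3 / 12)" and "w = 1 / (pi\<^sup>2 * x\<^sup>2 / 6)"
          have "real (card (D n)) / sqrt x * (4 * x * sqrt x * u + 2 * x * sqrt x * w) = 2 * R2 * u + R2 * w"
            using x by (simp add: R2_def field_simps)
          hence "u * (x powr (5/4) * S + R3 + R2) + (u + w) * (R1 + R2 + R3) =
              4 * cutoff_tail x * u + x powr (5/4) * S * u + (u + w) * (R1 + 4 * cutoff_tail x) +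
              real (card (D n)) / sqrt x * (4 * x * sqrt x * u + 2 * x * sqrt x * w)"
            by (simp add: R3_def algebra_simps)
          thus ?thesis by (simp only: u_def w_def times_divide_eq_right mult_1_right)
        qed
        ultimately show ?thesis
          unfolding E_def \<epsilon>_def count_error_def R1_def x_def[symmetric] by linarith
      qed
      define SQZ where "SQZ = eval_fps (\<Prod>j\<in>J n. geom_fps j * geom_fps j) (q n) * (\<Prod>j\<in>D n. 1 / (1 - q n ^ j)\<^sup>2) * Z"
      define C where "C = (\<lambda>j m. if m \<in> D n then {..a n j m} else UNIV)"
      define y where "y = (\<lambda>A :: peaked_seq set. sqrt (2 * pi * V) * q n ^ n * real (card A) / SQZ)"
      have pos: "m > 0" "1 - q n ^ m > 0" if "m \<in> D n" for m
      proof -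
        show "m > 0" using that DM by (auto simp: odds_upto_def odd_pos)
        thus "1 - q n ^ m > 0" using q by (simp add: power_less_one_iff)
      qed
      have "(\<Prod>m\<in>D n. eval_fps (part_fps (C LeftSide m) m) (q n) * eval_fps (part_fps (C RightSide m) m) (q n) * (1 - q n ^ m)\<^sup>2) = p n"
        unfolding p_def
      proof (intro prod.cong refl)
        fix m assume m: "m \<in> D n"
        have "(1 - q n ^ m)\<^sup>2 = (1 - q n ^ m) * (1 - q n ^ m)" by (simp add: power2_eq_square)
        thus "eval_fps (part_fps (C LeftSide m) m) (q n) * eval_fps (part_fps (C RightSide m) m) (q n) * (1 - q n ^ m)\<^sup>2 =
            (1 - q n ^ (m * (a n LeftSide m + 1))) * (1 - q n ^ (m * (a n RightSide m + 1)))"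
          using m pos[OF m] q by (simp add: C_def eval_part_fps_atMost)
      qed
      hence 1: "\<bar>y {s \<in> odd_unimodal n. \<forall>j m. num_parts j m s \<in> C j m} - p n\<bar> \<le> E"
        using key[of C] unfolding y_def SQZ_def by (auto simp: C_def)
      have "(\<Prod>m\<in>D n. eval_fps (geom_fps m) (q n) * eval_fps (geom_fps m) (q n) * (1 - q n ^ m)\<^sup>2) = 1"
      proof (intro prod.neutral ballI)
        fix m assume m: "m \<in> D n"
        have "(1 - q n ^ m)\<^sup>2 = (1 - q n ^ m) * (1 - q n ^ m)" by (simp add: power2_eq_square)
        thus "eval_fps (geom_fps m) (q n) * eval_fps (geom_fps m) (q n) * (1 - q n ^ m)\<^sup>2 = 1"
          using pos[OF m] q by (simp add: eval_geom_fps)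
      qed
      hence 2: "\<bar>y (odd_unimodal n) - 1\<bar> \<le> E"
        using key[of "\<lambda>_ _. UNIV"] unfolding y_def SQZ_def by simp
      have p01: "0 \<le> p n" "p n \<le> 1"
        unfolding p_def using q
        by (auto intro!: prod_nonneg prod_le_1 mult_le_one mult_nonneg_nonneg simp: power_le_one)
      have "OU_prob n (\<lambda>s. \<forall>m\<in>D n. \<forall>j. num_parts j m s \<le> a n j m) =
          y {s \<in> odd_unimodal n. \<forall>j m. num_parts j m s \<in> C j m} / y (odd_unimodal n)"
      proof -
        have "{s \<in> odd_unimodal n. \<forall>m\<in>D n. \<forall>j. num_parts j m s \<le> a n j m} =
            {s \<in> odd_unimodal n. \<forall>j m. num_parts j m s \<in> C j m}"
          by (auto simp: C_def)
        moreover have "y (odd_unimodal n) \<noteq> 0" using 2 E_le elim(8) by auto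
        hence "sqrt (2 * pi * V) * q n ^ n / SQZ \<noteq> 0" by (auto simp: y_def)
        hence "y A / y B = real (card A) / real (card B)" for A B
          by (auto simp: y_def)
        ultimately show ?thesis
          using OU_prob_eq_quotient[OF elim(10)] by simp
      qed
      moreover have "\<bar>y {s \<in> odd_unimodal n. \<forall>j m. num_parts j m s \<in> C j m} / y (odd_unimodal n) - p n\<bar> \<le> 4 * E"
        by (rule quotient_approx[OF 1 2 p01]) (use E_le elim(8) in auto)
      ultimately show ?case using E_le by simp
    qed
  qed
  moreover have "(\<lambda>n. 4 * \<epsilon> n) \<longlonglongrightarrow> 0"
    using tendsto_mult_left[OF \<epsilon>_lim, of 4] by simp
  ultimately have "(\<lambda>n. OU_prob n (\<lambda>s. \<forall>m\<in>D n. \<forall>j. num_parts j m s \<le> a n j m) - p n) \<longlonglongrightarrow> 0"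
    by (rule Lim_null_comparison)
  thus ?thesis by (simp only: p_def)
qed

section \<open>Convergence to independent exponential and geometric laws\<close>

lemma norm_exp_diff_le:
  fixes x y h :: real
  assumes "0 \<le> x" "x \<le> y" "y \<le> x + h"
  shows "\<bar>(1 - exp (- y)) - (1 - exp (- x))\<bar> \<le> h"
proof -
  have "exp (- y) = exp (- x) * exp (- (y - x))" by (simp flip: exp_add)
  hence "exp (- x) - exp (- y) = exp (- x) * (1 - exp (- (y - x)))" by (simp add: algebra_simps)
  also have "\<dots> \<le> 1 * (y - x)"
  proof (intro mult_mono)
    show "1 - exp (- (y - x)) \<le> y - x" using exp_ge_add_one_self[of "- (y - x)"] by linarith
  qed (use assms in auto)
  finally show ?thesis using assms by simp
qed

text \<open>Rounding \<open>v * \<tau> / m\<close> down to an integer moves the exponent by at most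
  \<open>m / \<tau>\<close>. As all factors are bounded by 1, the errors add over \<open>D\<close>
  and over the two sides; hence the hypothesis on the sum of the elements of
  \<open>D\<close>.\<close>

lemma OU_prob_exponential:
  fixes D :: "nat \<Rightarrow> nat set" and v :: "nat \<Rightarrow> side \<Rightarrow> nat \<Rightarrow> real"
  defines "\<tau> \<equiv> \<lambda>n::nat. sqrt 6 / pi * sqrt (real n)"
  assumes D: "\<forall>\<^sub>F n in sequentially. D n \<subseteq> odds_upto (peak_cutoff (\<tau> n))"
    and card: "(\<lambda>n. real (card (D n)) / sqrt (\<tau> n)) \<longlonglongrightarrow> 0"
    and total: "(\<lambda>n. (\<Sum>m\<in>D n. real m) / \<tau> n) \<longlonglongrightarrow> 0"
    and v: "\<And>n m j. m \<in> D n \<Longrightarrow> 0 \<le> v n j m"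
  shows "(\<lambda>n. OU_prob n (\<lambda>s. \<forall>m\<in>D n. \<forall>j. real m * real (num_parts j m s) / \<tau> n \<le> v n j m) -
     (\<Prod>m\<in>D n. (1 - exp (- v n LeftSide m)) * (1 - exp (- v n RightSide m)))) \<longlonglongrightarrow> 0"
proof -
  define q where "q = (\<lambda>n. exp (- (1 / \<tau> n)))"
  define a where "a = (\<lambda>n j m. nat \<lfloor>v n j m * \<tau> n / real m\<rfloor>)"
  define f where "f = (\<lambda>n m. (1 - q n ^ (m * (a n LeftSide m + 1))) * (1 - q n ^ (m * (a n RightSide m + 1))))"
  define g where "g = (\<lambda>n m. (1 - exp (- v n LeftSide m)) * (1 - exp (- v n RightSide m)))"
  have "(\<lambda>n. OU_prob n (\<lambda>s. \<forall>m\<in>D n. \<forall>j. num_parts j m s \<le> a n j m) - (\<Prod>m\<in>D n. f n m)) \<longlonglongrightarrow> 0"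
    using OU_prob_small_parts[OF D[unfolded \<tau>_def] card[unfolded \<tau>_def], of a]
    by (simp only: f_def q_def \<tau>_def)
  moreover have "(\<lambda>n. (\<Prod>m\<in>D n. f n m) - (\<Prod>m\<in>D n. g n m)) \<longlonglongrightarrow> 0"
  proof (rule Lim_null_comparison)
    show "\<forall>\<^sub>F n in sequentially. norm ((\<Prod>m\<in>D n. f n m) - (\<Prod>m\<in>D n. g n m)) \<le> 2 * ((\<Sum>m\<in>D n. real m) / \<tau> n)"
      using D eventually_gt_at_top[of 0]
    proof eventually_elim
      case (elim n)
      have \<tau>: "\<tau> n > 0" using elim(2) by (simp add: \<tau>_def)
      have diff: "\<bar>(1 - q n ^ (m * (a n j m + 1))) - (1 - exp (- v n j m))\<bar> \<le> real m / \<tau> n" if m: "m \<in> D n" for m j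
      proof -
        have m0: "m > 0" using m elim(1) by (auto simp: odds_upto_def odd_pos)
        have "0 \<le> v n j m * \<tau> n / real m" using v[OF m] \<tau> by simp
        hence "v n j m * \<tau> n / real m \<le> real (a n j m + 1)" "real (a n j m) \<le> v n j m * \<tau> n / real m"
          unfolding a_def by linarith+
        hence "v n j m \<le> real (m * (a n j m + 1)) / \<tau> n" "real (m * (a n j m + 1)) / \<tau> n \<le> v n j m + real m / \<tau> n"
          using m0 \<tau> by (simp_all add: field_simps)
        from norm_exp_diff_le[OF v[OF m] this]
        show ?thesis by (simp add: q_def flip: exp_of_nat_mult)
      qed
      have bnd: "\<bar>1 - q n ^ i\<bar> \<le> 1" for i
        using \<tau> by (auto simp: q_def abs_le_iff power_le_one intro: order_trans[OF _ zero_le_power])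
      have bnd': "\<bar>1 - exp (- v n j m)\<bar> \<le> 1" if "m \<in> D n" for m j
        using v[OF that, of j] by (simp add: abs_le_iff)
      have "norm ((\<Prod>m\<in>D n. f n m) - (\<Prod>m\<in>D n. g n m)) \<le> (\<Sum>m\<in>D n. norm (f n m - g n m))"
        by (rule norm_prod_diff) (auto simp: f_def g_def abs_mult intro!: mult_le_one bnd bnd')
      also have "\<dots> \<le> (\<Sum>m\<in>D n. 2 * (real m / \<tau> n))"
      proof (rule sum_mono)
        fix m assume m: "m \<in> D n"
        define f1 f2 g1 g2 where "f1 = 1 - q n ^ (m * (a n LeftSide m + 1))" and "f2 = 1 - q n ^ (m * (a n RightSide m + 1))"
          and "g1 = 1 - exp (- v n LeftSide m)" and "g2 = 1 - exp (- v n RightSide m)"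
        have "f1 * f2 - g1 * g2 = (f1 - g1) * f2 + g1 * (f2 - g2)" by (simp add: algebra_simps)
        hence "\<bar>f1 * f2 - g1 * g2\<bar> \<le> \<bar>f1 - g1\<bar> * \<bar>f2\<bar> + \<bar>g1\<bar> * \<bar>f2 - g2\<bar>"
          by (metis abs_mult abs_triangle_ineq)
        also have "\<dots> \<le> real m / \<tau> n * 1 + 1 * (real m / \<tau> n)"
          using diff[OF m] bnd bnd'[OF m] \<tau> unfolding f1_def f2_def g1_def g2_def
          by (intro add_mono mult_mono) auto
        finally show "norm (f n m - g n m) \<le> 2 * (real m / \<tau> n)"
          by (simp add: f_def g_def f1_def f2_def g1_def g2_def)
      qed
      also have "\<dots> = 2 * ((\<Sum>m\<in>D n. real m) / \<tau> n)"
        by (simp add: sum_distrib_left sum_divide_distrib)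
      finally show ?case .
    qed
    show "(\<lambda>n. 2 * ((\<Sum>m\<in>D n. real m) / \<tau> n)) \<longlonglongrightarrow> 0"
      using tendsto_mult_left[OF total, of 2] by simp
  qed
  ultimately have "(\<lambda>n. (OU_prob n (\<lambda>s. \<forall>m\<in>D n. \<forall>j. num_parts j m s \<le> a n j m) - (\<Prod>m\<in>D n. f n m)) +
      ((\<Prod>m\<in>D n. f n m) - (\<Prod>m\<in>D n. g n m))) \<longlonglongrightarrow> 0 + 0"
    by (rule tendsto_add)
  moreover have "\<forall>\<^sub>F n in sequentially. (OU_prob n (\<lambda>s. \<forall>m\<in>D n. \<forall>j. num_parts j m s \<le> a n j m) - (\<Prod>m\<in>D n. f n m)) +
      ((\<Prod>m\<in>D n. f n m) - (\<Prod>m\<in>D n. g n m)) =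
      OU_prob n (\<lambda>s. \<forall>m\<in>D n. \<forall>j. real m * real (num_parts j m s) / \<tau> n \<le> v n j m) - (\<Prod>m\<in>D n. g n m)"
    using D eventually_gt_at_top[of 0]
  proof eventually_elim
    case (elim n)
    have \<tau>: "\<tau> n > 0" using elim(2) by (simp add: \<tau>_def)
    have "num_parts j m s \<le> a n j m \<longleftrightarrow> real m * real (num_parts j m s) / \<tau> n \<le> v n j m" if m: "m \<in> D n" for m j s
    proof -
      have m0: "m > 0" using m elim(1) by (auto simp: odds_upto_def odd_pos)
      have "0 \<le> v n j m * \<tau> n / real m" using v[OF m] \<tau> by simp
      hence "num_parts j m s \<le> a n j m \<longleftrightarrow> real (num_parts j m s) \<le> v n j m * \<tau> n / real m"
        unfolding a_def by (simp add: le_nat_iff le_floor_iff)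
      also have "\<dots> \<longleftrightarrow> real m * real (num_parts j m s) / \<tau> n \<le> v n j m"
        using m0 \<tau> by (simp add: field_simps)
      finally show ?thesis .
    qed
    hence "(\<lambda>s. \<forall>m\<in>D n. \<forall>j. num_parts j m s \<le> a n j m) =
        (\<lambda>s. \<forall>m\<in>D n. \<forall>j. real m * real (num_parts j m s) / \<tau> n \<le> v n j m)"
      by (intro ext) auto
    thus ?case by simp
  qed
  ultimately have "(\<lambda>n. OU_prob n (\<lambda>s. \<forall>m\<in>D n. \<forall>j. real m * real (num_parts j m s) / \<tau> n \<le> v n j m) -
      (\<Prod>m\<in>D n. g n m)) \<longlonglongrightarrow> 0 + 0"
    by (rule Lim_transform_eventually)
  thus ?thesis by (simp only: g_def add_0)
qed

lemma all_side: "(\<forall>j. P j) \<longleftrightarrow> P LeftSide \<and> P RightSide"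
  by (metis side.exhaust)

lemma integral_exp_minus:
  fixes v :: real
  assumes "0 \<le> v"
  shows "integral {0..v} (\<lambda>u. exp (- u)) = 1 - exp (- v)"
proof -
  have "((\<lambda>u. exp (- u)) has_integral (- exp (- v) - (- exp (- 0)))) {0..v}"
    by (rule fundamental_theorem_of_calculus[OF assms])
      (auto intro!: derivative_eq_intros simp: has_real_derivative_iff_has_vector_derivative[symmetric])
  thus ?thesis by (simp add: integral_unique)
qed

theorem theorem1p7:
  fixes B :: real
  assumes B: "B = sqrt 6 / pi"
  shows
    "(\<forall>(k :: nat \<Rightarrow> nat) (v :: nat \<Rightarrow> side \<Rightarrow> nat \<Rightarrow> real).
        (\<forall>n. k n \<ge> 1) \<longrightarrow>
        (\<lambda>n. real (k n)) \<in> o(\<lambda>n. real n powr (1/4)) \<longrightarrow>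
        (\<forall>n. \<forall>i\<in>{1..k n}. \<forall>j. 0 \<le> v n j (2*i - 1)) \<longrightarrow>
        (\<lambda>n. OU_prob n (\<lambda>s. \<forall>i\<in>{1..k n}. \<forall>j.
                 real (2*i - 1) * real (num_parts j (2*i - 1) s) / (B * sqrt (real n))
                   \<le> v n j (2*i - 1))
             - (\<Prod>i=1..k n. \<Prod>j\<in>{LeftSide, RightSide}.
                 integral {0..v n j (2*i - 1)} (\<lambda>u. exp (-u)))) \<longlonglongrightarrow> 0)
     \<and>
     (\<forall>(k :: nat \<Rightarrow> nat) (vL :: real) (vR :: real).
        (\<forall>n. k n \<ge> 1) \<longrightarrow>
        (\<lambda>n. real (k n)) \<in> o(\<lambda>n. real n powr (1/2)) \<longrightarrow>
        0 \<le> vL \<longrightarrow> 0 \<le> vR \<longrightarrow>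
        (\<lambda>n. OU_prob n (\<lambda>s.
                 real (2 * k n - 1) * real (num_parts LeftSide (2 * k n - 1) s)
                   / (B * sqrt (real n)) \<le> vL \<and>
                 real (2 * k n - 1) * real (num_parts RightSide (2 * k n - 1) s)
                   / (B * sqrt (real n)) \<le> vR))
          \<longlonglongrightarrow> (1 - exp (- vL)) * (1 - exp (- vR)))
     \<and>
     (\<forall>(c :: real) (vL :: nat) (vR :: nat).
        c > 0 \<longrightarrow>
        ((\<lambda>n. OU_prob n (\<lambda>s.
                 num_parts LeftSide (nat \<lfloor>c * sqrt (real n)\<rfloor>) s \<le> vL \<and>
                 num_parts RightSide (nat \<lfloor>c * sqrt (real n)\<rfloor>) s \<le> vR))
          \<longlongrightarrow> (1 - exp (- (c / B) * (real vL + 1))) * (1 - exp (- (c / B) * (real vR + 1))))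
        (inf sequentially (principal {n. odd \<lfloor>c * sqrt (real n)\<rfloor>})))"
proof -
  define \<tau> where "\<tau> = (\<lambda>n::nat. sqrt 6 / pi * sqrt (real n))"
  have \<tau>B: "B * sqrt (real n) = \<tau> n" for n by (simp add: B \<tau>_def)
  have Bpos: "B > 0" by (simp add: B)
  have \<tau>_lim: "filterlim \<tau> at_top sequentially" unfolding \<tau>_def by real_asymp
  \<comment> \<open>The logarithm in the cutoff eventually exceeds any constant, so all parts of
    order \<open>sqrt n\<close> may be placed in \<open>D\<close>.\<close>
  have cutoff: "\<forall>\<^sub>F n in sequentially. K * \<tau> n \<le> peak_cutoff (\<tau> n)" for K
  proof -
    have "\<forall>\<^sub>F x in at_top. K * x \<le> 3/4 * x * ln x"
    proof -
      have "\<forall>\<^sub>F x::real in at_top. K \<le> 3/4 * ln x"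
      proof -
        have "filterlim (\<lambda>x::real. 3/4 * ln x) at_top at_top" by real_asymp
        thus ?thesis by (rule filterlim_at_top[THEN iffD1, rule_format])
      qed
      with eventually_ge_at_top[of 0] show ?thesis
      proof eventually_elim
        case (elim x)
        hence "K * x \<le> 3/4 * ln x * x" by (intro mult_right_mono)
        thus ?case by (simp add: mult_ac)
      qed
    qed
    moreover have "\<forall>\<^sub>F x::real in at_top. x \<ge> 1" by (rule eventually_ge_at_top)
    ultimately have "\<forall>\<^sub>F x in at_top. K * x \<le> peak_cutoff x"
      by eventually_elim (use peak_cutoff_bounds(1) in \<open>blast intro: order_trans\<close>)
    thus ?thesis by (rule eventually_compose_filterlim[OF _ \<tau>_lim])
  qed
  have sqrt_\<tau>: "(\<lambda>n. 1 / sqrt (\<tau> n)) \<longlonglongrightarrow> 0" unfolding \<tau>_def by real_asymp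
  show ?thesis
  proof (intro conjI allI impI)
    fix k :: "nat \<Rightarrow> nat" and v :: "nat \<Rightarrow> side \<Rightarrow> nat \<Rightarrow> real"
    assume k1: "\<forall>n. k n \<ge> 1" and k: "(\<lambda>n. real (k n)) \<in> o(\<lambda>n. real n powr (1/4))"
      and v: "\<forall>n. \<forall>i\<in>{1..k n}. \<forall>j. 0 \<le> v n j (2*i - 1)"
    define D where "D = (\<lambda>n. (\<lambda>i. 2 * i - 1) ` {1..k n})"
    have inj: "inj_on (\<lambda>i. 2 * i - 1 :: nat) {1..k n}" for n by (auto intro!: inj_onI)
    have card_D: "card (D n) = k n" for n
      unfolding D_def card_image[OF inj] by simp
    have ball_D: "(\<forall>m\<in>D n. P m) \<longleftrightarrow> (\<forall>i\<in>{1..k n}. P (2 * i - 1))" for n P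
      by (auto simp: D_def)
    have k_lim: "(\<lambda>n. real (k n) / real n powr (1/4)) \<longlonglongrightarrow> 0"
      by (rule smalloD_tendsto[OF k])
    have card_lim: "(\<lambda>n. real (card (D n)) / sqrt (\<tau> n)) \<longlonglongrightarrow> 0"
    proof -
      have "\<forall>\<^sub>F n in sequentially. real n powr (1/4) / sqrt (\<tau> n) = 1 / sqrt (sqrt 6 / pi)"
        using eventually_gt_at_top[of 0]
      proof eventually_elim
        case (elim n)
        have "real n powr (1/4) = sqrt (sqrt (real n))"
          by (simp add: powr_powr flip: powr_half_sqrt)
        thus ?case using elim unfolding \<tau>_def real_sqrt_mult[of "sqrt 6 / pi"] by simp
      qed
      hence "(\<lambda>n. real n powr (1/4) / sqrt (\<tau> n)) \<longlonglongrightarrow> 1 / sqrt (sqrt 6 / pi)"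
        by (rule tendsto_eventually)
      from tendsto_mult[OF k_lim this]
      have "(\<lambda>n. real (k n) / real n powr (1/4) * (real n powr (1/4) / sqrt (\<tau> n))) \<longlonglongrightarrow> 0" by simp
      moreover have "\<forall>\<^sub>F n in sequentially. real (k n) / real n powr (1/4) * (real n powr (1/4) / sqrt (\<tau> n)) =
          real (card (D n)) / sqrt (\<tau> n)"
        using eventually_gt_at_top[of 0] by eventually_elim (simp add: card_D)
      ultimately show ?thesis by (rule Lim_transform_eventually)
    qed
    have D_sub: "\<forall>\<^sub>F n in sequentially. D n \<subseteq> odds_upto (peak_cutoff (\<tau> n))"
    proof -
      have "\<forall>\<^sub>F n in sequentially. real (card (D n)) / sqrt (\<tau> n) < 1"
        using card_lim by (rule order_tendstoD) simp
      moreover have "\<forall>\<^sub>F n in sequentially. \<tau> n \<ge> 1"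
        using \<tau>_lim by (rule filterlim_at_top[THEN iffD1, rule_format])
      ultimately show ?thesis using cutoff[of 2]
      proof eventually_elim
        case (elim n)
        have "real (k n) < sqrt (\<tau> n)"
          using elim by (simp add: divide_less_eq card_D)
        also have "\<dots> \<le> \<tau> n" using elim by (intro real_le_lsqrt) (auto simp: self_le_power power2_eq_square)
        finally have "2 * k n \<le> peak_cutoff (\<tau> n)" using elim by linarith
        thus ?case by (auto simp: D_def odds_upto_def)
      qed
    qed
    \<comment> \<open>The sum is at most \<open>2 * (k n)\<^sup>2\<close>, so
      \<open>k n = o(sqrt \<tau>)\<close>, already needed for the cardinality, also controls the
      rounding errors.\<close>
    have total: "(\<lambda>n. (\<Sum>m\<in>D n. real m) / \<tau> n) \<longlonglongrightarrow> 0"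
    proof (rule Lim_null_comparison)
      show "\<forall>\<^sub>F n in sequentially. norm ((\<Sum>m\<in>D n. real m) / \<tau> n) \<le> 2 * (real (card (D n)) / sqrt (\<tau> n))\<^sup>2"
        using eventually_gt_at_top[of 0]
      proof eventually_elim
        case (elim n)
        have \<tau>: "\<tau> n > 0" using elim by (simp add: \<tau>_def)
        have "(\<Sum>m\<in>D n. real m) \<le> real (card (D n)) * (2 * real (k n))"
          by (rule sum_bounded_above) (auto simp: D_def)
        also have "\<dots> = 2 * (real (card (D n)))\<^sup>2"
          by (simp add: card_D power2_eq_square)
        finally have "(\<Sum>m\<in>D n. real m) / \<tau> n \<le> 2 * (real (card (D n)))\<^sup>2 / \<tau> n"
          using \<tau> by (intro divide_right_mono) auto
        moreover have "0 \<le> (\<Sum>m\<in>D n. real m) / \<tau> n" using \<tau> by (intro divide_nonneg_pos sum_nonneg) auto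
        ultimately show ?case using \<tau> by (simp add: power_divide)
      qed
      show "(\<lambda>n. 2 * (real (card (D n)) / sqrt (\<tau> n))\<^sup>2) \<longlonglongrightarrow> 0"
        using tendsto_mult_left[OF tendsto_power[OF card_lim, of 2], of 2] by simp
    qed
    have "(\<lambda>n. OU_prob n (\<lambda>s. \<forall>m\<in>D n. \<forall>j. real m * real (num_parts j m s) / \<tau> n \<le> v n j m) -
       (\<Prod>m\<in>D n. (1 - exp (- v n LeftSide m)) * (1 - exp (- v n RightSide m)))) \<longlonglongrightarrow> 0"
      using D_sub card_lim total unfolding \<tau>_def
      by (rule OU_prob_exponential) (use v in \<open>auto simp: D_def\<close>)
    moreover have "(\<Prod>m\<in>D n. (1 - exp (- v n LeftSide m)) * (1 - exp (- v n RightSide m))) =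
        (\<Prod>i=1..k n. \<Prod>j\<in>{LeftSide, RightSide}. integral {0..v n j (2*i - 1)} (\<lambda>u. exp (-u)))" for n
      unfolding D_def prod.reindex[OF inj] using v
      by (intro prod.cong refl) (auto simp: integral_exp_minus)
    ultimately show "(\<lambda>n. OU_prob n (\<lambda>s. \<forall>i\<in>{1..k n}. \<forall>j.
                 real (2*i - 1) * real (num_parts j (2*i - 1) s) / (B * sqrt (real n))
                   \<le> v n j (2*i - 1))
             - (\<Prod>i=1..k n. \<Prod>j\<in>{LeftSide, RightSide}.
                 integral {0..v n j (2*i - 1)} (\<lambda>u. exp (-u)))) \<longlonglongrightarrow> 0"
      by (simp only: \<tau>B ball_D)
  next
    fix k :: "nat \<Rightarrow> nat" and vL vR :: real
    assume k1: "\<forall>n. k n \<ge> 1" and k: "(\<lambda>n. real (k n)) \<in> o(\<lambda>n. real n powr (1/2))"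
      and v: "0 \<le> vL" "0 \<le> vR"
    \<comment> \<open>For a single part the cardinality condition is trivial and only rounding
      matters: the part has to be \<open>o(\<tau>)\<close>, which is the weaker growth bound with
      exponent 1/2.\<close>
    define D where "D = (\<lambda>n. {2 * k n - 1})"
    define v' where "v' = (\<lambda>j. case j of LeftSide \<Rightarrow> vL | RightSide \<Rightarrow> vR)"
    have k_lim: "(\<lambda>n. real (k n) / real n powr (1/2)) \<longlonglongrightarrow> 0"
      by (rule smalloD_tendsto[OF k])
    have k\<tau>: "(\<lambda>n. real (k n) / \<tau> n) \<longlonglongrightarrow> 0"
      using tendsto_divide[OF k_lim tendsto_const[of "sqrt 6 / pi"]]
      by (simp add: \<tau>_def powr_half_sqrt mult.commute)
    have D_sub: "\<forall>\<^sub>F n in sequentially. D n \<subseteq> odds_upto (peak_cutoff (\<tau> n))"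
    proof -
      have "\<forall>\<^sub>F n in sequentially. real (k n) / \<tau> n < 1"
        using k\<tau> by (rule order_tendstoD) simp
      thus ?thesis using cutoff[of 2] eventually_gt_at_top[of 0]
      proof eventually_elim
        case (elim n)
        have "\<tau> n > 0" using elim by (simp add: \<tau>_def)
        hence "real (k n) < \<tau> n" using elim by simp
        hence "2 * k n \<le> peak_cutoff (\<tau> n)" using elim by linarith
        thus ?case using k1 by (auto simp: D_def odds_upto_def Suc_le_eq)
      qed
    qed
    have total: "(\<lambda>n. (\<Sum>m\<in>D n. real m) / \<tau> n) \<longlonglongrightarrow> 0"
    proof (rule Lim_null_comparison)
      show "\<forall>\<^sub>F n in sequentially. norm ((\<Sum>m\<in>D n. real m) / \<tau> n) \<le> 2 * (real (k n) / \<tau> n)"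
        by (intro always_eventually allI) (auto simp: D_def \<tau>_def intro!: divide_right_mono)
      show "(\<lambda>n. 2 * (real (k n) / \<tau> n)) \<longlonglongrightarrow> 0"
        using tendsto_mult_left[OF k\<tau>, of 2] by simp
    qed
    have "(\<lambda>n. OU_prob n (\<lambda>s. \<forall>m\<in>D n. \<forall>j. real m * real (num_parts j m s) / \<tau> n \<le> (\<lambda>n j m. v' j) n j m) -
       (\<Prod>m\<in>D n. (1 - exp (- (\<lambda>n j m. v' j) n LeftSide m)) * (1 - exp (- (\<lambda>n j m. v' j) n RightSide m)))) \<longlonglongrightarrow> 0"
      unfolding \<tau>_def
    proof (rule OU_prob_exponential)
      show "(\<lambda>n. real (card (D n)) / sqrt (sqrt 6 / pi * sqrt (real n))) \<longlonglongrightarrow> 0"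
        using sqrt_\<tau> by (simp add: D_def \<tau>_def)
      show "0 \<le> v' j" for j using v by (cases j) (auto simp: v'_def)
    qed (use D_sub total in \<open>simp_all only: \<tau>_def\<close>)
    hence "(\<lambda>n. OU_prob n (\<lambda>s. real (2 * k n - 1) * real (num_parts LeftSide (2 * k n - 1) s) / \<tau> n \<le> vL \<and>
                 real (2 * k n - 1) * real (num_parts RightSide (2 * k n - 1) s) / \<tau> n \<le> vR) -
        (1 - exp (- vL)) * (1 - exp (- vR))) \<longlonglongrightarrow> 0"
      by (simp add: D_def all_side v'_def)
    thus "(\<lambda>n. OU_prob n (\<lambda>s.
                 real (2 * k n - 1) * real (num_parts LeftSide (2 * k n - 1) s)
                   / (B * sqrt (real n)) \<le> vL \<and>
                 real (2 * k n - 1) * real (num_parts RightSide (2 * k n - 1) s)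
                   / (B * sqrt (real n)) \<le> vR))
          \<longlonglongrightarrow> (1 - exp (- vL)) * (1 - exp (- vR))"
      unfolding \<tau>B by (rule LIM_zero_cancel)
  next
    fix c :: real and vL vR :: nat
    assume c: "c > 0"
    define F where "F = inf sequentially (principal {n. odd \<lfloor>c * sqrt (real n)\<rfloor>})"
    define m where "m = (\<lambda>n::nat. nat \<lfloor>c * sqrt (real n)\<rfloor>)"
    \<comment> \<open>The empty set at even floors allows the general result to be used along all
      \<open>n\<close>; the restriction to odd floors is made afterwards by passing to the filter
      \<open>F\<close>. The geometric law survives here because \<open>m n / \<tau> n\<close> tends
      to \<open>c / B\<close> and not to 0.\<close>
    define D where "D = (\<lambda>n. if odd \<lfloor>c * sqrt (real n)\<rfloor> then {m n} else {})"
    define a where "a = (\<lambda>j. case j of LeftSide \<Rightarrow> vL | RightSide \<Rightarrow> vR)"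
    define q where "q = (\<lambda>n. exp (- (1 / \<tau> n)))"
    have le: "F \<le> sequentially" by (simp add: F_def)
    have floor_nonneg: "0 \<le> \<lfloor>c * sqrt (real n)\<rfloor>" for n using c by simp
    have odd_m: "odd (m n)" if "odd \<lfloor>c * sqrt (real n)\<rfloor>" for n
      using that floor_nonneg[of n] by (simp add: m_def even_nat_iff)
    have m_le: "real (m n) \<le> c * sqrt (real n)" "c * sqrt (real n) - 1 \<le> real (m n)" for n
      using floor_nonneg[of n] unfolding m_def by linarith+
    have "(\<lambda>n. OU_prob n (\<lambda>s. \<forall>m\<in>D n. \<forall>j. num_parts j m s \<le> (\<lambda>n j m. a j) n j m) -
       (\<Prod>m\<in>D n. (1 - exp (- (1 / \<tau> n)) ^ (m * ((\<lambda>n j m. a j) n LeftSide m + 1))) *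
          (1 - exp (- (1 / \<tau> n)) ^ (m * ((\<lambda>n j m. a j) n RightSide m + 1))))) \<longlonglongrightarrow> 0"
      unfolding \<tau>_def
    proof (rule OU_prob_small_parts)
      show "\<forall>\<^sub>F n in sequentially. D n \<subseteq> odds_upto (peak_cutoff (sqrt 6 / pi * sqrt (real n)))"
        using cutoff[of "c / B"]
      proof eventually_elim
        case (elim n)
        have "c / B * \<tau> n = c * sqrt (real n)" using Bpos by (simp flip: \<tau>B)
        hence "m n \<le> peak_cutoff (\<tau> n)" using elim m_le[of n] by linarith
        thus ?case using odd_m[of n] by (auto simp: D_def odds_upto_def \<tau>_def)
      qed
      show "(\<lambda>n. real (card (D n)) / sqrt (sqrt 6 / pi * sqrt (real n))) \<longlonglongrightarrow> 0"
      proof (rule Lim_null_comparison)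
        show "\<forall>\<^sub>F n in sequentially. norm (real (card (D n)) / sqrt (sqrt 6 / pi * sqrt (real n))) \<le> 1 / sqrt (\<tau> n)"
          by (intro always_eventually allI) (auto simp: D_def \<tau>_def)
      qed (rule sqrt_\<tau>)
    qed
    hence "((\<lambda>n. OU_prob n (\<lambda>s. \<forall>m\<in>D n. \<forall>j. num_parts j m s \<le> a j) -
       (\<Prod>m\<in>D n. (1 - q n ^ (m * (vL + 1))) * (1 - q n ^ (m * (vR + 1))))) \<longlongrightarrow> 0) F"
      using le by (intro tendsto_mono[OF le]) (simp add: a_def q_def)
    moreover have "\<forall>\<^sub>F n in F. OU_prob n (\<lambda>s. \<forall>m\<in>D n. \<forall>j. num_parts j m s \<le> a j) -
       (\<Prod>m\<in>D n. (1 - q n ^ (m * (vL + 1))) * (1 - q n ^ (m * (vR + 1)))) =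
       OU_prob n (\<lambda>s. num_parts LeftSide (m n) s \<le> vL \<and> num_parts RightSide (m n) s \<le> vR) -
       (1 - q n ^ (m n * (vL + 1))) * (1 - q n ^ (m n * (vR + 1)))"
      unfolding F_def eventually_inf_principal
      by (intro always_eventually) (simp add: D_def all_side a_def)
    ultimately have 1: "((\<lambda>n. OU_prob n (\<lambda>s. num_parts LeftSide (m n) s \<le> vL \<and> num_parts RightSide (m n) s \<le> vR) -
       (1 - q n ^ (m n * (vL + 1))) * (1 - q n ^ (m n * (vR + 1)))) \<longlongrightarrow> 0) F"
      by (rule Lim_transform_eventually)
    have m_lim: "(\<lambda>n. real (m n) / \<tau> n) \<longlonglongrightarrow> c / B"
    proof (rule tendsto_sandwich[OF _ _ _ tendsto_const])
      show "\<forall>\<^sub>F n in sequentially. c / B - 1 / \<tau> n \<le> real (m n) / \<tau> n"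
        using eventually_gt_at_top[of 0]
      proof eventually_elim
        case (elim n)
        have \<tau>: "\<tau> n > 0" using elim by (simp add: \<tau>_def)
        have "c / B * \<tau> n = c * sqrt (real n)" using Bpos by (simp flip: \<tau>B)
        hence "(c / B * \<tau> n - 1) / \<tau> n \<le> real (m n) / \<tau> n"
          using m_le[of n] \<tau> by (intro divide_right_mono) auto
        thus ?case using \<tau> by (simp add: diff_divide_distrib)
      qed
      show "\<forall>\<^sub>F n in sequentially. real (m n) / \<tau> n \<le> c / B"
        using eventually_gt_at_top[of 0]
      proof eventually_elim
        case (elim n)
        have \<tau>: "\<tau> n > 0" using elim by (simp add: \<tau>_def)
        have "c / B * \<tau> n = c * sqrt (real n)" using Bpos by (simp flip: \<tau>B)
        hence "real (m n) \<le> c / B * \<tau> n" using m_le[of n] by simp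
        thus ?case using \<tau> by (simp add: pos_divide_le_eq)
      qed
      have "(\<lambda>n. 1 / \<tau> n) \<longlonglongrightarrow> 0" unfolding \<tau>_def by real_asymp
      from tendsto_diff[OF tendsto_const this, of "c / B"]
      show "(\<lambda>n. c / B - 1 / \<tau> n) \<longlonglongrightarrow> c / B" by simp
    qed
    have q_lim: "(\<lambda>n. q n ^ (m n * (w + 1))) \<longlonglongrightarrow> exp (- (c / B) * (real w + 1))" for w
    proof -
      have "(\<lambda>n. exp (- (real (m n) / \<tau> n) * (real w + 1))) \<longlonglongrightarrow> exp (- (c / B) * (real w + 1))"
        by (intro tendsto_intros m_lim)
      moreover have "exp (- (real (m n) / \<tau> n) * (real w + 1)) = q n ^ (m n * (w + 1))" for n
        by (simp add: q_def algebra_simps add_divide_distrib flip: exp_of_nat_mult)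
      ultimately show ?thesis by simp
    qed
    have "((\<lambda>n. (1 - q n ^ (m n * (vL + 1))) * (1 - q n ^ (m n * (vR + 1)))) \<longlongrightarrow>
        (1 - exp (- (c / B) * (real vL + 1))) * (1 - exp (- (c / B) * (real vR + 1)))) F"
      by (intro tendsto_mono[OF le] tendsto_mult tendsto_diff tendsto_const q_lim)
    from tendsto_add[OF 1 this]
    show "((\<lambda>n. OU_prob n (\<lambda>s.
                 num_parts LeftSide (nat \<lfloor>c * sqrt (real n)\<rfloor>) s \<le> vL \<and>
                 num_parts RightSide (nat \<lfloor>c * sqrt (real n)\<rfloor>) s \<le> vR))
          \<longlongrightarrow> (1 - exp (- (c / B) * (real vL + 1))) * (1 - exp (- (c / B) * (real vR + 1))))
        (inf sequentially (principal {n. odd \<lfloor>c * sqrt (real n)\<rfloor>}))"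
      by (simp add: F_def m_def)
  qed
qed

end
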